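(* Let $K$ be a field and let $n\ge d\ge 1$ be integers. Let $I_{n,d}$ be the squarefree Veronese ideal generated by all squarefree monomials of degree $d$ in $R=K[x_1,\dots,x_n]$, and let $\mathfrak{m}=(x_1,\dots,x_n)$ be the irrelevant maximal ideal of $R$. Let $\hat{R}=K[x_1,\dots,x_{n-d+1}]$, let $\hat{\mathfrak{m}}=\mathfrak{m}\cap\hat{R}=(x_1,\dots,x_{n-d+1})$ be the irrelevant maximal ideal of $\hat{R}$, and let $\hat{\mathfrak{m}}^d$ be the ideal of $\hat{R}$ generated by all monomials of degree $d$ in $\hat{R}$. Then $$\operatorname{Hdepth}(\hat{\mathfrak{m}}^d)+d-1=\operatorname{Hdepth}(I_{n,d}),$$ where $\hat{\mathfrak{m}}^d$ is regarded as a graded $\hat{R}$-module and $I_{n,d}$ as a graded $R$-module.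
   Context: Polynomial rings over $K$ carry the standard grading ($\deg x_i=1$). Hilbert depth: let $A$ be a polynomial ring over $K$ in finitely many variables and let $M$ be a finitely generated graded $A$-module. A Hilbert decomposition of $M$ is a finite family $\mathscr{H}=(S_i,s_i)$ such that $s_i\in\mathbb{Z}$, each $S_i$ is a graded $K$-algebra retract of $A$ (i.e. a graded $K$-algebra with graded $K$-algebra homomorphisms $S_i\to A\to S_i$ whose composition is the identity), and $M\cong\bigoplus_i S_i(-s_i)$ as graded $K$-vector spaces. Put $\operatorname{Hdepth}\mathscr{H}=\min_i \operatorname{depth} S_i(-s_i)$. The Hilbert depth of $M$ is $\operatorname{Hdepth} M=\max\{\operatorname{Hdepth}\mathscr{H} : \mathscr{H}\text{ is a Hilbert decomposition of } M\}$. *)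

theory Defs
  imports
    "HOL-Algebra.Algebra"
    "HOL-Algebra.Algebraic_Closure_Type"
    "HOL-Library.Poly_Mapping"
    "HOL-Library.Extended_Nat"
begin

section \<open>Graded vector spaces, algebras and modules\<close>

text \<open>
  Modules and algebras are the records of \<^theory>\<open>HOL-Algebra.Module\<close>, extended by the
  family of homogeneous components. As in that theory, the fields \<^const>\<open>monoid.mult\<close> and
  \<^const>\<open>one\<close> carry no meaning unless the structure is an algebra.
\<close>

record ('a, 'b) graded = "('a, 'b) module" +
  hcomp :: "int \<Rightarrow> 'b set"

text \<open>\<open>V\<close> is the internal direct sum of its homogeneous components.\<close>

definition graded_decomposition :: "'k ring \<Rightarrow> ('k, 'v) graded \<Rightarrow> bool" where
  "graded_decomposition K V \<longleftrightarrow>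
     (\<forall>t. submodule (hcomp V t) K V) \<and>
     (\<forall>x\<in>carrier V. \<exists>!c. (\<forall>t. c t \<in> hcomp V t) \<and> finite {t. c t \<noteq> \<zero>\<^bsub>V\<^esub>} \<and>
        x = finsum V c {t. c t \<noteq> \<zero>\<^bsub>V\<^esub>})"

definition graded_algebra :: "'k ring \<Rightarrow> ('k, 's) graded \<Rightarrow> bool" where
  "graded_algebra K S \<longleftrightarrow>
     algebra K S \<and> graded_decomposition K S \<and>
     (\<forall>s t. \<forall>x\<in>hcomp S s. \<forall>y\<in>hcomp S t. x \<otimes>\<^bsub>S\<^esub> y \<in> hcomp S (s + t))"

definition graded_algebra_hom ::
    "'k ring \<Rightarrow> ('k, 's) graded \<Rightarrow> ('k, 't) graded \<Rightarrow> ('s \<Rightarrow> 't) set" where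
  "graded_algebra_hom K S T =
     {f \<in> ring_hom S T.
        (\<forall>k\<in>carrier K. \<forall>x\<in>carrier S. f (k \<odot>\<^bsub>S\<^esub> x) = k \<odot>\<^bsub>T\<^esub> f x) \<and>
        (\<forall>t. f ` hcomp S t \<subseteq> hcomp T t)}"

text \<open>
  The elements of \<open>S\<close> are taken from the element type of \<open>A\<close>, but \<open>S\<close> has its own
  operations and need not be a subalgebra of \<open>A\<close>. Up to isomorphism this loses nothing,
  since \<open>\<iota>\<close> is injective.
\<close>

definition graded_retract :: "'k ring \<Rightarrow> ('k, 'a) graded \<Rightarrow> ('k, 'a) graded \<Rightarrow> bool" where
  "graded_retract K A S \<longleftrightarrow>
     graded_algebra K S \<and>
     (\<exists>\<iota>\<in>graded_algebra_hom K S A. \<exists>\<pi>\<in>graded_algebra_hom K A S.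
        \<forall>x\<in>carrier S. \<pi> (\<iota> x) = x)"

text \<open>\<open>shift M s\<close> is $M(s)$, that is $M(s)_t = M_{s+t}$.\<close>

definition shift :: "('a, 'm) graded \<Rightarrow> int \<Rightarrow> ('a, 'm) graded" where
  "shift M s = M\<lparr>hcomp := (\<lambda>t. hcomp M (s + t))\<rparr>"

text \<open>A homogeneous ideal \<open>I\<close> of \<open>A\<close>, regarded as a graded \<open>A\<close>-module.\<close>

definition ideal_module :: "('k, 'a) graded \<Rightarrow> 'a set \<Rightarrow> ('a, 'a) graded" where
  "ideal_module A I =
     \<lparr>carrier = I, monoid.mult = monoid.mult A, one = one A,
      ring.zero = ring.zero A, add = add A, module.smult = monoid.mult A, hcomp = (\<lambda>t. I \<inter> hcomp A t)\<rparr>"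

text \<open>Restriction of scalars along the structure map $K \to A$, $k \mapsto k \cdot 1$.\<close>

definition restrict_scalars :: "('k, 'a) graded \<Rightarrow> ('a, 'm) graded \<Rightarrow> ('k, 'm) graded" where
  "restrict_scalars A M =
     \<lparr>carrier = carrier M, monoid.mult = monoid.mult M, one = one M,
      ring.zero = ring.zero M, add = add M,
      module.smult = (\<lambda>k x. (k \<odot>\<^bsub>A\<^esub> \<one>\<^bsub>A\<^esub>) \<odot>\<^bsub>M\<^esub> x), hcomp = hcomp M\<rparr>"

definition direct_sum :: "('k, 'v) graded list \<Rightarrow> ('k, nat \<Rightarrow> 'v) graded" where
  "direct_sum Vs =
     \<lparr>carrier = (\<Pi>\<^sub>E i\<in>{..<length Vs}. carrier (Vs ! i)),
      monoid.mult = (\<lambda>f g. \<lambda>i\<in>{..<length Vs}. f i \<otimes>\<^bsub>Vs ! i\<^esub> g i),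
      one = (\<lambda>i\<in>{..<length Vs}. \<one>\<^bsub>Vs ! i\<^esub>),
      ring.zero = (\<lambda>i\<in>{..<length Vs}. \<zero>\<^bsub>Vs ! i\<^esub>),
      add = (\<lambda>f g. \<lambda>i\<in>{..<length Vs}. f i \<oplus>\<^bsub>Vs ! i\<^esub> g i),
      module.smult = (\<lambda>k f. \<lambda>i\<in>{..<length Vs}. k \<odot>\<^bsub>Vs ! i\<^esub> f i),
      hcomp = (\<lambda>t. \<Pi>\<^sub>E i\<in>{..<length Vs}. hcomp (Vs ! i) t)\<rparr>"

definition graded_vs_iso :: "'k ring \<Rightarrow> ('k, 'v) graded \<Rightarrow> ('k, 'w) graded \<Rightarrow> bool" where
  "graded_vs_iso K V W \<longleftrightarrow>
     (\<exists>f. bij_betw f (carrier V) (carrier W) \<and>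
        (\<forall>x\<in>carrier V. \<forall>y\<in>carrier V. f (x \<oplus>\<^bsub>V\<^esub> y) = f x \<oplus>\<^bsub>W\<^esub> f y) \<and>
        (\<forall>k\<in>carrier K. \<forall>x\<in>carrier V. f (k \<odot>\<^bsub>V\<^esub> x) = k \<odot>\<^bsub>W\<^esub> f x) \<and>
        (\<forall>t. f ` hcomp V t = hcomp W t))"


section \<open>Depth\<close>

definition irrelevant_ideal :: "('k, 's) graded \<Rightarrow> 's set" where
  "irrelevant_ideal S = genideal S (\<Union>t\<in>{0<..}. hcomp S t)"

text \<open>The submodule $(y_1, \dots, y_r)M = y_1 M + \dots + y_r M$.\<close>

definition seq_times_module :: "'s list \<Rightarrow> ('s, 'm) graded \<Rightarrow> 'm set" where
  "seq_times_module ys M =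
     {finsum M (\<lambda>j. (ys ! j) \<odot>\<^bsub>M\<^esub> u j) {..<length ys} | u. u \<in> {..<length ys} \<rightarrow> carrier M}"

definition regular_sequence :: "('k, 's) graded \<Rightarrow> ('s, 'm) graded \<Rightarrow> 's list \<Rightarrow> bool" where
  "regular_sequence S M ys \<longleftrightarrow>
     set ys \<subseteq> carrier S \<and>
     (\<forall>i<length ys. \<forall>x\<in>carrier M.
        (ys ! i) \<odot>\<^bsub>M\<^esub> x \<in> seq_times_module (take i ys) M \<longrightarrow>
        x \<in> seq_times_module (take i ys) M) \<and>
     seq_times_module ys M \<noteq> carrier M"

text \<open>
  The grade of the irrelevant ideal on \<open>M\<close>. Members of a regular sequence are not
  required to be homogeneous. The zero module has depth \<open>\<infinity>\<close>.
\<close>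

definition depth :: "('k, 's) graded \<Rightarrow> ('s, 'm) graded \<Rightarrow> enat" where
  "depth S M =
     (if carrier M = {\<zero>\<^bsub>M\<^esub>} then \<infinity>
      else SUP ys\<in>{ys. set ys \<subseteq> irrelevant_ideal S \<and> regular_sequence S M ys}.
             enat (length ys))"


section \<open>Hilbert depth\<close>

definition hilbert_decomposition ::
    "'k ring \<Rightarrow> ('k, 'a) graded \<Rightarrow> ('a, 'm) graded \<Rightarrow> (('k, 'a) graded \<times> int) list \<Rightarrow> bool" where
  "hilbert_decomposition K A M H \<longleftrightarrow>
     (\<forall>(S, s)\<in>set H. graded_retract K A S) \<and>
     graded_vs_iso K (restrict_scalars A M) (direct_sum (map (\<lambda>(S, s). shift S (- s)) H))"

text \<open>
  The depth of $S(-s)$ is taken as a graded $S$-module. The infimum over the empty family,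
  which decomposes only the zero module, is \<open>\<infinity>\<close>.
\<close>

definition hdepth_decomposition :: "(('k, 'a) graded \<times> int) list \<Rightarrow> enat" where
  "hdepth_decomposition H =
     (INF (S, s)\<in>set H. depth S (shift (ideal_module S (carrier S)) (- s)))"

text \<open>Meant for a polynomial ring \<open>A\<close> over \<open>K\<close> and a finitely generated graded \<open>A\<close>-module \<open>M\<close>.\<close>

definition Hdepth :: "'k ring \<Rightarrow> ('k, 'a) graded \<Rightarrow> ('a, 'm) graded \<Rightarrow> enat" where
  "Hdepth K A M = Max {hdepth_decomposition H | H. hilbert_decomposition K A M H}"


section \<open>Polynomial rings and the two ideals\<close>

type_synonym 'k mpoly = "(nat \<Rightarrow>\<^sub>0 nat) \<Rightarrow>\<^sub>0 'k"

definition monomial_degree :: "(nat \<Rightarrow>\<^sub>0 nat) \<Rightarrow> nat" where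
  "monomial_degree m = (\<Sum>i\<in>Poly_Mapping.keys m. Poly_Mapping.lookup m i)"

text \<open>$K[x_1, \dots, x_n]$ with the standard grading, as a subring of $K[x_0, x_1, \dots]$.\<close>

definition polynomial_ring :: "nat \<Rightarrow> ('k::field, 'k mpoly) graded" where
  "polynomial_ring n =
     (let P = {p. \<forall>m\<in>Poly_Mapping.keys p. Poly_Mapping.keys m \<subseteq> {1..n}} in
      \<lparr>carrier = P, monoid.mult = (*), one = 1, ring.zero = 0, add = (+),
       module.smult = (\<lambda>k p. Poly_Mapping.single 0 k * p),
       hcomp = (\<lambda>t. {p \<in> P. \<forall>m\<in>Poly_Mapping.keys p. int (monomial_degree m) = t})\<rparr>)"

definition squarefree_veronese :: "nat \<Rightarrow> nat \<Rightarrow> 'k::field mpoly set" where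
  "squarefree_veronese n d =
     genideal (polynomial_ring n)
       {Poly_Mapping.single m 1 | m.
          Poly_Mapping.keys m \<subseteq> {1..n} \<and> monomial_degree m = d \<and> (\<forall>i. Poly_Mapping.lookup m i \<le> 1)}"

text \<open>The $d$-th power of the irrelevant maximal ideal of $K[x_1, \dots, x_n]$.\<close>

definition maximal_ideal_power :: "nat \<Rightarrow> nat \<Rightarrow> 'k::field mpoly set" where
  "maximal_ideal_power n d =
     genideal (polynomial_ring n)
       {Poly_Mapping.single m 1 | m. Poly_Mapping.keys m \<subseteq> {1..n} \<and> monomial_degree m = d}"

end

theory Submission
  imports Defs
begin

text \<open>
  Both Hilbert depths are determined by Hilbert functions, and the Hilbert series of the two
  ideals differ by a power of \<open>1 - T\<close>.

  A graded retract \<open>S\<close> of a polynomial ring in \<open>n\<close> variables is generated by \<open>S\<^sub>1\<close>, which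
  embeds into the space of linear forms. Hence \<open>S\<close> is a polynomial ring in \<open>r \<le> n\<close> variables
  (\<open>graded_retract_polynomial_ring\<close>), and \<open>S(-s)\<close> has depth \<open>r\<close>
  (\<open>depth_of_polynomial_algebra\<close>). So up to isomorphism a Hilbert decomposition of an ideal
  spanned by monomials is a list of pairs \<open>(r, s)\<close> with \<open>r \<le> n\<close> for which the Hilbert series of
  the ideal is the sum of the terms \<open>T^s / (1 - T)^r\<close>, and its value is the least \<open>r\<close> that occurs
  (\<open>Hdepth_supported_on\<close>).

  That a polynomial ring in \<open>r\<close> variables has no regular sequence longer than \<open>r\<close> is shown
  without dimension theory: the members of a regular sequence are algebraically independent over \<open>K\<close>
  (\<open>substitute_regular_eq_zero\<close>), and \<open>k\<close> algebraically independent polynomials have too many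
  independent products of bounded degree when \<open>k > r\<close> (\<open>length_regular_polynomials_le\<close>).

  Write \<open>V(n, d)\<close> for the Hilbert series of the squarefree Veronese ideal and \<open>P(m, d)\<close> for that of
  the \<open>d\<close>-th power of the maximal ideal in \<open>m\<close> variables. Sorting monomials by whether the
  last variable divides them gives
  \<open>(1 - T) V(n + 1, d + 1) = (1 - T) V(n, d + 1) + T V(n, d)\<close> and
  \<open>P(m + 1, d + 1) = P(m, d + 1) + T P(m + 1, d)\<close>, and induction yields
  \<open>(1 - T)^(d - 1) V(n, d) = P(n - d + 1, d)\<close> (\<open>funpow_backward_diff_veronese_hilbert\<close>).
  Therefore adding \<open>d - 1\<close> to every \<open>r\<close> turns the pairs of a decomposition of the power into
  those of a decomposition of the Veronese ideal. Conversely \<open>d - 1\<close> can be subtracted as soon as all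
  \<open>r\<close> are at least \<open>d - 1\<close>; this holds for an optimal decomposition of the Veronese ideal, because
  it is at least as good as one that comes from the power (\<open>Max_pairs_veronese\<close>).
\<close>

section \<open>Polynomials supported on a set of monomials\<close>

lemma lookup_sum_singles:
  assumes "finite A"
  shows "Poly_Mapping.lookup (\<Sum>m\<in>A. Poly_Mapping.single m (f m)) k = (if k \<in> A then f k else 0)"
  using assms by (simp add: lookup_sum lookup_single when_def sum.delta)

lemma sum_singles:
  assumes "finite A" "Poly_Mapping.keys p \<subseteq> A"
  shows "(\<Sum>m\<in>A. Poly_Mapping.single m (Poly_Mapping.lookup p m)) = p"
  by (rule poly_mapping_eqI) (use assms in \<open>auto simp: lookup_sum_singles in_keys_iff\<close>)

lemma lookup_const_mult:
  "Poly_Mapping.lookup (Poly_Mapping.single 0 c * p) m = (c::'a::field) * Poly_Mapping.lookup p (m::'x::comm_monoid_add)"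
  by (simp add: mult_map_scale_conv_mult[symmetric] Poly_Mapping.map.rep_eq when_def)

lemma monomial_degree_add: "monomial_degree (a + b) = monomial_degree a + monomial_degree b"
  unfolding monomial_degree_def by (rule setsum_keys_plus_distrib) auto

lemma monomial_degree_zero [simp]: "monomial_degree 0 = 0"
  by (simp add: monomial_degree_def)

lemma monomial_degree_single [simp]: "monomial_degree (Poly_Mapping.single i c) = c"
  by (simp add: monomial_degree_def)

lemma keys_add_nat: "Poly_Mapping.keys (a + b :: 'x \<Rightarrow>\<^sub>0 nat) = Poly_Mapping.keys a \<union> Poly_Mapping.keys b"
  by (auto simp: in_keys_iff lookup_add)

text \<open>For a monomial ideal the monomials in it form a \<open>K\<close>-basis. Up to isomorphism
  every graded piece of the rings and ideals below is of this kind.\<close>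

definition supported_on :: "'x set \<Rightarrow> ('x \<Rightarrow>\<^sub>0 'k::zero) set" where
  "supported_on U = {p. Poly_Mapping.keys p \<subseteq> U}"

definition monomials :: "nat \<Rightarrow> (nat \<Rightarrow>\<^sub>0 nat) set" where
  "monomials n = {m. Poly_Mapping.keys m \<subseteq> {1..n}}"

lemma supported_on_iff: "p \<in> supported_on U \<longleftrightarrow> (\<forall>m. m \<notin> U \<longrightarrow> Poly_Mapping.lookup p m = 0)"
  by (auto simp: supported_on_def in_keys_iff)

lemma supported_on_mono: "U \<subseteq> V \<Longrightarrow> supported_on U \<subseteq> supported_on V"
  by (auto simp: supported_on_def)

lemma zero_supported_on [simp]: "0 \<in> supported_on U"
  by (simp add: supported_on_def)

lemma add_supported_on: "p \<in> supported_on U \<Longrightarrow> q \<in> supported_on U \<Longrightarrow> p + q \<in> supported_on (U :: 'x set)"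
  for p q :: "'x \<Rightarrow>\<^sub>0 'k::comm_monoid_add"
  by (simp add: supported_on_iff lookup_add)

lemma uminus_supported_on: "p \<in> supported_on U \<Longrightarrow> - p \<in> supported_on U"
  for p :: "'x \<Rightarrow>\<^sub>0 'k::ab_group_add"
  by (simp add: supported_on_iff)

lemma const_mult_supported_on:
  "p \<in> supported_on U \<Longrightarrow> Poly_Mapping.single 0 c * p \<in> supported_on (U :: 'x::comm_monoid_add set)"
  for c :: "'k::field"
  by (simp add: supported_on_iff lookup_const_mult)

lemma sum_supported_on:
  fixes f :: "'i \<Rightarrow> 'x \<Rightarrow>\<^sub>0 'k::comm_monoid_add"
  shows "(\<And>i. i \<in> A \<Longrightarrow> f i \<in> supported_on U) \<Longrightarrow> sum f A \<in> supported_on U"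
  by (induction A rule: infinite_finite_induct) (auto intro: add_supported_on)

lemma single_supported_on: "m \<in> U \<Longrightarrow> Poly_Mapping.single m c \<in> supported_on U"
  by (simp add: supported_on_def)

lemma mult_supported_on:
  fixes p q :: "'x::comm_monoid_add \<Rightarrow>\<^sub>0 'k::field"
  assumes "p \<in> supported_on U" "q \<in> supported_on V" "\<And>u v. u \<in> U \<Longrightarrow> v \<in> V \<Longrightarrow> u + v \<in> W"
  shows "p * q \<in> supported_on W"
proof -
  have "Poly_Mapping.keys (p * q) \<subseteq> {a + b |a b. a \<in> Poly_Mapping.keys p \<and> b \<in> Poly_Mapping.keys q}"
    by (rule keys_mult)
  then show ?thesis using assms by (fastforce simp: supported_on_def)
qed

lemma zero_in_monomials [simp]: "0 \<in> monomials n"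
  by (simp add: monomials_def)

lemma add_in_monomials: "a \<in> monomials n \<Longrightarrow> b \<in> monomials n \<Longrightarrow> a + b \<in> monomials n"
  by (simp add: monomials_def keys_add_nat)

lemma add_in_monomialsD: "a + b \<in> monomials n \<Longrightarrow> a \<in> monomials n \<and> b \<in> monomials n"
  by (simp add: monomials_def keys_add_nat)

section \<open>The polynomial ring as a graded algebra\<close>

lemma polynomial_ring_simps:
  "carrier (polynomial_ring n) = supported_on (monomials n)"
  "monoid.mult (polynomial_ring n) = (*)"
  "one (polynomial_ring n) = 1"
  "ring.zero (polynomial_ring n) = 0"
  "add (polynomial_ring n) = (+)"
  "module.smult (polynomial_ring n) = (\<lambda>k p. Poly_Mapping.single 0 k * p)"
  "hcomp (polynomial_ring n) t = supported_on {m \<in> monomials n. int (monomial_degree m) = t}"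
  by (auto simp: polynomial_ring_def Let_def supported_on_def monomials_def)

lemma ring_of_type_algebra_simps:
  "carrier (ring_of_type_algebra :: 'k::field ring) = UNIV"
  "monoid.mult (ring_of_type_algebra :: 'k::field ring) = (*)"
  "one (ring_of_type_algebra :: 'k::field ring) = 1"
  "ring.zero (ring_of_type_algebra :: 'k::field ring) = 0"
  "add (ring_of_type_algebra :: 'k::field ring) = (+)"
  by (simp_all add: ring_of_type_algebra_def fun_eq_iff)

lemma one_in_polys [simp]: "(1 :: 'k::field mpoly) \<in> supported_on (monomials n)"
  by (simp add: supported_on_def)

lemma mult_in_polys: "p \<in> supported_on (monomials n) \<Longrightarrow> q \<in> supported_on (monomials n) \<Longrightarrow>
    p * q \<in> supported_on (monomials n)" for p q :: "'k::field mpoly"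
  by (rule mult_supported_on) (auto intro: add_in_monomials)

lemma cring_polynomial_ring: "cring (polynomial_ring n :: ('k::field, 'k mpoly) graded)"
proof (rule cringI)
  show "abelian_group (polynomial_ring n :: ('k, 'k mpoly) graded)"
  proof (rule abelian_groupI)
    fix x :: "'k mpoly" assume "x \<in> carrier (polynomial_ring n)"
    then have "- x \<in> carrier (polynomial_ring n)"
      by (simp add: polynomial_ring_simps uminus_supported_on)
    then show "\<exists>y\<in>carrier (polynomial_ring n). y \<oplus>\<^bsub>polynomial_ring n\<^esub> x = \<zero>\<^bsub>polynomial_ring n\<^esub>"
      by (intro bexI[of _ "- x"]) (simp_all add: polynomial_ring_simps)
  qed (simp_all add: polynomial_ring_simps add_supported_on algebra_simps)
  show "comm_monoid (polynomial_ring n :: ('k, 'k mpoly) graded)"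
    by unfold_locales (auto simp add: polynomial_ring_simps algebra_simps mult_in_polys)
qed (simp add: polynomial_ring_simps algebra_simps)

lemma algebra_polynomial_ring:
  "algebra (ring_of_type_algebra :: 'k::field ring) (polynomial_ring n)"
proof (rule algebraI)
  show "cring (ring_of_type_algebra :: 'k::field ring)" ..
  show "cring (polynomial_ring n :: ('k, 'k mpoly) graded)"
    by (rule cring_polynomial_ring)
qed (simp_all add: polynomial_ring_simps ring_of_type_algebra_simps const_mult_supported_on
   single_add distrib_left distrib_right mult.assoc mult_single)

definition homogeneous_part :: "int \<Rightarrow> 'k::field mpoly \<Rightarrow> 'k mpoly" where
  "homogeneous_part t p =
     (\<Sum>m\<in>{m \<in> Poly_Mapping.keys p. int (monomial_degree m) = t}. Poly_Mapping.single m (Poly_Mapping.lookup p m))"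

lemma lookup_homogeneous_part:
  "Poly_Mapping.lookup (homogeneous_part t p) m =
     (if int (monomial_degree m) = t then Poly_Mapping.lookup p m else 0)"
  by (simp add: homogeneous_part_def lookup_sum_singles in_keys_iff)

lemma finsum_polynomial_ring:
  assumes "finite A" "f \<in> A \<rightarrow> supported_on (monomials n)"
  shows "finsum (polynomial_ring n :: ('k::field, 'k mpoly) graded) f A = sum f A"
proof -
  interpret cring "polynomial_ring n :: ('k, 'k mpoly) graded" by (rule cring_polynomial_ring)
  show ?thesis using assms
    by (induction A rule: finite_induct) (simp_all add: polynomial_ring_simps Pi_iff)
qed

lemma graded_decomposition_polynomial_ring:
  "graded_decomposition (ring_of_type_algebra :: 'k::field ring) (polynomial_ring n)"
  unfolding graded_decomposition_def
proof (intro conjI allI ballI)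
  let ?K = "ring_of_type_algebra :: 'k ring" and ?P = "polynomial_ring n :: ('k, 'k mpoly) graded"
  fix t
  interpret algebra ?K ?P by (rule algebra_polynomial_ring)
  have "subgroup (hcomp ?P t) (add_monoid ?P)"
  proof
    fix x assume x: "x \<in> hcomp ?P t"
    then have xc: "x \<in> carrier ?P"
      by (auto simp: polynomial_ring_simps supported_on_def)
    have "- x \<in> carrier ?P" using xc by (simp add: polynomial_ring_simps uminus_supported_on)
    moreover have "- x \<oplus>\<^bsub>?P\<^esub> x = \<zero>\<^bsub>?P\<^esub>" by (simp add: polynomial_ring_simps)
    ultimately have "inv\<^bsub>add_monoid ?P\<^esub> x = - x"
      using M.minus_equality[of "- x" x] xc by (simp add: a_inv_def)
    then show "inv\<^bsub>add_monoid ?P\<^esub> x \<in> hcomp ?P t"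
      using x by (simp add: polynomial_ring_simps uminus_supported_on)
  qed (auto simp: polynomial_ring_simps add_supported_on, auto simp: supported_on_def)
  then show "submodule (hcomp ?P t) ?K ?P"
    by (intro submodule.intro submodule_axioms.intro)
       (simp_all add: polynomial_ring_simps const_mult_supported_on)
next
  let ?K = "ring_of_type_algebra :: 'k ring" and ?P = "polynomial_ring n :: ('k, 'k mpoly) graded"
  fix x :: "'k mpoly" assume x: "x \<in> carrier ?P"
  let ?c = "\<lambda>t. homogeneous_part t x"
  have c_in: "\<forall>t. ?c t \<in> hcomp ?P t"
    using x by (auto simp: polynomial_ring_simps supported_on_iff lookup_homogeneous_part)
  have sub: "hcomp ?P t \<subseteq> supported_on (monomials n)" for t
    by (auto simp: polynomial_ring_simps supported_on_def)
  have "{t. ?c t \<noteq> 0} \<subseteq> (\<lambda>m. int (monomial_degree m)) ` Poly_Mapping.keys x"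
  proof
    fix t assume "t \<in> {t. ?c t \<noteq> 0}"
    then obtain m where "Poly_Mapping.lookup (?c t) m \<noteq> 0"
      by (metis (mono_tags) lookup_zero mem_Collect_eq poly_mapping_eqI)
    then show "t \<in> (\<lambda>m. int (monomial_degree m)) ` Poly_Mapping.keys x"
      by (auto simp: lookup_homogeneous_part in_keys_iff split: if_splits)
  qed
  then have fin: "finite {t. ?c t \<noteq> 0}"
    by (rule finite_subset) simp
  have comp: "Poly_Mapping.lookup (c (int (monomial_degree m))) m = Poly_Mapping.lookup (sum c {t. c t \<noteq> 0}) m"
    if c: "\<forall>t. c t \<in> hcomp ?P t" "finite {t. c t \<noteq> 0}" for c m
  proof -
    let ?t = "int (monomial_degree m)"
    have z: "Poly_Mapping.lookup (c t) m = 0" if "t \<noteq> ?t" for t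
      using c(1) that by (auto simp: polynomial_ring_simps supported_on_iff)
    have "Poly_Mapping.lookup (sum c {t. c t \<noteq> 0}) m = (\<Sum>t | c t \<noteq> 0. if t = ?t then Poly_Mapping.lookup (c ?t) m else 0)"
      unfolding lookup_sum by (rule sum.cong) (use z in auto)
    also have "\<dots> = Poly_Mapping.lookup (c ?t) m"
      using c(2) by (simp add: sum.delta)
    finally show ?thesis by simp
  qed
  have finsum: "finsum ?P c {t. c t \<noteq> \<zero>\<^bsub>?P\<^esub>} = sum c {t. c t \<noteq> 0}"
    if c: "\<forall>t. c t \<in> hcomp ?P t" "finite {t. c t \<noteq> 0}" for c
    using c sub by (subst finsum_polynomial_ring) (auto simp: polynomial_ring_simps(4))
  show "\<exists>!c. (\<forall>t. c t \<in> hcomp ?P t) \<and> finite {t. c t \<noteq> \<zero>\<^bsub>?P\<^esub>} \<and> x = finsum ?P c {t. c t \<noteq> \<zero>\<^bsub>?P\<^esub>}"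
  proof (rule ex1I[of _ ?c])
    have "x = sum ?c {t. ?c t \<noteq> 0}"
      by (rule poly_mapping_eqI) (simp add: comp[OF c_in fin, symmetric] lookup_homogeneous_part)
    then show "(\<forall>t. ?c t \<in> hcomp ?P t) \<and> finite {t. ?c t \<noteq> \<zero>\<^bsub>?P\<^esub>} \<and> x = finsum ?P ?c {t. ?c t \<noteq> \<zero>\<^bsub>?P\<^esub>}"
      using c_in fin finsum[OF c_in fin] by (simp add: polynomial_ring_simps(4))
  next
    fix c assume c: "(\<forall>t. c t \<in> hcomp ?P t) \<and> finite {t. c t \<noteq> \<zero>\<^bsub>?P\<^esub>} \<and> x = finsum ?P c {t. c t \<noteq> \<zero>\<^bsub>?P\<^esub>}"
    then have c1: "\<forall>t. c t \<in> hcomp ?P t" and c2: "finite {t. c t \<noteq> 0}"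
      by (simp_all add: polynomial_ring_simps(4))
    have xs: "x = sum c {t. c t \<noteq> 0}" using c finsum[OF c1 c2] by simp
    show "c = ?c"
    proof
      fix t show "c t = ?c t"
      proof (rule poly_mapping_eqI)
        fix m
        show "Poly_Mapping.lookup (c t) m = Poly_Mapping.lookup (?c t) m"
        proof (cases "int (monomial_degree m) = t")
          case True
          then show ?thesis using comp[OF c1 c2, of m] xs by (simp add: lookup_homogeneous_part)
        next
          case False
          then show ?thesis using c1 by (auto simp: lookup_homogeneous_part polynomial_ring_simps supported_on_iff)
        qed
      qed
    qed
  qed
qed

lemma graded_algebra_polynomial_ring:
  "graded_algebra (ring_of_type_algebra :: 'k::field ring) (polynomial_ring n)"
  unfolding graded_algebra_def
  by (auto simp: algebra_polynomial_ring graded_decomposition_polynomial_ring)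
     (auto simp: polynomial_ring_simps monomial_degree_add intro: add_in_monomials
       intro!: mult_supported_on)

section \<open>Linear algebra of coefficients\<close>

text \<open>Scalar multiplication for an arbitrary index type, so that coordinate spaces and polynomials
  are treated alike. For polynomials it is multiplication by a constant.\<close>

definition scale :: "'k::field \<Rightarrow> ('x \<Rightarrow>\<^sub>0 'k) \<Rightarrow> ('x \<Rightarrow>\<^sub>0 'k)" where
  "scale c p = Poly_Mapping.map ((*) c) p"

lemma lookup_scale [simp]: "Poly_Mapping.lookup (scale c p) x = c * Poly_Mapping.lookup p x"
  by (simp add: scale_def Poly_Mapping.map.rep_eq when_def)

lemma const_mult_eq_scale: "Poly_Mapping.single 0 c * p = scale c (p :: 'x::comm_monoid_add \<Rightarrow>\<^sub>0 'k::field)"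
  by (simp add: scale_def mult_map_scale_conv_mult)

interpretation pm: vector_space "scale :: 'k::field \<Rightarrow> ('x \<Rightarrow>\<^sub>0 'k) \<Rightarrow> _"
  by unfold_locales (rule poly_mapping_eqI; simp add: lookup_add algebra_simps)+

interpretation pm_pair: vector_space_pair
  "scale :: 'k::field \<Rightarrow> ('x \<Rightarrow>\<^sub>0 'k) \<Rightarrow> _" "scale :: 'k::field \<Rightarrow> ('y \<Rightarrow>\<^sub>0 'k) \<Rightarrow> _" ..

lemma subspace_supported_on: "pm.subspace (supported_on U)"
  by (auto simp: pm.subspace_def supported_on_iff lookup_add)

lemma scale_single: "scale c (Poly_Mapping.single x a) = Poly_Mapping.single x (c * a)"
  by (rule poly_mapping_eqI) (simp add: lookup_single when_def)

lemma span_singles: "pm.span ((\<lambda>x. Poly_Mapping.single x 1) ` U) = (supported_on U :: ('x \<Rightarrow>\<^sub>0 'k::field) set)"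
proof
  show "pm.span ((\<lambda>x. Poly_Mapping.single x 1) ` U) \<subseteq> (supported_on U :: ('x \<Rightarrow>\<^sub>0 'k::field) set)"
    by (intro pm.span_minimal subspace_supported_on) (auto intro: single_supported_on)
  show "(supported_on U :: ('x \<Rightarrow>\<^sub>0 'k::field) set) \<subseteq> pm.span ((\<lambda>x. Poly_Mapping.single x 1) ` U)"
  proof
    fix p :: "'x \<Rightarrow>\<^sub>0 'k" assume p: "p \<in> supported_on U"
    have "p = (\<Sum>x\<in>Poly_Mapping.keys p. scale (Poly_Mapping.lookup p x) (Poly_Mapping.single x 1))"
      by (simp add: scale_single sum_singles)
    also have "\<dots> \<in> pm.span ((\<lambda>x. Poly_Mapping.single x 1) ` U)"
      using p by (intro pm.span_sum pm.span_scale pm.span_base) (auto simp: supported_on_def)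
    finally show "p \<in> pm.span ((\<lambda>x. Poly_Mapping.single x 1) ` U)" .
  qed
qed

text \<open>The two spaces have bases indexed by \<open>U\<close> and \<open>V\<close>, so this compares dimensions. \<open>F\<close> is linear only
  on the subspace, which is why the images of the basis vectors are shown to be independent by hand.\<close>

lemma card_le_of_injective_linear:
  fixes F :: "('x \<Rightarrow>\<^sub>0 'k::field) \<Rightarrow> ('y \<Rightarrow>\<^sub>0 'k)"
  assumes "finite U" "finite V"
    and add: "\<And>p q. p \<in> supported_on U \<Longrightarrow> q \<in> supported_on U \<Longrightarrow> F (p + q) = F p + F q"
    and scale: "\<And>c p. p \<in> supported_on U \<Longrightarrow> F (scale c p) = scale c (F p)"
    and inj: "inj_on F (supported_on U)"
    and into: "F ` supported_on U \<subseteq> supported_on V"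
  shows "card U \<le> card V"
proof -
  let ?e = "\<lambda>x. Poly_Mapping.single x (1::'k)"
  have F0: "F 0 = 0" using add[of 0 0] by simp
  have Fsum: "F (\<Sum>x\<in>A. f x) = (\<Sum>x\<in>A. F (f x))" if "\<And>x. x \<in> A \<Longrightarrow> f x \<in> supported_on U" for A and f :: "'x \<Rightarrow> _"
    using that by (induction A rule: infinite_finite_induct) (auto simp: F0 add sum_supported_on)
  have e: "?e x \<in> supported_on U" if "x \<in> U" for x
    using that by (rule single_supported_on)
  have injFe: "inj_on (\<lambda>x. F (?e x)) U"
  proof (rule inj_onI)
    fix x y assume "x \<in> U" "y \<in> U" "F (?e x) = F (?e y)"
    then have "?e x = ?e y" using inj e by (auto dest: inj_onD)
    then show "x = y" by (metis lookup_single_eq lookup_single_not_eq zero_neq_one)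
  qed
  have "pm.independent ((\<lambda>x. F (?e x)) ` U)"
  proof (rule pm.independent_if_scalars_zero)
    fix f v assume s: "(\<Sum>v\<in>(\<lambda>x. F (?e x)) ` U. scale (f v) v) = 0" and v: "v \<in> (\<lambda>x. F (?e x)) ` U"
    let ?p = "\<Sum>x\<in>U. Poly_Mapping.single x (f (F (?e x)))"
    have "F ?p = (\<Sum>x\<in>U. F (Poly_Mapping.single x (f (F (?e x)))))"
      by (intro Fsum single_supported_on)
    also have "\<dots> = (\<Sum>x\<in>U. scale (f (F (?e x))) (F (?e x)))"
      by (intro sum.cong refl) (metis e mult.right_neutral scale scale_single)
    also have "\<dots> = (\<Sum>v\<in>(\<lambda>x. F (?e x)) ` U. scale (f v) v)"
      using injFe by (simp add: sum.reindex)
    finally have "F ?p = F 0" using s F0 by simp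
    moreover have "?p \<in> supported_on U" by (intro sum_supported_on single_supported_on)
    ultimately have "?p = 0" using inj by (auto dest: inj_onD)
    then have z: "Poly_Mapping.lookup ?p x = 0" for x by simp
    obtain x where x: "x \<in> U" "v = F (?e x)" using v by blast
    show "f v = 0" using z[of x] x(1) unfolding lookup_sum_singles[OF \<open>finite U\<close>] x(2) by simp
  qed (use \<open>finite U\<close> in simp)
  moreover have "(\<lambda>x. F (?e x)) ` U \<subseteq> pm.span (?e ` V)"
    using into e by (auto simp: span_singles)
  ultimately have "card ((\<lambda>x. F (?e x)) ` U) \<le> card (?e ` V)"
    using pm.independent_span_bound \<open>finite V\<close> by blast
  also have "\<dots> \<le> card V" using \<open>finite V\<close> by (rule card_image_le)
  finally show ?thesis using injFe by (simp add: card_image)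
qed

section \<open>Substitution homomorphisms\<close>

definition Var :: "nat \<Rightarrow> 'k::field mpoly" where
  "Var i = Poly_Mapping.single (Poly_Mapping.single i 1) 1"

definition monomial_value :: "(nat \<Rightarrow> 'k::field mpoly) \<Rightarrow> (nat \<Rightarrow>\<^sub>0 nat) \<Rightarrow> 'k mpoly" where
  "monomial_value g m = (\<Prod>i\<in>Poly_Mapping.keys m. g i ^ Poly_Mapping.lookup m i)"

definition substitute :: "(nat \<Rightarrow> 'k::field mpoly) \<Rightarrow> 'k mpoly \<Rightarrow> 'k mpoly" where
  "substitute g p = (\<Sum>m\<in>Poly_Mapping.keys p. scale (Poly_Mapping.lookup p m) (monomial_value g m))"

lemma monomial_value_superset:
  "finite A \<Longrightarrow> Poly_Mapping.keys m \<subseteq> A \<Longrightarrow> monomial_value g m = (\<Prod>i\<in>A. g i ^ Poly_Mapping.lookup m i)"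
  unfolding monomial_value_def by (rule prod.mono_neutral_left) (auto simp: in_keys_iff)

lemma monomial_value_add: "monomial_value g (a + b) = monomial_value g a * monomial_value g b"
proof -
  let ?A = "Poly_Mapping.keys a \<union> Poly_Mapping.keys b"
  show ?thesis
    by (subst (1 2 3) monomial_value_superset[of ?A])
       (auto simp: keys_add_nat lookup_add power_add prod.distrib)
qed

lemma monomial_value_zero [simp]: "monomial_value g 0 = 1"
  by (simp add: monomial_value_def)

lemma substitute_superset:
  "finite A \<Longrightarrow> Poly_Mapping.keys p \<subseteq> A \<Longrightarrow> substitute g p = (\<Sum>m\<in>A. scale (Poly_Mapping.lookup p m) (monomial_value g m))"
  unfolding substitute_def by (rule sum.mono_neutral_left) (auto simp: in_keys_iff)

lemma substitute_add: "substitute g (p + q) = substitute g p + substitute g q"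
proof -
  let ?A = "Poly_Mapping.keys p \<union> Poly_Mapping.keys q"
  have "Poly_Mapping.keys (p + q) \<subseteq> ?A" by (rule keys_add)
  then show ?thesis
    by (subst (1 2 3) substitute_superset[of ?A]) (auto simp: lookup_add pm.scale_left_distrib sum.distrib)
qed

lemma substitute_scale: "substitute g (scale c p) = scale c (substitute g p)"
  by (subst substitute_superset[of "Poly_Mapping.keys p"])
     (auto simp: in_keys_iff substitute_def pm.scale_sum_right)

lemma substitute_zero [simp]: "substitute g 0 = 0"
  by (simp add: substitute_def)

lemma linear_substitute: "Vector_Spaces.linear scale scale (substitute g)"
  by (simp add: Vector_Spaces.linear_iff substitute_add substitute_scale pm.vector_space_axioms)

lemma substitute_sum: "substitute g (sum f A) = (\<Sum>x\<in>A. substitute g (f x))"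
  by (induction A rule: infinite_finite_induct) (auto simp: substitute_add)

lemma substitute_single: "substitute g (Poly_Mapping.single m c) = scale c (monomial_value g m)"
  by (cases "c = 0") (simp_all add: substitute_def)

lemma scale_mult_left: "scale c (p::'x::comm_monoid_add \<Rightarrow>\<^sub>0 'k::field) * q = scale c (p * q)"
  by (simp add: const_mult_eq_scale[symmetric] mult.assoc)

lemma scale_mult_right: "p * scale c (q::'x::comm_monoid_add \<Rightarrow>\<^sub>0 'k::field) = scale c (p * q)"
  by (simp add: const_mult_eq_scale[symmetric] mult.left_commute)

lemma substitute_mult: "substitute g (p * q) = substitute g p * substitute g q"
proof -
  let ?P = "Poly_Mapping.keys p" and ?Q = "Poly_Mapping.keys q"
  let ?p = "Poly_Mapping.lookup p" and ?q = "Poly_Mapping.lookup q"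
  have "p * q = (\<Sum>a\<in>?P. Poly_Mapping.single a (?p a)) * (\<Sum>b\<in>?Q. Poly_Mapping.single b (?q b))"
    by (simp add: sum_singles)
  also have "\<dots> = (\<Sum>a\<in>?P. \<Sum>b\<in>?Q. Poly_Mapping.single (a + b) (?p a * ?q b))"
    by (simp add: sum_product mult_single)
  finally have "substitute g (p * q) = (\<Sum>a\<in>?P. \<Sum>b\<in>?Q. scale (?p a * ?q b) (monomial_value g a * monomial_value g b))"
    by (simp add: substitute_sum substitute_single monomial_value_add)
  also have "\<dots> = substitute g p * substitute g q"
    by (simp add: substitute_def sum_product scale_mult_left scale_mult_right mult.commute)
  finally show ?thesis .
qed

lemma single_zero_eq_scale: "Poly_Mapping.single 0 c = scale c (1 :: 'x::comm_monoid_add \<Rightarrow>\<^sub>0 'k::field)"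
  by (simp add: const_mult_eq_scale[symmetric])

lemma substitute_one [simp]: "substitute g 1 = 1"
  using substitute_single[of g 0 1] by (simp del: single_one add: single_one[symmetric])

lemma monomial_value_single: "monomial_value g (Poly_Mapping.single i 1) = g i"
  by (simp add: monomial_value_def)

lemma substitute_Var [simp]: "substitute g (Var i) = g i"
  by (simp add: Var_def substitute_single monomial_value_single del: One_nat_def)

lemma Var_power: "Var i ^ k = Poly_Mapping.single (Poly_Mapping.single i k) (1::'k::field)"
  by (induction k) (simp_all add: Var_def mult_single single_add[symmetric])

lemma monomial_value_Var: "monomial_value Var m = Poly_Mapping.single m (1::'k::field)"
proof -
  have "finite A \<Longrightarrow> (\<Prod>i\<in>A. Poly_Mapping.single (Poly_Mapping.single i (f i)) (1::'k)) =
    Poly_Mapping.single (\<Sum>i\<in>A. Poly_Mapping.single i (f i)) 1" for A :: "nat set" and f :: "nat \<Rightarrow> nat"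
    by (induction A rule: finite_induct) (simp_all add: mult_single)
  then show ?thesis
    by (simp add: monomial_value_def Var_power sum_singles)
qed

lemma single_in_monomials_iff: "Poly_Mapping.single i (Suc 0) \<in> monomials n \<longleftrightarrow> i \<in> {1..n}"
  by (simp add: monomials_def)

lemma Var_in_polys: "i \<in> {1..n} \<Longrightarrow> Var i \<in> supported_on (monomials n)"
  by (simp add: Var_def single_supported_on single_in_monomials_iff)

lemma scale_in_supported_on: "p \<in> supported_on U \<Longrightarrow> scale c p \<in> supported_on U"
  by (simp add: supported_on_iff)

lemma monomial_value_in:
  assumes one: "1 \<in> R" and mult: "\<And>p q. p \<in> R \<Longrightarrow> q \<in> R \<Longrightarrow> p * q \<in> R"
    and g: "\<And>i. i \<in> Poly_Mapping.keys m \<Longrightarrow> g i \<in> R"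
  shows "monomial_value g m \<in> R"
proof -
  have pow: "p ^ k \<in> R" if "p \<in> R" for p k
    using that by (induction k) (auto intro: one mult)
  have "finite A \<Longrightarrow> (\<And>i. i \<in> A \<Longrightarrow> g i \<in> R) \<Longrightarrow> (\<Prod>i\<in>A. g i ^ f i) \<in> R" for A f
    by (induction A rule: finite_induct) (auto intro: one mult pow)
  then show ?thesis using g by (simp add: monomial_value_def)
qed

text \<open>\<open>K[x\<^sub>1, \<dots>, x\<^sub>n]\<close> is the closure of the constants and variables under sums and products. This
  identifies algebra homomorphisms by their values on variables.\<close>

lemma polynomial_induct [consumes 1, case_names const Var add mult]:
  fixes p :: "'k::field mpoly"
  assumes p: "p \<in> supported_on (monomials n)"
    and const: "\<And>c. Q (Poly_Mapping.single 0 c)"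
    and Var: "\<And>i. i \<in> {1..n} \<Longrightarrow> Q (Var i)"
    and add: "\<And>p q. p \<in> supported_on (monomials n) \<Longrightarrow> q \<in> supported_on (monomials n) \<Longrightarrow> Q p \<Longrightarrow> Q q \<Longrightarrow> Q (p + q)"
    and mult: "\<And>p q. p \<in> supported_on (monomials n) \<Longrightarrow> q \<in> supported_on (monomials n) \<Longrightarrow> Q p \<Longrightarrow> Q q \<Longrightarrow> Q (p * q)"
  shows "Q p"
proof -
  let ?R = "{p \<in> supported_on (monomials n). Q p}"
  have c: "Poly_Mapping.single 0 c \<in> ?R" for c :: 'k
    by (auto intro: const single_supported_on)
  have single: "Poly_Mapping.single m c \<in> ?R" if m: "m \<in> monomials n" for m and c :: 'k
  proof -
    have "monomial_value Var m \<in> ?R"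
    proof (rule monomial_value_in)
      fix i assume "i \<in> Poly_Mapping.keys m"
      then have "i \<in> {1..n}" using m by (auto simp: monomials_def)
      then show "Var i \<in> ?R" using Var Var_in_polys by blast
    qed (use c[of 1] in \<open>auto intro: mult mult_in_polys\<close>)
    then have "Poly_Mapping.single 0 c * monomial_value Var m \<in> ?R"
      using c by (auto intro: mult mult_in_polys)
    then show ?thesis by (simp add: monomial_value_Var mult_single)
  qed
  have "finite A \<Longrightarrow> A \<subseteq> monomials n \<Longrightarrow> (\<Sum>m\<in>A. Poly_Mapping.single m (f m)) \<in> ?R" for A and f :: "_ \<Rightarrow> 'k"
  proof (induction A rule: finite_induct)
    case empty
    show ?case using c[of 0] by simp
  next
    case (insert m A)
    then show ?case using single[of m "f m"] by (auto intro: add add_supported_on)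
  qed
  from this[of "Poly_Mapping.keys p" "Poly_Mapping.lookup p"] show ?thesis
    using p by (simp add: sum_singles supported_on_def)
qed

lemma substitute_in_polys:
  assumes "p \<in> supported_on (monomials r)" "\<And>i. i \<in> {1..r} \<Longrightarrow> g i \<in> supported_on (monomials n)"
  shows "substitute g p \<in> supported_on (monomials n)"
  using assms(1)
proof (induction rule: polynomial_induct)
  case (const c)
  then show ?case by (simp add: substitute_single scale_in_supported_on)
qed (auto simp: substitute_add substitute_mult assms intro: add_supported_on mult_in_polys)

abbreviation homogeneous :: "nat \<Rightarrow> int \<Rightarrow> 'k::field mpoly set" where
  "homogeneous n t \<equiv> supported_on {m \<in> monomials n. int (monomial_degree m) = t}"

lemma homogeneous_mult: "p \<in> homogeneous n s \<Longrightarrow> q \<in> homogeneous n t \<Longrightarrow> p * q \<in> homogeneous n (s + t)"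
  by (erule (1) mult_supported_on) (auto intro: add_in_monomials simp: monomial_degree_add)

lemma one_homogeneous: "1 \<in> homogeneous n 0"
  by (simp add: supported_on_def)

lemma substitute_homogeneous:
  assumes p: "p \<in> homogeneous r t" and g: "\<And>i. i \<in> {1..r} \<Longrightarrow> g i \<in> homogeneous n 1"
  shows "substitute g p \<in> homogeneous n t"
  unfolding substitute_def
proof (intro sum_supported_on scale_in_supported_on)
  fix m assume "m \<in> Poly_Mapping.keys p"
  then have m: "Poly_Mapping.keys m \<subseteq> {1..r}" "int (monomial_degree m) = t"
    using p by (auto simp: supported_on_def monomials_def)
  have pow: "q ^ k \<in> homogeneous n (int k)" if "q \<in> homogeneous n 1" for q k
  proof (induction k)
    case (Suc k)
    then show ?case using homogeneous_mult[OF that Suc] by simp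
  qed (use one_homogeneous in simp)
  have "finite A \<Longrightarrow> A \<subseteq> {1..r} \<Longrightarrow> (\<Prod>i\<in>A. g i ^ f i) \<in> homogeneous n (int (sum f A))" for A f
  proof (induction A rule: finite_induct)
    case (insert i A)
    then show ?case using homogeneous_mult[OF pow[OF g, of i "f i"] insert.IH] by simp
  qed (use one_homogeneous in simp)
  from this[OF _ m(1), of "Poly_Mapping.lookup m"]
  have "monomial_value g m \<in> homogeneous n (int (sum (Poly_Mapping.lookup m) (Poly_Mapping.keys m)))"
    by (simp only: monomial_value_def finite_keys)
  then show "monomial_value g m \<in> homogeneous n t"
    using m(2) by (simp only: monomial_degree_def[of m])
qed

lemma degree_one_monomials:
  "{m \<in> monomials n. int (monomial_degree m) = 1} = (\<lambda>i. Poly_Mapping.single i 1) ` {1..n}"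
proof (intro equalityI subsetI)
  fix m assume m: "m \<in> {m \<in> monomials n. int (monomial_degree m) = 1}"
  then have "monomial_degree m = 1" by simp
  then have d: "(\<Sum>i\<in>Poly_Mapping.keys m. Poly_Mapping.lookup m i) = 1"
    by (simp only: monomial_degree_def)
  then obtain i where i: "i \<in> Poly_Mapping.keys m"
    by fastforce
  have "Poly_Mapping.lookup m i + (\<Sum>j\<in>Poly_Mapping.keys m - {i}. Poly_Mapping.lookup m j) = 1"
    using d i by (simp add: sum.remove)
  moreover have "Poly_Mapping.lookup m i \<noteq> 0" using i by (simp add: in_keys_iff)
  ultimately have 1: "Poly_Mapping.lookup m i = 1" "(\<Sum>j\<in>Poly_Mapping.keys m - {i}. Poly_Mapping.lookup m j) = 0"
    by linarith+
  from 1(2) have 2: "\<forall>j\<in>Poly_Mapping.keys m - {i}. Poly_Mapping.lookup m j = 0"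
    by (subst (asm) sum_eq_0_iff) auto
  have "m = Poly_Mapping.single i 1"
  proof (rule poly_mapping_eqI)
    fix k
    have "Poly_Mapping.lookup m k = 0" if "k \<noteq> i"
      using 2 that by (metis Diff_iff in_keys_iff singletonD)
    then show "Poly_Mapping.lookup m k = Poly_Mapping.lookup (Poly_Mapping.single i 1) k"
      using 1(1) by (cases "k = i") (simp_all add: lookup_single when_def)
  qed
  then show "m \<in> (\<lambda>i. Poly_Mapping.single i 1) ` {1..n}"
    using m i by (auto simp: monomials_def)
qed (auto simp: monomials_def)

lemma span_Vars: "pm.span (Var ` {1..n}) = (homogeneous n 1 :: 'k::field mpoly set)"
proof -
  have "Var ` {1..n} = (\<lambda>m. Poly_Mapping.single m (1::'k)) ` {m \<in> monomials n. int (monomial_degree m) = 1}"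
    unfolding degree_one_monomials by (auto simp: Var_def)
  then show ?thesis by (simp only: span_singles)
qed

lemma homogeneous_subset: "homogeneous n t \<subseteq> supported_on (monomials n)"
  by (rule supported_on_mono) auto

section \<open>Graded retracts of polynomial rings\<close>

definition graded_algebra_iso ::
    "'k ring \<Rightarrow> ('k, 's) graded \<Rightarrow> ('k, 't) graded \<Rightarrow> ('s \<Rightarrow> 't) \<Rightarrow> bool" where
  "graded_algebra_iso K A S \<theta> \<longleftrightarrow> \<theta> \<in> graded_algebra_hom K A S \<and>
     bij_betw \<theta> (carrier A) (carrier S) \<and> (\<forall>t. \<theta> ` hcomp A t = hcomp S t)"

lemma graded_algebra_homD:
  assumes "f \<in> graded_algebra_hom K S T"
  shows "x \<in> carrier S \<Longrightarrow> f x \<in> carrier T"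
    "x \<in> carrier S \<Longrightarrow> y \<in> carrier S \<Longrightarrow> f (x \<otimes>\<^bsub>S\<^esub> y) = f x \<otimes>\<^bsub>T\<^esub> f y"
    "x \<in> carrier S \<Longrightarrow> y \<in> carrier S \<Longrightarrow> f (x \<oplus>\<^bsub>S\<^esub> y) = f x \<oplus>\<^bsub>T\<^esub> f y"
    "f \<one>\<^bsub>S\<^esub> = \<one>\<^bsub>T\<^esub>"
    "k \<in> carrier K \<Longrightarrow> x \<in> carrier S \<Longrightarrow> f (k \<odot>\<^bsub>S\<^esub> x) = k \<odot>\<^bsub>T\<^esub> f x"
    "x \<in> hcomp S t \<Longrightarrow> f x \<in> hcomp T t"
  using assms by (auto simp: graded_algebra_hom_def ring_hom_def) blast

text \<open>Let \<open>b\<^sub>1, \<dots>, b\<^sub>r\<close> be a basis of \<open>\<iota>(S\<^sub>1)\<close>, which is a space of linear forms; thus \<open>r \<le> n\<close>. The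
  substitution \<open>\<phi>\<close> of the \<open>b\<^sub>i\<close> for the variables is injective, since a linear map with \<open>b\<^sub>i \<mapsto> x\<^sub>i\<close>
  induces a substitution \<open>\<psi>\<close> that inverts it. The isomorphism is \<open>\<theta> = \<pi> \<circ> \<phi>\<close>: it is injective
  because \<open>\<iota> \<circ> \<theta> = \<phi>\<close>, and it is onto because the images \<open>\<pi>(x\<^sub>j)\<close>, which generate \<open>S\<close>, are linear
  combinations of the \<open>\<pi>(b\<^sub>i)\<close>.\<close>

lemma graded_retract_polynomial_ring:
  fixes S :: "('k::field, 'k mpoly) graded"
  assumes "graded_retract ring_of_type_algebra (polynomial_ring n) S"
  obtains r \<theta> where "r \<le> n" "graded_algebra_iso ring_of_type_algebra (polynomial_ring r) S \<theta>"
proof -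
  let ?K = "ring_of_type_algebra :: 'k ring" and ?A = "polynomial_ring n :: ('k, 'k mpoly) graded"
  from assms obtain \<iota> \<pi> where S: "graded_algebra ?K S"
    and \<iota>: "\<iota> \<in> graded_algebra_hom ?K S ?A" and \<pi>: "\<pi> \<in> graded_algebra_hom ?K ?A S"
    and \<pi>\<iota>: "\<And>x. x \<in> carrier S \<Longrightarrow> \<pi> (\<iota> x) = x"
    unfolding graded_retract_def by blast
  interpret S: algebra ?K S using S by (simp add: graded_algebra_def)
  note simps = polynomial_ring_simps ring_of_type_algebra_simps const_mult_eq_scale
  note \<iota>D = graded_algebra_homD[OF \<iota>, unfolded simps]
  note \<pi>D = graded_algebra_homD[OF \<pi>, unfolded simps]
  have sub: "submodule (hcomp S t) ?K S" for t
    using S by (simp add: graded_algebra_def graded_decomposition_def)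
  have subc: "hcomp S t \<subseteq> carrier S" for t
    using subgroup.subset[OF submodule.axioms(1)[OF sub[of t]]] by simp
  let ?L = "\<iota> ` hcomp S 1"
  have L_sub: "?L \<subseteq> homogeneous n 1"
    using \<iota>D(6) by blast
  have "pm.subspace ?L"
    unfolding pm.subspace_def
  proof (intro conjI ballI allI)
    have z: "\<zero>\<^bsub>S\<^esub> \<in> hcomp S 1"
      using subgroup.one_closed[OF submodule.axioms(1)[OF sub[of 1]]] by simp
    have "\<iota> \<zero>\<^bsub>S\<^esub> + \<iota> \<zero>\<^bsub>S\<^esub> = \<iota> \<zero>\<^bsub>S\<^esub>"
      using \<iota>D(3)[of "\<zero>\<^bsub>S\<^esub>" "\<zero>\<^bsub>S\<^esub>"] by simp
    then show "0 \<in> ?L" using z by (metis add_cancel_right_left image_eqI)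
  next
    fix x y assume "x \<in> ?L" "y \<in> ?L"
    then obtain a b where ab: "a \<in> hcomp S 1" "b \<in> hcomp S 1" "x = \<iota> a" "y = \<iota> b" by blast
    have "a \<oplus>\<^bsub>S\<^esub> b \<in> hcomp S 1"
      using subgroup.m_closed[OF submodule.axioms(1)[OF sub[of 1]]] ab by simp
    moreover have "x + y = \<iota> (a \<oplus>\<^bsub>S\<^esub> b)"
      using ab \<iota>D(3)[OF subc[THEN subsetD] subc[THEN subsetD]] by simp
    ultimately show "x + y \<in> ?L" by blast
  next
    fix c x assume "x \<in> ?L"
    then obtain a where a: "a \<in> hcomp S 1" "x = \<iota> a" by blast
    have "c \<odot>\<^bsub>S\<^esub> a \<in> hcomp S 1"
      using submodule.smult_closed[OF sub[of 1]] a by (simp add: ring_of_type_algebra_simps)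
    moreover have "scale c x = \<iota> (c \<odot>\<^bsub>S\<^esub> a)"
      using a \<iota>D(5)[OF _ subc[THEN subsetD]] by simp
    ultimately show "scale c x \<in> ?L" by blast
  qed
  obtain B where B: "B \<subseteq> ?L" "pm.independent B" "?L \<subseteq> pm.span B"
    by (rule pm.basis_exists)
  have "B \<subseteq> pm.span (Var ` {1..n})"
    unfolding span_Vars by (rule subset_trans[OF B(1) L_sub])
  from pm.independent_span_bound[OF _ B(2) this] have finB: "finite B" and "card B \<le> card (Var ` {1..n} :: 'k mpoly set)"
    by auto
  moreover have "card (Var ` {1..n} :: 'k mpoly set) \<le> n"
    using card_image_le[of "{1..n}" "Var :: nat \<Rightarrow> 'k mpoly"] by simp
  ultimately have rn: "card B \<le> n" by simp
  define r where "r = card B"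
  obtain b where b: "bij_betw b {1..r} B"
    using ex_bij_betw_nat_finite_1[OF finB] unfolding r_def by blast
  have bB: "b i \<in> B" if "i \<in> {1..r}" for i using b that by (auto simp: bij_betw_def)
  have b1: "b i \<in> homogeneous n 1" if "i \<in> {1..r}" for i
    using bB[OF that] B(1) L_sub by blast
  let ?f = "\<lambda>x. Var (inv_into {1..r} b x) :: 'k mpoly"
  obtain g where g: "Vector_Spaces.linear scale scale g \<and> (\<forall>x\<in>B. g x = ?f x) \<and>
      range g = pm.span (?f ` B)"
    using pm_pair.linear_independent_extend_subspace[OF B(2), of ?f] by (rule exE)
  then have g: "Vector_Spaces.linear scale scale g" "\<And>x. x \<in> B \<Longrightarrow> g x = ?f x"
      "range g = pm.span (?f ` B)"
    by simp_all
  have gb: "g (b i) = Var i" if "i \<in> {1..r}" for i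
    using g(2)[OF bB[OF that]] bij_betw_inv_into_left[OF b that] by simp
  have "?f ` B = Var ` (inv_into {1..r} b ` B)" by (rule image_image[symmetric])
  also have "inv_into {1..r} b ` B = {1..r}"
    using bij_betw_inv_into[OF b] unfolding bij_betw_def by (rule conjunct2)
  finally have "range g = homogeneous r 1"
    using g(3) span_Vars by simp
  then have g1: "g x \<in> homogeneous r 1" for x
    by blast
  define \<phi> where "\<phi> = substitute b"
  define \<psi> where "\<psi> = substitute (\<lambda>j. g (Var j))"
  have \<psi>b: "\<psi> x = g x" if "x \<in> homogeneous n 1" for x
    unfolding \<psi>_def
  proof (rule pm_pair.linear_eq_on[OF linear_substitute g(1)])
    show "x \<in> pm.span (Var ` {1..n})" unfolding span_Vars by (rule that)
  qed auto
  have \<phi>_hom: "\<phi> p \<in> homogeneous n t" if "p \<in> homogeneous r t" for p t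
    unfolding \<phi>_def using that by (rule substitute_homogeneous) (rule b1)
  have \<phi>_in: "\<phi> p \<in> supported_on (monomials n)" if "p \<in> supported_on (monomials r)" for p
    unfolding \<phi>_def using that by (rule substitute_in_polys) (use b1 homogeneous_subset in blast)
  have \<psi>_hom: "\<psi> p \<in> homogeneous r t" if "p \<in> homogeneous n t" for p t
    unfolding \<psi>_def using that by (rule substitute_homogeneous) (rule g1)
  have \<psi>\<phi>: "\<psi> (\<phi> p) = p" if "p \<in> supported_on (monomials r)" for p
    using that
  proof (induction rule: polynomial_induct)
    case (const c)
    show ?case by (simp add: \<psi>_def \<phi>_def single_zero_eq_scale substitute_scale)
  next
    case (Var i)
    then show ?case using \<psi>b[OF b1[OF Var]] gb[OF Var] by (simp add: \<phi>_def)
  qed (auto simp: \<psi>_def \<phi>_def substitute_add substitute_mult)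
  have \<iota>\<pi>\<phi>: "\<iota> (\<pi> (\<phi> p)) = \<phi> p" if "p \<in> supported_on (monomials r)" for p
    using that
  proof (induction rule: polynomial_induct)
    case (const c)
    show ?case by (simp add: \<phi>_def single_zero_eq_scale substitute_scale \<pi>D \<iota>D)
  next
    case (Var i)
    then obtain s where "s \<in> hcomp S 1" "b i = \<iota> s" using bB B(1) by blast
    then show ?case using \<pi>\<iota>[OF subc[THEN subsetD]] by (auto simp: \<phi>_def)
  next
    case (add p q)
    then show ?case using \<phi>_in \<pi>D(1)
      by (simp add: \<pi>D(3) \<iota>D(3) \<phi>_def substitute_add)
  next
    case (mult p q)
    then show ?case using \<phi>_in \<pi>D(1)
      by (simp add: \<pi>D(2) \<iota>D(2) \<phi>_def substitute_mult)
  qed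
  define \<theta> where "\<theta> p = \<pi> (\<phi> p)" for p
  have \<theta>_hom: "\<theta> \<in> graded_algebra_hom ?K (polynomial_ring r) S"
    unfolding graded_algebra_hom_def ring_hom_def simps
    using \<phi>_in \<phi>_hom \<pi>D
    by (auto simp: \<theta>_def) (simp_all add: \<phi>_def substitute_add substitute_mult substitute_scale)
  have inj: "inj_on \<theta> (supported_on (monomials r))"
    by (rule inj_on_inverseI[of _ "\<lambda>x. \<psi> (\<iota> x)"]) (simp add: \<theta>_def \<iota>\<pi>\<phi> \<psi>\<phi>)
  have surj\<pi>: "\<pi> p \<in> \<theta> ` supported_on (monomials r)" if "p \<in> supported_on (monomials n)" for p
    using that
  proof (induction rule: polynomial_induct)
    case (const c)
    have "\<pi> (Poly_Mapping.single 0 c) = \<theta> (Poly_Mapping.single 0 c)"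
      by (simp add: \<theta>_def \<phi>_def single_zero_eq_scale substitute_scale)
    then show ?case by (auto intro!: single_supported_on)
  next
    case (Var j)
    have vj: "Var j \<in> (homogeneous n 1 :: 'k mpoly set)"
      unfolding span_Vars[symmetric] using Var by (intro pm.span_base) simp
    have "B = \<phi> ` Var ` {1..r}" using b by (simp add: image_image \<phi>_def bij_betw_def)
    then have "pm.span B = \<phi> ` pm.span (Var ` {1..r})"
      unfolding \<phi>_def by (simp only: pm_pair.linear_span_image[OF linear_substitute])
    then have "pm.span B = \<phi> ` homogeneous r 1" by (simp only: span_Vars)
    moreover have "\<iota> (\<pi> (Var j)) \<in> pm.span B" using B(3) \<pi>D(6)[OF vj] by blast
    ultimately obtain q where q: "q \<in> homogeneous r 1" "\<iota> (\<pi> (Var j)) = \<phi> q" by blast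
    have "\<pi> (Var j) = \<pi> (\<iota> (\<pi> (Var j)))" by (rule \<pi>\<iota>[OF \<pi>D(1)[OF Var_in_polys[OF Var]], symmetric])
    then have "\<pi> (Var j) = \<theta> q" using q(2) by (simp add: \<theta>_def)
    then show ?case using q(1) homogeneous_subset by blast
  next
    case (add p q)
    then obtain p' q' where "p' \<in> supported_on (monomials r)" "q' \<in> supported_on (monomials r)"
      "\<pi> p = \<theta> p'" "\<pi> q = \<theta> q'" by blast
    then have "\<pi> (p + q) = \<theta> (p' + q')" "p' + q' \<in> supported_on (monomials r)"
      using add graded_algebra_homD(3)[OF \<theta>_hom, unfolded simps] by (simp_all add: \<pi>D add_supported_on)
    then show ?case by blast
  next
    case (mult p q)
    then obtain p' q' where "p' \<in> supported_on (monomials r)" "q' \<in> supported_on (monomials r)"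
      "\<pi> p = \<theta> p'" "\<pi> q = \<theta> q'" by blast
    then have "\<pi> (p * q) = \<theta> (p' * q')" "p' * q' \<in> supported_on (monomials r)"
      using mult graded_algebra_homD(2)[OF \<theta>_hom, unfolded simps] by (simp_all add: \<pi>D mult_in_polys)
    then show ?case by blast
  qed
  have surj: "x \<in> \<theta> ` supported_on (monomials r)" if "x \<in> carrier S" for x
    using surj\<pi>[OF \<iota>D(1)[OF that]] \<pi>\<iota>[OF that] by simp
  have "\<theta> ` homogeneous r t = hcomp S t" for t
  proof
    show "\<theta> ` homogeneous r t \<subseteq> hcomp S t"
      using graded_algebra_homD(6)[OF \<theta>_hom, unfolded simps] by blast
    show "hcomp S t \<subseteq> \<theta> ` homogeneous r t"
    proof
      fix x assume x: "x \<in> hcomp S t"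
      then obtain q where q: "q \<in> supported_on (monomials r)" "x = \<theta> q"
        using surj subc by blast
      have "\<iota> x = \<phi> q" using q \<iota>\<pi>\<phi> by (simp add: \<theta>_def)
      then have "q \<in> homogeneous r t"
        using \<psi>_hom[OF \<iota>D(6)[OF x]] \<psi>\<phi>[OF q(1)] by simp
      then show "x \<in> \<theta> ` homogeneous r t" using q(2) by blast
    qed
  qed
  moreover have "bij_betw \<theta> (supported_on (monomials r)) (carrier S)"
    unfolding bij_betw_def using inj surj graded_algebra_homD(1)[OF \<theta>_hom, unfolded simps] by blast
  ultimately have "graded_algebra_iso ?K (polynomial_ring r) S \<theta>"
    using \<theta>_hom by (simp add: graded_algebra_iso_def polynomial_ring_simps)
  then show thesis using that rn r_def by blast
qed

section \<open>Ideals generated by sequences\<close>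

text \<open>For polynomial rings this is the submodule in the definition of a regular sequence, with
  sums of the ring type in place of sums over a carrier.\<close>

definition generated_ideal :: "nat \<Rightarrow> 'k::field mpoly list \<Rightarrow> 'k mpoly set" where
  "generated_ideal r ys =
     {\<Sum>j<length ys. ys ! j * u j | u. \<forall>j. u j \<in> supported_on (monomials r)}"

definition regular_polynomials :: "nat \<Rightarrow> 'k::field mpoly list \<Rightarrow> bool" where
  "regular_polynomials r ys \<longleftrightarrow> set ys \<subseteq> supported_on (monomials r) \<and>
     (\<forall>i<length ys. \<forall>x\<in>supported_on (monomials r).
        ys ! i * x \<in> generated_ideal r (take i ys) \<longrightarrow> x \<in> generated_ideal r (take i ys)) \<and>
     1 \<notin> generated_ideal r ys"

lemma generated_ideal_Nil [simp]: "generated_ideal r [] = {0}"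
proof -
  have "\<exists>u. \<forall>j::nat. u j \<in> (supported_on (monomials r) :: 'a mpoly set)"
    by (rule exI[of _ "\<lambda>_. 0"]) simp
  then show ?thesis by (auto simp: generated_ideal_def)
qed

lemma generated_ideal_snoc:
  "generated_ideal r (ys @ [y]) =
     {a + y * u | a u. a \<in> generated_ideal r ys \<and> u \<in> supported_on (monomials r)}"
proof (intro equalityI subsetI)
  fix x assume "x \<in> generated_ideal r (ys @ [y])"
  then obtain u where u: "\<forall>j. u j \<in> supported_on (monomials r)"
    "x = (\<Sum>j<Suc (length ys). (ys @ [y]) ! j * u j)"
    by (auto simp: generated_ideal_def)
  have "x = (\<Sum>j<length ys. ys ! j * u j) + y * u (length ys)"
    unfolding u(2) sum.lessThan_Suc by (simp add: nth_append)
  then show "x \<in> {a + y * u | a u. a \<in> generated_ideal r ys \<and> u \<in> supported_on (monomials r)}"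
    using u(1) by (auto simp: generated_ideal_def)
next
  fix x assume "x \<in> {a + y * u | a u. a \<in> generated_ideal r ys \<and> u \<in> supported_on (monomials r)}"
  then obtain u v where u: "\<forall>j. u j \<in> supported_on (monomials r)" "v \<in> supported_on (monomials r)"
    "x = (\<Sum>j<length ys. ys ! j * u j) + y * v"
    by (auto simp: generated_ideal_def)
  have "x = (\<Sum>j<length (ys @ [y]). (ys @ [y]) ! j * (u(length ys := v)) j)"
    unfolding u(3) by (simp add: nth_append)
  moreover have "\<forall>j. (u(length ys := v)) j \<in> supported_on (monomials r)" using u by simp
  ultimately show "x \<in> generated_ideal r (ys @ [y])"
    unfolding generated_ideal_def by blast
qed

lemma generated_ideal_take_Suc:
  assumes "i < length ys"
  shows "generated_ideal r (take (Suc i) ys) =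
     {a + ys ! i * u | a u. a \<in> generated_ideal r (take i ys) \<and> u \<in> supported_on (monomials r)}"
  by (simp add: take_Suc_conv_app_nth[OF assms] generated_ideal_snoc)

lemma diff_supported_on: "p \<in> supported_on U \<Longrightarrow> q \<in> supported_on U \<Longrightarrow> p - q \<in> supported_on U"
  for p q :: "'x \<Rightarrow>\<^sub>0 'k::ab_group_add"
  by (simp add: supported_on_iff lookup_minus)

lemma generated_ideal_mult:
  "a \<in> generated_ideal r ys \<Longrightarrow> p \<in> supported_on (monomials r) \<Longrightarrow> p * a \<in> generated_ideal r ys"
proof (induction ys arbitrary: a rule: rev_induct)
  case (snoc y ys)
  then obtain a' u where *: "a = a' + y * u" "a' \<in> generated_ideal r ys" "u \<in> supported_on (monomials r)"
    by (auto simp: generated_ideal_snoc)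
  have "p * a = p * a' + y * (p * u)" using * by (simp add: algebra_simps)
  then show ?case using snoc.IH[of a'] snoc.prems * mult_in_polys[of p r u]
    unfolding generated_ideal_snoc by blast
qed simp

section \<open>Splitting off a variable\<close>

lemma lookup_monomial_mult:
  "Poly_Mapping.lookup (Poly_Mapping.single a 1 * q) (a + m) = Poly_Mapping.lookup (q :: 'k::field mpoly) m"
  "(\<And>m. k \<noteq> a + m) \<Longrightarrow> Poly_Mapping.lookup (Poly_Mapping.single a 1 * q) k = 0"
proof -
  have eq: "Poly_Mapping.single a 1 * q = (\<Sum>m\<in>Poly_Mapping.keys q. Poly_Mapping.single (a + m) (Poly_Mapping.lookup q m))"
    by (subst (1) sum_singles[of "Poly_Mapping.keys q" q, symmetric])
       (simp_all add: sum_distrib_left mult_single)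
  show "Poly_Mapping.lookup (Poly_Mapping.single a 1 * q) (a + m) = Poly_Mapping.lookup q m"
    by (simp add: eq lookup_sum lookup_single when_def in_keys_iff sum.delta)
  show "(\<And>m. k \<noteq> a + m) \<Longrightarrow> Poly_Mapping.lookup (Poly_Mapping.single a 1 * q) k = 0"
    unfolding eq lookup_sum by (intro sum.neutral ballI) (metis lookup_single_not_eq)
qed

definition quotient_by_Var :: "nat \<Rightarrow> 'k::field mpoly \<Rightarrow> 'k mpoly" where
  "quotient_by_Var i p = Poly_Mapping.map_key (\<lambda>m. Poly_Mapping.single i 1 + m) p"

lemma lookup_quotient_by_Var:
  "Poly_Mapping.lookup (quotient_by_Var i p) m = Poly_Mapping.lookup p (Poly_Mapping.single i 1 + m)"
  unfolding quotient_by_Var_def by (subst map_key.rep_eq) (auto simp: inj_def)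

lemma variable_divides_iff: "(\<exists>m'. m = Poly_Mapping.single i 1 + m') \<longleftrightarrow> Poly_Mapping.lookup m i \<noteq> (0::nat)"
proof
  assume "\<exists>m'. m = Poly_Mapping.single i 1 + m'"
  then show "Poly_Mapping.lookup m i \<noteq> 0" by (auto simp: lookup_add)
next
  assume *: "Poly_Mapping.lookup m i \<noteq> 0"
  have "m = Poly_Mapping.single i 1 + (m - Poly_Mapping.single i 1)"
    by (rule poly_mapping_eqI) (use * in \<open>auto simp: lookup_add lookup_minus lookup_single when_def\<close>)
  then show "\<exists>m'. m = Poly_Mapping.single i 1 + m'" by blast
qed

lemma lookup_Var_mult:
  "Poly_Mapping.lookup (Var i * q) (Poly_Mapping.single i 1 + m) = Poly_Mapping.lookup q m"
  "Poly_Mapping.lookup m i = 0 \<Longrightarrow> Poly_Mapping.lookup (Var i * q) m = 0"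
proof -
  show "Poly_Mapping.lookup (Var i * q) (Poly_Mapping.single i 1 + m) = Poly_Mapping.lookup q m"
    unfolding Var_def by (rule lookup_monomial_mult(1))
  assume "Poly_Mapping.lookup m i = 0"
  then have "m \<noteq> Poly_Mapping.single i 1 + m'" for m'
    using variable_divides_iff[of m i] by blast
  then show "Poly_Mapping.lookup (Var i * q) m = 0"
    unfolding Var_def by (rule lookup_monomial_mult(2))
qed

text \<open>Every polynomial is \<open>x\<^sub>i\<close> times its quotient plus a remainder free of \<open>x\<^sub>i\<close>.\<close>

lemma lookup_minus_Var_quotient:
  "Poly_Mapping.lookup (p - Var i * quotient_by_Var i p) m =
     (if Poly_Mapping.lookup m i = 0 then Poly_Mapping.lookup p m else 0)"
proof (cases "Poly_Mapping.lookup m i = 0")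
  case False
  then obtain m' where "m = Poly_Mapping.single i 1 + m'" using variable_divides_iff[of m i] by blast
  then show ?thesis using False by (simp only: lookup_minus lookup_Var_mult(1) lookup_quotient_by_Var) simp
qed (simp add: lookup_minus lookup_Var_mult(2))

section \<open>Algebraic independence of regular sequences\<close>

text \<open>Downward induction on \<open>i\<close> proves that the entries from \<open>i\<close> on are algebraically independent modulo
  the ideal generated by the earlier ones; the case \<open>i = 0\<close> is algebraic independence over \<open>K\<close>.
  At the end of the sequence only constants are left, and the ideal is proper. For the step write
  \<open>G = G\<^sub>0 + x\<^sub>i Q\<close> with \<open>G\<^sub>0\<close> free of \<open>x\<^sub>i\<close>. Modulo the entry \<open>y\<^sub>i\<close> only \<open>G\<^sub>0\<close> survives, so it vanishes by
  induction; then regularity cancels \<open>y\<^sub>i\<close> and leaves \<open>Q\<close>, whose degree in \<open>x\<^sub>i\<close> is smaller.\<close>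

lemma substitute_regular_eq_zero:
  assumes reg: "regular_polynomials r ys" and "i \<le> length ys"
    and "F \<in> supported_on {m. Poly_Mapping.keys m \<subseteq> {i..<length ys}}"
    and "substitute (\<lambda>j. ys ! j) F \<in> generated_ideal r (take i ys)"
  shows "F = 0"
  using assms(2-)
proof (induction i arbitrary: F rule: inc_induct)
  case base
  have "Poly_Mapping.keys F \<subseteq> {0}"
    using base by (auto simp: supported_on_def)
  then have F: "F = Poly_Mapping.single 0 (Poly_Mapping.lookup F 0)"
    using sum_singles[of "{0}" F] by simp
  show ?case
  proof (rule ccontr)
    assume "F \<noteq> 0"
    define c where "c = Poly_Mapping.lookup F 0"
    have c: "c \<noteq> 0" "F = Poly_Mapping.single 0 c" using F \<open>F \<noteq> 0\<close> by (auto simp: c_def)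
    then have "substitute (\<lambda>j. ys ! j) F = scale c 1" by (simp add: substitute_single)
    then have "Poly_Mapping.single 0 (1 / c) * scale c 1 \<in> generated_ideal r ys"
      using base by (intro generated_ideal_mult single_supported_on) auto
    moreover have "Poly_Mapping.single 0 (1 / c) * scale c 1 = (1 :: 'a mpoly)"
      using c(1) by (simp add: const_mult_eq_scale)
    ultimately show False using reg by (simp add: regular_polynomials_def)
  qed
next
  case (step i)
  let ?g = "\<lambda>j. ys ! j"
  have yi: "ys ! i \<in> supported_on (monomials r)"
    using reg step(2) by (auto simp: regular_polynomials_def)
  have gP: "substitute ?g G \<in> supported_on (monomials r)" if "G \<in> supported_on {m. Poly_Mapping.keys m \<subseteq> {i..<length ys}}" for G
    unfolding substitute_def
  proof (intro sum_supported_on scale_in_supported_on monomial_value_in)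
    fix m j assume "m \<in> Poly_Mapping.keys G" "j \<in> Poly_Mapping.keys m"
    then have "m \<in> {m. Poly_Mapping.keys m \<subseteq> {i..<length ys}}"
      using that by (auto simp: supported_on_def simp del: mem_Collect_eq)
    then have "j < length ys" using \<open>j \<in> Poly_Mapping.keys m\<close> by auto
    then show "ys ! j \<in> supported_on (monomials r)" using reg by (auto simp: regular_polynomials_def)
  qed (auto intro: mult_in_polys)
  have "G = 0" if "G \<in> supported_on {m. Poly_Mapping.keys m \<subseteq> {i..<length ys}}"
      "substitute ?g G \<in> generated_ideal r (take i ys)" "\<forall>m\<in>Poly_Mapping.keys G. Poly_Mapping.lookup m i < N" for G N
    using that
  proof (induction N arbitrary: G)
    case 0
    then show ?case by simp
  next
    case (Suc N)
    define Q where "Q = quotient_by_Var i G"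
    define G0 where "G0 = G - Var i * Q"
    have Q: "Q \<in> supported_on {m. Poly_Mapping.keys m \<subseteq> {i..<length ys}}"
      unfolding supported_on_def Q_def
    proof (intro CollectI subsetI)
      fix m j assume m: "m \<in> Poly_Mapping.keys (quotient_by_Var i G)" "j \<in> Poly_Mapping.keys m"
      then have "Poly_Mapping.single i 1 + m \<in> Poly_Mapping.keys G"
        by (simp add: in_keys_iff lookup_quotient_by_Var)
      then have "Poly_Mapping.keys (Poly_Mapping.single i 1 + m) \<subseteq> {i..<length ys}"
        using Suc.prems(1) unfolding supported_on_def by blast
      then show "j \<in> {i..<length ys}" using m(2) unfolding keys_add_nat by blast
    qed
    have G0: "G0 \<in> supported_on {m. Poly_Mapping.keys m \<subseteq> {Suc i..<length ys}}"
      unfolding supported_on_iff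
    proof (intro allI impI)
      fix m :: "nat \<Rightarrow>\<^sub>0 nat" assume m: "m \<notin> {m. Poly_Mapping.keys m \<subseteq> {Suc i..<length ys}}"
      show "Poly_Mapping.lookup G0 m = 0"
      proof (cases "Poly_Mapping.lookup m i = 0")
        case True
        then have "i \<notin> Poly_Mapping.keys m" by (simp add: in_keys_iff)
        then have "\<not> Poly_Mapping.keys m \<subseteq> {i..<length ys}"
        proof -
          have "{i..<length ys} - {i} \<subseteq> {Suc i..<length ys}" by auto
          then show ?thesis using m \<open>i \<notin> _\<close> by blast
        qed
        then have "Poly_Mapping.lookup G m = 0" using Suc.prems(1) by (simp add: supported_on_iff)
        then show ?thesis by (simp add: G0_def Q_def lookup_minus_Var_quotient)
      qed (simp add: G0_def Q_def lookup_minus_Var_quotient)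
    qed
    have s: "substitute ?g G = substitute ?g G0 + ys ! i * substitute ?g Q"
      using substitute_add[of ?g G0 "Var i * Q"] by (simp add: substitute_mult G0_def)
    have "substitute ?g G0 = substitute ?g G + ys ! i * (- substitute ?g Q)"
      using s by simp
    then have "substitute ?g G0 \<in> generated_ideal r (take (Suc i) ys)"
      unfolding generated_ideal_take_Suc[OF step(2)]
      using Suc.prems(2) gP[OF Q] uminus_supported_on by blast
    then have "G0 = 0" by (rule step.IH[OF G0])
    then have G: "G = Var i * Q" and "ys ! i * substitute ?g Q \<in> generated_ideal r (take i ys)"
      using s Suc.prems(2) by (simp_all add: G0_def)
    then have "substitute ?g Q \<in> generated_ideal r (take i ys)"
      using reg step(2) gP[OF Q] by (simp add: regular_polynomials_def)
    moreover have "\<forall>m\<in>Poly_Mapping.keys Q. Poly_Mapping.lookup m i < N"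
    proof
      fix m assume "m \<in> Poly_Mapping.keys Q"
      then have "Poly_Mapping.single i 1 + m \<in> Poly_Mapping.keys G"
        by (simp add: in_keys_iff Q_def lookup_quotient_by_Var)
      then have "Poly_Mapping.lookup (Poly_Mapping.single i 1 + m) i < Suc N" using Suc.prems(3) by blast
      then show "Poly_Mapping.lookup m i < N" by (simp add: lookup_add)
    qed
    ultimately have "Q = 0" using Suc.IH Q by blast
    then show ?case using G by simp
  qed
  \<comment> \<open>Any bound on the exponents of \<open>x\<^sub>i\<close> starts the inner induction.\<close>
  moreover have "\<forall>m\<in>Poly_Mapping.keys F. Poly_Mapping.lookup m i < Suc (\<Sum>m\<in>Poly_Mapping.keys F. Poly_Mapping.lookup m i)"
    unfolding less_Suc_eq_le by (intro ballI member_le_sum) auto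
  ultimately show ?case using step.prems by blast
qed

section \<open>Counting monomials\<close>

lemma card_bounded_exponents:
  assumes "finite A"
  shows "finite {m :: 'i \<Rightarrow>\<^sub>0 nat. Poly_Mapping.keys m \<subseteq> A \<and> (\<forall>i. Poly_Mapping.lookup m i \<le> N)}" (is "finite ?M")
    and "card {m :: 'i \<Rightarrow>\<^sub>0 nat. Poly_Mapping.keys m \<subseteq> A \<and> (\<forall>i. Poly_Mapping.lookup m i \<le> N)} = (N + 1) ^ card A"
proof -
  let ?r = "\<lambda>m :: 'i \<Rightarrow>\<^sub>0 nat. restrict (Poly_Mapping.lookup m) A"
  have "bij_betw ?r ?M (A \<rightarrow>\<^sub>E {..N})"
  proof (rule bij_betwI')
    fix m m' assume "m \<in> ?M" "m' \<in> ?M"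
    show "(?r m = ?r m') = (m = m')"
    proof
      assume eq: "?r m = ?r m'"
      show "m = m'"
      proof (rule poly_mapping_eqI)
        fix i show "Poly_Mapping.lookup m i = Poly_Mapping.lookup m' i"
        proof (cases "i \<in> A")
          case True
          then show ?thesis using fun_cong[OF eq, of i] by simp
        next
          case False
          then have "i \<notin> Poly_Mapping.keys m" "i \<notin> Poly_Mapping.keys m'"
            using \<open>m \<in> ?M\<close> \<open>m' \<in> ?M\<close> by blast+
          then show ?thesis by (simp add: in_keys_iff)
        qed
      qed
    qed simp
  next
    fix m assume "m \<in> ?M"
    then show "?r m \<in> A \<rightarrow>\<^sub>E {..N}" by auto
  next
    fix f assume f: "f \<in> A \<rightarrow>\<^sub>E {..N}"
    let ?m = "\<Sum>i\<in>A. Poly_Mapping.single i (f i)"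
    have eq: "?r ?m = f"
      using f assms by (auto simp: lookup_sum_singles PiE_def extensional_def fun_eq_iff)
    have "Poly_Mapping.keys ?m \<subseteq> A"
    proof
      fix i assume "i \<in> Poly_Mapping.keys ?m"
      then have "(if i \<in> A then f i else 0) \<noteq> 0"
        unfolding in_keys_iff lookup_sum_singles[OF assms] .
      then show "i \<in> A" by (cases "i \<in> A") simp_all
    qed
    moreover have "Poly_Mapping.lookup ?m i \<le> N" for i
      unfolding lookup_sum_singles[OF assms] using PiE_mem[OF f, of i] by (cases "i \<in> A") simp_all
    ultimately have mem: "?m \<in> ?M" unfolding mem_Collect_eq by (intro conjI allI)
    show "\<exists>m\<in>?M. f = ?r m"
    proof (rule bexI)
      show "f = ?r ?m" using eq by (rule sym)
      show "?m \<in> ?M" by (rule mem)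
    qed
  qed
  moreover have "finite (A \<rightarrow>\<^sub>E {..N})" using assms by (simp add: finite_PiE)
  moreover have "card (A \<rightarrow>\<^sub>E {..N}) = (N + 1) ^ card A" using assms by (simp add: card_PiE)
  ultimately show "finite ?M" "card ?M = (N + 1) ^ card A"
    by (simp_all add: bij_betw_finite bij_betw_same_card)
qed

lemma lookup_le_monomial_degree: "Poly_Mapping.lookup m i \<le> monomial_degree m"
proof (cases "i \<in> Poly_Mapping.keys m")
  case True
  then show ?thesis unfolding monomial_degree_def by (intro member_le_sum) auto
qed (simp add: in_keys_iff)

lemma monomials_bounded_degree_subset:
  "{m \<in> monomials r. monomial_degree m \<le> D} \<subseteq>
    {m. Poly_Mapping.keys m \<subseteq> {1..r} \<and> (\<forall>i. Poly_Mapping.lookup m i \<le> D)}"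
  by (auto simp: monomials_def intro: order_trans[OF lookup_le_monomial_degree])

lemma finite_monomials_bounded_degree: "finite {m \<in> monomials r. monomial_degree m \<le> D}"
  by (rule finite_subset[OF monomials_bounded_degree_subset card_bounded_exponents(1)]) simp

lemma card_monomials_bounded_degree: "card {m \<in> monomials r. monomial_degree m \<le> D} \<le> (D + 1) ^ r"
  using card_mono[OF card_bounded_exponents(1) monomials_bounded_degree_subset[of r D]]
    card_bounded_exponents(2)[of "{1..r}" D] by simp

text \<open>Suppose there were \<open>k > r\<close> entries, all of degree at most \<open>e\<close>. The \<open>(N + 1)^k\<close> products of the entries
  with exponents at most \<open>N\<close> are linearly independent and lie in the space of polynomials of degree
  at most \<open>k e N\<close>, whose dimension is at most \<open>(k e N + 1)^r\<close>. For large \<open>N\<close> this is impossible.\<close>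

lemma length_regular_polynomials_le:
  fixes ys :: "'k::field mpoly list"
  assumes reg: "regular_polynomials r ys"
  shows "length ys \<le> r"
proof (rule ccontr)
  assume "\<not> length ys \<le> r"
  define k where "k = length ys"
  have k: "r + 1 \<le> k" using \<open>\<not> _\<close> k_def by simp
  let ?T = "\<lambda>D. supported_on {m \<in> monomials r. monomial_degree m \<le> D} :: 'k mpoly set"
  have T_mult: "p * q \<in> ?T (a + b)" if "p \<in> ?T a" "q \<in> ?T b" for p q a b
    using that by (rule mult_supported_on) (auto intro: add_in_monomials simp: monomial_degree_add)
  have T_one: "1 \<in> ?T a" for a by (simp add: supported_on_def)
  have T_mono: "p \<in> ?T b" if "p \<in> ?T a" "a \<le> b" for p a b
    using that(1) by (rule subsetD[OF supported_on_mono, rotated]) (use that(2) in auto)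
  define e where "e = (\<Sum>y\<in>set ys. \<Sum>m\<in>Poly_Mapping.keys y. monomial_degree m)"
  have ye: "ys ! j \<in> ?T e" if "j < k" for j
  proof -
    have y: "ys ! j \<in> set ys" using that by (simp add: k_def)
    then have "ys ! j \<in> supported_on (monomials r)" using reg by (auto simp: regular_polynomials_def)
    moreover have "monomial_degree m \<le> e" if "m \<in> Poly_Mapping.keys (ys ! j)" for m
    proof -
      have "monomial_degree m \<le> (\<Sum>m\<in>Poly_Mapping.keys (ys ! j). monomial_degree m)"
        using that by (intro member_le_sum) auto
      also have "\<dots> \<le> e" unfolding e_def using y by (intro member_le_sum) auto
      finally show ?thesis .
    qed
    ultimately show ?thesis by (auto simp: supported_on_def)
  qed
  \<comment> \<open>The estimate below reduces to \<open>N + 1 \<le> (k e + 1)^r\<close>, which this choice violates.\<close>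
  define N where "N = (k * e + 1) ^ r"
  let ?U = "{m. Poly_Mapping.keys m \<subseteq> {0..<k} \<and> (\<forall>i. Poly_Mapping.lookup m i \<le> N)}"
  let ?V = "{m \<in> monomials r. monomial_degree m \<le> k * e * N}"
  let ?F = "substitute (\<lambda>j. ys ! j)"
  have U_sub: "supported_on ?U \<subseteq> supported_on {m. Poly_Mapping.keys m \<subseteq> {0..<length ys}}"
    by (rule supported_on_mono) (auto simp: k_def)
  have "card ?U \<le> card ?V"
  proof (rule card_le_of_injective_linear[where F = ?F])
    show "inj_on ?F (supported_on ?U)"
    proof (rule inj_onI)
      fix p q assume pq: "p \<in> supported_on ?U" "q \<in> supported_on ?U" "?F p = ?F q"
      have "?F (p - q) = 0"
        using substitute_add[of "\<lambda>j. ys ! j" "p - q" q] pq(3) by simp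
      then have "p - q = 0"
        using U_sub diff_supported_on[OF pq(1,2)]
        by (intro substitute_regular_eq_zero[OF reg, of 0]) auto
      then show "p = q" by simp
    qed
    show "?F ` supported_on ?U \<subseteq> supported_on ?V"
    proof
      fix x assume "x \<in> ?F ` supported_on ?U"
      then obtain p where p: "p \<in> supported_on ?U" "x = ?F p" by blast
      have "monomial_value (\<lambda>j. ys ! j) m \<in> ?T (k * e * N)" if m: "m \<in> ?U" for m
      proof -
        have pow: "(ys ! j) ^ a \<in> ?T (e * a)" if "j < k" for j a
        proof (induction a)
          case (Suc a)
          then show ?case using T_mult[OF ye[OF that] Suc] by simp
        qed (use T_one[of 0] in simp)
        have "finite A \<Longrightarrow> A \<subseteq> {0..<k} \<Longrightarrow> (\<Prod>j\<in>A. ys ! j ^ Poly_Mapping.lookup m j) \<in> ?T (card A * (e * N))" for A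
        proof (induction A rule: finite_induct)
          case (insert j A)
          have "ys ! j ^ Poly_Mapping.lookup m j \<in> ?T (e * N)"
            using pow[of j] insert.prems m by (intro T_mono[OF pow]) auto
          from T_mult[OF this insert.IH] show ?case using insert by simp
        qed (use T_one[of 0] in simp)
        from this[of "Poly_Mapping.keys m"] have "monomial_value (\<lambda>j. ys ! j) m \<in> ?T (card (Poly_Mapping.keys m) * (e * N))"
          using m by (simp add: monomial_value_def)
        moreover have "card (Poly_Mapping.keys m) \<le> k"
          using card_mono[of "{0..<k}" "Poly_Mapping.keys m"] m by simp
        then have "card (Poly_Mapping.keys m) * (e * N) \<le> k * e * N" by (simp add: mult.assoc)
        ultimately show ?thesis by (rule T_mono)
      qed
      then show "x \<in> supported_on ?V"
        using p unfolding p(2) substitute_def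
        by (intro sum_supported_on scale_in_supported_on) (auto simp: supported_on_def)
    qed
  qed (auto simp: substitute_add substitute_scale card_bounded_exponents finite_monomials_bounded_degree)
  then have "(N + 1) ^ k \<le> (k * e * N + 1) ^ r"
    using card_bounded_exponents(2)[of "{0..<k}" N] card_monomials_bounded_degree[of r "k * e * N"] by simp
  have "(N + 1) ^ (r + 1) \<le> (N + 1) ^ k"
    using k by (intro power_increasing) auto
  also have "\<dots> \<le> (k * e * N + 1) ^ r" by fact
  also have "\<dots> \<le> ((k * e + 1) * (N + 1)) ^ r"
    by (intro power_mono) (auto simp: algebra_simps)
  also have "\<dots> = N * (N + 1) ^ r"
    by (simp only: power_mult_distrib N_def)
  finally have "(N + 1) * (N + 1) ^ r \<le> N * (N + 1) ^ r" by simp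
  then show False by (subst (asm) mult_le_cancel2) simp
qed

section \<open>Depth of a polynomial ring\<close>

text \<open>A monomial ideal: membership is decided by each monomial separately, and a monomial lies in it when one of the
  first \<open>i\<close> variables divides it.\<close>

lemma generated_ideal_Vars:
  assumes "i \<le> r"
  shows "generated_ideal r (map Var [1..<Suc i]) =
    (supported_on {m \<in> monomials r. \<exists>j\<in>{1..i}. Poly_Mapping.lookup m j \<noteq> 0} :: 'k::field mpoly set)"
  using assms
proof (induction i)
  case (Suc i)
  let ?B = "\<lambda>i. {m \<in> monomials r. \<exists>j\<in>{1..i}. Poly_Mapping.lookup m j \<noteq> 0}"
  have IH: "generated_ideal r (map Var [1..<Suc i]) = (supported_on (?B i) :: 'k mpoly set)"
    using Suc by simp
  have eq: "generated_ideal r (map Var [1..<Suc (Suc i)]) =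
    {a + Var (Suc i) * u | a u. a \<in> (supported_on (?B i) :: 'k mpoly set) \<and> u \<in> supported_on (monomials r)}"
  proof -
    have "map Var [1..<Suc (Suc i)] = map Var [1..<Suc i] @ [Var (Suc i) :: 'k mpoly]" by simp
    show ?thesis
      unfolding \<open>map Var _ = _\<close> generated_ideal_snoc IH by (rule refl)
  qed
  show ?case unfolding eq
  proof (intro equalityI subsetI)
    fix x :: "'k mpoly" assume "x \<in> {a + Var (Suc i) * u | a u. a \<in> supported_on (?B i) \<and> u \<in> supported_on (monomials r)}"
    then obtain a u where x: "x = a + Var (Suc i) * u" "a \<in> supported_on (?B i)" "u \<in> supported_on (monomials r)"
      by blast
    have "a \<in> supported_on (?B (Suc i))"
      using x(2) supported_on_mono[of "?B i" "?B (Suc i)"] by fastforce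
    moreover have "Var (Suc i) * u \<in> supported_on (?B (Suc i))"
      unfolding Var_def
    proof (rule mult_supported_on[OF _ x(3)])
      show "Poly_Mapping.single (Poly_Mapping.single (Suc i) 1) 1 \<in> supported_on {Poly_Mapping.single (Suc i) 1}"
        by (rule single_supported_on) simp
    qed (use Suc.prems in \<open>auto simp: lookup_add single_in_monomials_iff intro!: add_in_monomials
        bexI[of _ "Suc i"]\<close>)
    ultimately show "x \<in> supported_on (?B (Suc i))" unfolding x(1) by (rule add_supported_on)
  next
    fix x :: "'k mpoly" assume x: "x \<in> supported_on (?B (Suc i))"
    define u where "u = quotient_by_Var (Suc i) x"
    have "u \<in> supported_on (monomials r)"
      using x unfolding supported_on_def u_def
      by (auto simp: in_keys_iff lookup_quotient_by_Var dest!: add_in_monomialsD)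
    moreover have "x - Var (Suc i) * u \<in> supported_on (?B i)"
      using x unfolding supported_on_iff u_def
      by (auto simp: lookup_minus_Var_quotient atLeastAtMostSuc_conv)
    moreover have "x = (x - Var (Suc i) * u) + Var (Suc i) * u" by simp
    ultimately show "x \<in> {a + Var (Suc i) * u | a u. a \<in> supported_on (?B i) \<and> u \<in> supported_on (monomials r)}"
      by blast
  qed
qed (auto simp: supported_on_def)

lemma regular_Vars: "regular_polynomials r (map Var [1..<Suc r] :: 'k::field mpoly list)"
  unfolding regular_polynomials_def
proof (intro conjI allI impI ballI)
  show "set (map Var [1..<Suc r] :: 'k mpoly list) \<subseteq> supported_on (monomials r)"
    by (auto intro!: Var_in_polys)
  show "1 \<notin> generated_ideal r (map Var [1..<Suc r] :: 'k mpoly list)"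
    unfolding generated_ideal_Vars[OF order_refl] by (auto simp: supported_on_def)
next
  fix i and x :: "'k mpoly" assume i: "i < length (map Var [1..<Suc r] :: 'k mpoly list)" and x: "x \<in> supported_on (monomials r)"
    and "map Var [1..<Suc r] ! i * x \<in> generated_ideal r (take i (map Var [1..<Suc r]))"
  moreover have t: "take i (map Var [1..<Suc r]) = (map Var [1..<Suc i] :: 'k mpoly list)"
    using i by (simp add: take_map take_upt del: upt_Suc)
  moreover have "map Var [1..<Suc r] ! i = (Var (Suc i) :: 'k mpoly)" using i by (simp del: upt_Suc)
  ultimately have *: "Var (Suc i) * x \<in> supported_on {m \<in> monomials r. \<exists>j\<in>{1..i}. Poly_Mapping.lookup m j \<noteq> 0}"
    using generated_ideal_Vars[of i r, where 'k = 'k] i by (simp del: upt_Suc)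
  have "m \<in> {m \<in> monomials r. \<exists>j\<in>{1..i}. Poly_Mapping.lookup m j \<noteq> 0}" if m: "m \<in> Poly_Mapping.keys x" for m
  proof -
    have "Poly_Mapping.single (Suc i) 1 + m \<in> Poly_Mapping.keys (Var (Suc i) * x)"
      using m lookup_Var_mult(1)[of "Suc i" x m] by (simp add: in_keys_iff)
    then have "\<exists>j\<in>{1..i}. Poly_Mapping.lookup (Poly_Mapping.single (Suc i) 1 + m) j \<noteq> 0"
      using * by (auto simp: supported_on_def)
    then show ?thesis using m x by (auto simp: lookup_add lookup_single when_def supported_on_def)
  qed
  moreover have "i \<le> r" using i by (simp del: upt_Suc)
  ultimately show "x \<in> generated_ideal r (take i (map Var [1..<Suc r]))"
    unfolding t by (subst generated_ideal_Vars) (auto simp: supported_on_def)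
qed

text \<open>The isomorphism \<open>\<theta>\<close> identifies regular sequences of \<open>S\<close> with regular sequences of polynomials, whose
  length is at most \<open>r\<close>; the images of the variables attain this bound. The shift does not change the module
  structure.\<close>

lemma depth_of_polynomial_algebra:
  fixes S :: "('k::field, 's) graded"
  assumes S: "cring S"
    and iso: "graded_algebra_iso ring_of_type_algebra (polynomial_ring r) S \<theta>"
  shows "depth S (shift (ideal_module S (carrier S)) s) = enat r"
proof -
  let ?M = "shift (ideal_module S (carrier S)) s"
  let ?P = "supported_on (monomials r) :: 'k mpoly set"
  interpret S: cring S by (rule S)
  have M: "carrier ?M = carrier S" "add ?M = add S" "ring.zero ?M = ring.zero S" "module.smult ?M = monoid.mult S"
    by (simp_all add: shift_def ideal_module_def)
  interpret M: abelian_group ?M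
  proof (rule abelian_groupI)
    fix x assume "x \<in> carrier ?M"
    then show "\<exists>y\<in>carrier ?M. y \<oplus>\<^bsub>?M\<^esub> x = \<zero>\<^bsub>?M\<^esub>"
      unfolding M by (intro bexI[of _ "\<ominus>\<^bsub>S\<^esub> x"]) (simp_all add: S.l_neg)
  qed (simp_all add: M S.a_ac)
  from iso have hom: "\<theta> \<in> graded_algebra_hom ring_of_type_algebra (polynomial_ring r) S"
    and bij: "bij_betw \<theta> ?P (carrier S)"
    and gr: "\<And>t. \<theta> ` homogeneous r t = hcomp S t"
    by (auto simp: graded_algebra_iso_def polynomial_ring_simps)
  note \<theta> = graded_algebra_homD[OF hom, unfolded polynomial_ring_simps ring_of_type_algebra_simps]
  have inj: "\<theta> p = \<theta> q \<longleftrightarrow> p = q" if "p \<in> ?P" "q \<in> ?P" for p q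
    using bij that by (auto simp: bij_betw_def inj_on_def)
  have surj: "\<exists>p\<in>?P. x = \<theta> p" if "x \<in> carrier S" for x
    using bij that by (auto simp: bij_betw_def)
  have \<theta>0: "\<theta> 0 = \<zero>\<^bsub>S\<^esub>"
    using \<theta>(3)[of 0 0] \<theta>(1)[of 0] S.add.l_cancel_one' by simp
  have finsum: "finsum ?M (\<lambda>j. \<theta> (f j)) A = \<theta> (sum f A)" if "finite A" "\<And>j. j \<in> A \<Longrightarrow> f j \<in> ?P" for f and A :: "nat set"
    using that
  proof (induction A rule: finite_induct)
    case empty
    show ?case using M.finsum_empty by (simp add: \<theta>0 M)
  next
    case (insert a A)
    have "finsum ?M (\<lambda>j. \<theta> (f j)) (insert a A) = \<theta> (f a) \<oplus>\<^bsub>?M\<^esub> finsum ?M (\<lambda>j. \<theta> (f j)) A"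
      using insert by (intro M.finsum_insert) (auto simp: M \<theta>(1))
    also have "\<dots> = \<theta> (f a) \<oplus>\<^bsub>S\<^esub> \<theta> (sum f A)" using insert by (simp add: M)
    also have "\<dots> = \<theta> (f a + sum f A)"
      using insert by (intro \<theta>(3)[symmetric] sum_supported_on) auto
    finally show ?case using insert by simp
  qed
  have seq: "seq_times_module (map \<theta> ys) ?M = \<theta> ` generated_ideal r ys" if ys: "set ys \<subseteq> ?P" for ys
  proof (intro equalityI subsetI)
    have ysj: "ys ! j \<in> ?P" if "j < length ys" for j using ys that by auto
    have val: "finsum ?M (\<lambda>j. (map \<theta> ys ! j) \<odot>\<^bsub>?M\<^esub> \<theta> (v j)) {..<length ys} = \<theta> (\<Sum>j<length ys. ys ! j * v j)"
      if v: "\<And>j. j < length ys \<Longrightarrow> v j \<in> ?P" for v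
    proof -
      have "finsum ?M (\<lambda>j. (map \<theta> ys ! j) \<odot>\<^bsub>?M\<^esub> \<theta> (v j)) {..<length ys} =
          finsum ?M (\<lambda>j. \<theta> (ys ! j * v j)) {..<length ys}"
        by (rule M.finsum_cong') (auto simp: M \<theta>(1,2) v ysj mult_in_polys)
      also have "\<dots> = \<theta> (\<Sum>j<length ys. ys ! j * v j)"
        by (rule finsum) (auto simp: v ysj mult_in_polys)
      finally show ?thesis .
    qed
    {
      fix x assume "x \<in> seq_times_module (map \<theta> ys) ?M"
      then obtain u where u: "u \<in> {..<length ys} \<rightarrow> carrier S"
        "x = finsum ?M (\<lambda>j. (map \<theta> ys ! j) \<odot>\<^bsub>?M\<^esub> u j) {..<length ys}"
        by (auto simp: seq_times_module_def M)
      define v where "v j = (if j < length ys then inv_into ?P \<theta> (u j) else 0)" for j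
      have v: "v j \<in> ?P" for j
        using u(1) bij by (auto simp: v_def Pi_iff bij_betw_def intro!: inv_into_into)
      have uv: "u j = \<theta> (v j)" if "j < length ys" for j
        using u(1) that by (simp add: v_def Pi_iff bij_betw_inv_into_right[OF bij])
      have "x = finsum ?M (\<lambda>j. (map \<theta> ys ! j) \<odot>\<^bsub>?M\<^esub> \<theta> (v j)) {..<length ys}"
        unfolding u(2) by (rule M.finsum_cong') (auto simp: M uv v ysj \<theta>(1))
      then have "x = \<theta> (\<Sum>j<length ys. ys ! j * v j)"
        using val[of v, OF v] by simp
      then show "x \<in> \<theta> ` generated_ideal r ys"
        using v unfolding generated_ideal_def by blast
    next
      fix x assume "x \<in> \<theta> ` generated_ideal r ys"
      then obtain v where v: "\<And>j. v j \<in> ?P" "x = \<theta> (\<Sum>j<length ys. ys ! j * v j)"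
        by (auto simp: generated_ideal_def)
      have "x = finsum ?M (\<lambda>j. (map \<theta> ys ! j) \<odot>\<^bsub>?M\<^esub> \<theta> (v j)) {..<length (map \<theta> ys)}"
        using val[of v] v by simp
      moreover have "(\<lambda>j. \<theta> (v j)) \<in> {..<length (map \<theta> ys)} \<rightarrow> carrier ?M"
        using v(1) by (auto simp: M \<theta>(1))
      ultimately show "x \<in> seq_times_module (map \<theta> ys) ?M"
        unfolding seq_times_module_def mem_Collect_eq by (intro exI[of _ "\<lambda>j. \<theta> (v j)"] conjI)
    }
  qed
  have ideal_in: "generated_ideal r ys \<subseteq> ?P" if "set ys \<subseteq> ?P" for ys
    using that unfolding generated_ideal_def by (auto intro!: sum_supported_on mult_in_polys)
  have reg: "regular_sequence S ?M (map \<theta> ys) \<longleftrightarrow> regular_polynomials r ys" if ys: "set ys \<subseteq> ?P" for ys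
  proof -
    have mem: "\<theta> p \<in> \<theta> ` generated_ideal r zs \<longleftrightarrow> p \<in> generated_ideal r zs" if "p \<in> ?P" "set zs \<subseteq> ?P" for p zs
    proof
      assume "\<theta> p \<in> \<theta> ` generated_ideal r zs"
      then obtain q where q: "\<theta> p = \<theta> q" "q \<in> generated_ideal r zs" by (rule imageE)
      then have "p = q" using inj[OF that(1) subsetD[OF ideal_in[OF that(2)] q(2)]] by simp
      then show "p \<in> generated_ideal r zs" using q(2) by simp
    qed (rule imageI)
    have "set (map \<theta> ys) \<subseteq> carrier S" using ys \<theta>(1) by auto
    moreover have "(\<forall>x\<in>carrier ?M. (map \<theta> ys ! i) \<odot>\<^bsub>?M\<^esub> x \<in> seq_times_module (take i (map \<theta> ys)) ?M \<longrightarrow>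
        x \<in> seq_times_module (take i (map \<theta> ys)) ?M) \<longleftrightarrow>
      (\<forall>x\<in>?P. ys ! i * x \<in> generated_ideal r (take i ys) \<longrightarrow> x \<in> generated_ideal r (take i ys))"
      if i: "i < length ys" for i
    proof -
      have tk: "set (take i ys) \<subseteq> ?P" by (rule subset_trans[OF set_take_subset ys])
      have yi: "ys ! i \<in> ?P" using ys i by auto
      have e: "seq_times_module (take i (map \<theta> ys)) ?M = \<theta> ` generated_ideal r (take i ys)"
        using seq[OF tk] by (simp add: take_map)
      \<comment> \<open>Quantifiers over \<open>S\<close> become quantifiers over polynomials.\<close>
      have cS: "carrier S = \<theta> ` ?P" using bij by (simp add: bij_betw_def)
      have prod: "map \<theta> ys ! i \<otimes>\<^bsub>S\<^esub> \<theta> p = \<theta> (ys ! i * p)" if "p \<in> ?P" for p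
        using i yi that by (simp add: \<theta>(2))
      show ?thesis
        unfolding e M unfolding cS ball_simps
        by (rule ball_cong[OF refl]) (simp only: prod mem[OF _ tk] mult_in_polys[OF yi])
    qed
    moreover have "seq_times_module (map \<theta> ys) ?M \<noteq> carrier ?M \<longleftrightarrow> 1 \<notin> generated_ideal r ys"
    proof -
      have "1 \<in> generated_ideal r ys" if "\<theta> ` generated_ideal r ys = \<theta> ` ?P"
        using mem[OF one_in_polys ys] imageI[OF one_in_polys, of \<theta> r] unfolding that by blast
      moreover have "generated_ideal r ys = ?P" if "1 \<in> generated_ideal r ys"
      proof (rule equalityI[OF ideal_in[OF ys]])
        show "?P \<subseteq> generated_ideal r ys" using generated_ideal_mult[OF that] by auto
      qed
      moreover have "seq_times_module (map \<theta> ys) ?M \<noteq> carrier ?M \<longleftrightarrow> \<theta> ` generated_ideal r ys \<noteq> \<theta> ` ?P"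
        by (simp only: seq[OF ys] M bij_betw_imp_surj_on[OF bij])
      ultimately show ?thesis by metis
    qed
    ultimately show ?thesis
      using ys unfolding regular_sequence_def regular_polynomials_def length_map by blast
  qed
  have "\<theta> 1 \<noteq> \<theta> 0" using inj[of 1 0] by simp
  then have nz: "carrier ?M \<noteq> {\<zero>\<^bsub>?M\<^esub>}"
    using \<theta>(1)[of 0] \<theta>(1)[of 1] by (auto simp: M)
  have "(SUP ys\<in>{ys. set ys \<subseteq> irrelevant_ideal S \<and> regular_sequence S ?M ys}. enat (length ys)) = enat r"
  proof (rule antisym)
    show "(SUP ys\<in>{ys. set ys \<subseteq> irrelevant_ideal S \<and> regular_sequence S ?M ys}. enat (length ys)) \<le> enat r"
    proof (rule SUP_least)
      fix zs assume "zs \<in> {ys. set ys \<subseteq> irrelevant_ideal S \<and> regular_sequence S ?M ys}"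
      then have zs: "regular_sequence S ?M zs" by simp
      then have "set zs \<subseteq> \<theta> ` ?P" using bij by (simp add: regular_sequence_def bij_betw_def)
      then have z: "z \<in> \<theta> ` ?P" if "z \<in> set zs" for z using that by (rule subsetD)
      define ys where "ys = map (inv_into ?P \<theta>) zs"
      have ys: "set ys \<subseteq> ?P" "zs = map \<theta> ys"
        using inv_into_into[OF z] f_inv_into_f[OF z] by (auto simp: ys_def intro!: map_idI[symmetric])
      then have "regular_polynomials r ys" using zs reg[OF ys(1)] by simp
      then show "enat (length zs) \<le> enat r"
        using length_regular_polynomials_le ys(2) by simp
    qed
    let ?X = "map Var [1..<Suc r] :: 'k mpoly list"
    have "set ?X \<subseteq> ?P" by (rule conjunct1[OF regular_Vars[unfolded regular_polynomials_def]])
    then have "regular_sequence S ?M (map \<theta> ?X)" using reg regular_Vars by blast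
    moreover have "set (map \<theta> ?X) \<subseteq> irrelevant_ideal S"
    proof
      fix x assume "x \<in> set (map \<theta> ?X)"
      then have "x \<in> (\<lambda>i. \<theta> (Var i)) ` {1..r}"
        by (simp only: set_map set_upt image_image atLeastLessThanSuc_atLeastAtMost)
      then obtain i where i: "x = \<theta> (Var i)" "i \<in> {1..r}" by (rule imageE)
      have "Var i \<in> (homogeneous r 1 :: 'k mpoly set)"
        unfolding span_Vars[symmetric] using i by (intro pm.span_base) simp
      then have "x \<in> (\<Union>t\<in>{0<..}. hcomp S t)" using i(1) \<theta>(6)[of _ 1] by (intro UN_I[of 1]) auto
      then show "x \<in> irrelevant_ideal S" unfolding irrelevant_ideal_def genideal_def by blast
    qed
    ultimately have "enat (length (map \<theta> ?X)) \<le>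
      (SUP ys\<in>{ys. set ys \<subseteq> irrelevant_ideal S \<and> regular_sequence S ?M ys}. enat (length ys))"
      by (intro SUP_upper) simp
    then show "enat r \<le> (SUP ys\<in>{ys. set ys \<subseteq> irrelevant_ideal S \<and> regular_sequence S ?M ys}. enat (length ys))"
      by (simp del: upt_Suc)
  qed
  then show ?thesis using nz by (simp add: depth_def)
qed

section \<open>From Hilbert decompositions to Hilbert functions\<close>

definition polynomial_ring_hilbert :: "nat \<Rightarrow> int \<Rightarrow> nat" where
  "polynomial_ring_hilbert r t = card {m \<in> monomials r. int (monomial_degree m) = t}"

text \<open>A pair \<open>(r, s)\<close> stands for a summand \<open>S(-s)\<close> with \<open>S\<close> a polynomial ring in \<open>r\<close> variables, so the second
  condition says that the summands have Hilbert function \<open>F\<close> in total.\<close>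

definition hilbert_pairs :: "nat \<Rightarrow> (int \<Rightarrow> nat) \<Rightarrow> (nat \<times> int) list \<Rightarrow> bool" where
  "hilbert_pairs n F rs \<longleftrightarrow> (\<forall>(r, s)\<in>set rs. r \<le> n) \<and>
     (\<forall>t. F t = (\<Sum>(r, s)\<leftarrow>rs. polynomial_ring_hilbert r (t - s)))"

lemma finite_monomials_degree: "finite {m \<in> monomials r. int (monomial_degree m) = t}"
  by (rule finite_subset[OF _ finite_monomials_bounded_degree[of r "nat t"]]) auto

lemma sum_list_pairs_nth:
  "(\<Sum>(r, s)\<leftarrow>rs. h r s) = (\<Sum>i<length rs. h (fst (rs ! i)) (snd (rs ! i)))"
  by (simp add: sum_list_sum_nth lessThan_atLeast0 case_prod_beta)

lemma ideal_module_simps: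
  fixes U n
  defines "V \<equiv> restrict_scalars (polynomial_ring n) (ideal_module (polynomial_ring n) (supported_on U))
     :: ('k::field, 'k mpoly) graded"
  assumes U: "U \<subseteq> monomials n"
  shows "carrier V = supported_on U" "add V = (+)" "module.smult V = scale"
    "hcomp V t = supported_on {m \<in> U. int (monomial_degree m) = t}"
  using U unfolding V_def restrict_scalars_def ideal_module_def
  by (auto simp: polynomial_ring_simps fun_eq_iff const_mult_eq_scale scale_mult_left)
     (auto simp: supported_on_def)

lemma direct_sum_simps:
  fixes H :: "(('k, 's) graded \<times> int) list"
  defines "V \<equiv> direct_sum (map (\<lambda>(S, s). shift S (- s)) H)"
  shows "carrier V = (\<Pi>\<^sub>E i\<in>{..<length H}. carrier (fst (H ! i)))"
    "add V = (\<lambda>f g. \<lambda>i\<in>{..<length H}. f i \<oplus>\<^bsub>fst (H ! i)\<^esub> g i)"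
    "module.smult V = (\<lambda>k f. \<lambda>i\<in>{..<length H}. k \<odot>\<^bsub>fst (H ! i)\<^esub> f i)"
    "hcomp V t = (\<Pi>\<^sub>E i\<in>{..<length H}. hcomp (fst (H ! i)) (t - snd (H ! i)))"
  unfolding V_def direct_sum_def
  by (auto simp: shift_def case_prod_beta fun_eq_iff restrict_def intro!: PiE_cong)

lemma graded_algebra_iso_inverse:
  fixes S :: "('k::field, 's) graded"
  assumes iso: "graded_algebra_iso ring_of_type_algebra (polynomial_ring r) S \<theta>"
  obtains \<theta>' where
    "\<And>x. x \<in> carrier S \<Longrightarrow> \<theta>' x \<in> supported_on (monomials r)"
    "\<And>x. x \<in> carrier S \<Longrightarrow> \<theta> (\<theta>' x) = x"
    "\<And>x y. x \<in> carrier S \<Longrightarrow> y \<in> carrier S \<Longrightarrow> \<theta>' (x \<oplus>\<^bsub>S\<^esub> y) = \<theta>' x + \<theta>' y"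
    "\<And>c x. x \<in> carrier S \<Longrightarrow> \<theta>' (c \<odot>\<^bsub>S\<^esub> x) = scale c (\<theta>' x)"
    "\<And>x t. x \<in> hcomp S t \<Longrightarrow> \<theta>' x \<in> homogeneous r t"
proof -
  let ?P = "supported_on (monomials r) :: 'k mpoly set"
  from iso have hom: "\<theta> \<in> graded_algebra_hom ring_of_type_algebra (polynomial_ring r) S"
    and bij: "bij_betw \<theta> ?P (carrier S)"
    and gr: "\<And>t. \<theta> ` homogeneous r t = hcomp S t"
    by (auto simp: graded_algebra_iso_def polynomial_ring_simps)
  note \<theta> = graded_algebra_homD[OF hom, unfolded polynomial_ring_simps ring_of_type_algebra_simps const_mult_eq_scale]
  let ?i = "inv_into ?P \<theta>"
  have i1: "?i x \<in> ?P" if "x \<in> carrier S" for x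
    using bij that by (auto simp: bij_betw_def intro!: inv_into_into)
  have i2: "\<theta> (?i x) = x" if "x \<in> carrier S" for x
    using bij_betw_inv_into_right[OF bij that] .
  have i3: "?i (\<theta> p) = p" if "p \<in> ?P" for p
    using bij_betw_inv_into_left[OF bij that] .
  show thesis
  proof (rule that[of ?i])
    fix x y assume xy: "x \<in> carrier S" "y \<in> carrier S"
    have "x \<oplus>\<^bsub>S\<^esub> y = \<theta> (?i x + ?i y)" using xy by (simp add: \<theta>(3) i1 i2)
    then show "?i (x \<oplus>\<^bsub>S\<^esub> y) = ?i x + ?i y" using xy i3 by (simp add: i1 add_supported_on)
  next
    fix c x assume x: "x \<in> carrier S"
    have "c \<odot>\<^bsub>S\<^esub> x = \<theta> (scale c (?i x))" using x by (simp add: \<theta>(5) i1 i2)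
    then show "?i (c \<odot>\<^bsub>S\<^esub> x) = scale c (?i x)" using x i3 by (simp add: i1 scale_in_supported_on)
  next
    fix x t assume "x \<in> hcomp S t"
    then obtain p where p: "p \<in> homogeneous r t" "x = \<theta> p" using gr by blast
    then have "?i x = p" using i3[OF subsetD[OF homogeneous_subset p(1)]] by simp
    then show "?i x \<in> homogeneous r t" using p(1) by simp
  qed (auto intro: i1 i2)
qed

text \<open>In degree \<open>t\<close> both sides of the isomorphism have bases that can be counted: the monomials of the ideal, and the
  disjoint union of the monomials of degree \<open>t - s\<close> in the polynomial rings isomorphic to the summands. Transport
  to coordinates gives an injective linear map \<open>F\<close> from left to right and another one, \<open>G\<close>, back.\<close>

lemma hilbert_pairs_of_decomposition:
  assumes U: "U \<subseteq> monomials n"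
    and H: "hilbert_decomposition (ring_of_type_algebra :: 'k::field ring) (polynomial_ring n)
        (ideal_module (polynomial_ring n) (supported_on U)) H"
  shows "\<exists>rs. hilbert_pairs n (\<lambda>t. card {m \<in> U. int (monomial_degree m) = t}) rs \<and>
     hdepth_decomposition H = (INF (r, s)\<in>set rs. enat r)"
proof -
  let ?K = "ring_of_type_algebra :: 'k ring"
  let ?l = "length H"
  let ?S = "\<lambda>i. fst (H ! i)" and ?s = "\<lambda>i. snd (H ! i)"
  let ?V = "restrict_scalars (polynomial_ring n) (ideal_module (polynomial_ring n) (supported_on U))
     :: ('k, 'k mpoly) graded"
  let ?D = "direct_sum (map (\<lambda>(S, s). shift S (- s)) H)"
  from H have retr: "graded_retract ?K (polynomial_ring n) (?S i)" if "i < ?l" for i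
    using nth_mem[OF that] by (auto simp: hilbert_decomposition_def case_prod_beta)
  have "\<forall>i. \<exists>r. i < ?l \<longrightarrow> r \<le> n \<and> (\<exists>\<theta>. graded_algebra_iso ?K (polynomial_ring r) (?S i) \<theta>)"
    using graded_retract_polynomial_ring[OF retr] by metis
  then obtain r where "\<forall>i. i < ?l \<longrightarrow> r i \<le> n \<and> (\<exists>\<theta>. graded_algebra_iso ?K (polynomial_ring (r i)) (?S i) \<theta>)"
    by (rule choice[THEN exE])
  then have rn: "\<And>i. i < ?l \<Longrightarrow> r i \<le> n"
    and "\<forall>i. \<exists>\<theta>. i < ?l \<longrightarrow> graded_algebra_iso ?K (polynomial_ring (r i)) (?S i) \<theta>" by blast+
  from choice[OF this(2)] obtain \<theta> where iso: "\<And>i. i < ?l \<Longrightarrow> graded_algebra_iso ?K (polynomial_ring (r i)) (?S i) (\<theta> i)"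
    by blast
  have cr: "cring (?S i)" if "i < ?l" for i
    using retr[OF that] by (auto simp: graded_retract_def graded_algebra_def algebra_def)
  let ?P = "\<lambda>i. supported_on (monomials (r i)) :: 'k mpoly set"
  \<comment> \<open>The properties of an inverse isomorphism, in a form that permits choosing one for every \<open>i\<close>.\<close>
  let ?Q = "\<lambda>i \<theta>'. (\<forall>x\<in>carrier (?S i). \<theta>' x \<in> ?P i \<and> \<theta> i (\<theta>' x) = x \<and> (\<forall>c. \<theta>' (c \<odot>\<^bsub>?S i\<^esub> x) = scale c (\<theta>' x)) \<and>
       (\<forall>y\<in>carrier (?S i). \<theta>' (x \<oplus>\<^bsub>?S i\<^esub> y) = \<theta>' x + \<theta>' y)) \<and> (\<forall>t. \<forall>x\<in>hcomp (?S i) t. \<theta>' x \<in> homogeneous (r i) t)"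
  have "\<forall>i. \<exists>\<theta>'. i < ?l \<longrightarrow> ?Q i \<theta>'"
  proof (intro allI)
    fix i
    show "\<exists>\<theta>'. i < ?l \<longrightarrow> ?Q i \<theta>'"
    proof (cases "i < ?l")
      case True
      show ?thesis
        by (rule graded_algebra_iso_inverse[OF iso[OF True]]) blast
    qed simp
  qed
  from choice[OF this] obtain \<theta>' where \<theta>': "\<And>i. i < ?l \<Longrightarrow> ?Q i (\<theta>' i)" by blast
  from H obtain f where bij: "bij_betw f (carrier ?V) (carrier ?D)"
    and add: "\<And>x y. x \<in> carrier ?V \<Longrightarrow> y \<in> carrier ?V \<Longrightarrow> f (x \<oplus>\<^bsub>?V\<^esub> y) = f x \<oplus>\<^bsub>?D\<^esub> f y"
    and sm: "\<And>c x. x \<in> carrier ?V \<Longrightarrow> f (c \<odot>\<^bsub>?V\<^esub> x) = c \<odot>\<^bsub>?D\<^esub> f x"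
    and hc: "\<And>t. f ` hcomp ?V t = hcomp ?D t"
    by (auto simp: hilbert_decomposition_def graded_vs_iso_def ring_of_type_algebra_simps)
  note f = bij add sm hc
  note f = f[unfolded ideal_module_simps[OF U] direct_sum_simps]
  have dim: "card {m \<in> U. int (monomial_degree m) = t} = (\<Sum>i<?l. polynomial_ring_hilbert (r i) (t - ?s i))" for t
  proof -
    let ?W = "{m \<in> U. int (monomial_degree m) = t}"
    let ?Ci = "\<lambda>i. {m \<in> monomials (r i). int (monomial_degree m) = t - ?s i}"
    let ?C = "Sigma {..<?l} ?Ci"
    have finW: "finite ?W"
      by (rule finite_subset[OF _ finite_monomials_degree[of n t]]) (use U in auto)
    have finC: "finite ?C" by (intro finite_SigmaI finite_monomials_degree) simp
    have WU: "p \<in> supported_on U" if "p \<in> supported_on ?W" for p :: "'k mpoly"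
      using that supported_on_mono[of ?W U] by auto
    have fi: "f p i \<in> hcomp (?S i) (t - ?s i)" "f p i \<in> carrier (?S i)" if "p \<in> supported_on ?W" "i < ?l" for p i
    proof -
      have "f p \<in> (\<Pi>\<^sub>E i\<in>{..<?l}. hcomp (?S i) (t - ?s i))" using f(4)[of t] that(1) by blast
      then show "f p i \<in> hcomp (?S i) (t - ?s i)" using that(2) by (auto dest: PiE_mem)
      have "f p \<in> (\<Pi>\<^sub>E i\<in>{..<?l}. carrier (?S i))" using f(1) WU[OF that(1)] by (auto simp: bij_betw_def)
      then show "f p i \<in> carrier (?S i)" using that(2) by (auto dest: PiE_mem)
    qed
    define F where "F p = (\<Sum>c\<in>?C. Poly_Mapping.single c (Poly_Mapping.lookup (\<theta>' (fst c) (f p (fst c))) (snd c)))" for p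
    have lF: "Poly_Mapping.lookup (F p) c = (if c \<in> ?C then Poly_Mapping.lookup (\<theta>' (fst c) (f p (fst c))) (snd c) else 0)" for p c
      unfolding F_def by (rule lookup_sum_singles[OF finC])
    have le1: "card ?W \<le> card ?C"
    proof (rule card_le_of_injective_linear[where F = F, OF finW finC])
      fix p q :: "'k mpoly" assume pq: "p \<in> supported_on ?W" "q \<in> supported_on ?W"
      show "F (p + q) = F p + F q"
        by (rule poly_mapping_eqI) (use \<theta>' fi[OF pq(1)] fi[OF pq(2)] in
          \<open>auto simp: lF lookup_add f(2)[OF WU WU, OF pq]\<close>)
    next
      fix c and p :: "'k mpoly" assume p: "p \<in> supported_on ?W"
      show "F (scale c p) = scale c (F p)"
        by (rule poly_mapping_eqI) (use \<theta>' fi[OF p] in \<open>auto simp: lF f(3)[OF WU, OF p]\<close>)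
    next
      show "inj_on F (supported_on ?W)"
      proof (rule inj_onI)
        fix p q assume pq: "p \<in> supported_on ?W" "q \<in> supported_on ?W" "F p = F q"
        have "f p i = f q i" if i: "i < ?l" for i
        proof -
          have h: "\<theta>' i (f p i) \<in> homogeneous (r i) (t - ?s i)" "\<theta>' i (f q i) \<in> homogeneous (r i) (t - ?s i)"
            using \<theta>'[OF i] fi[OF pq(1) i] fi[OF pq(2) i] by blast+
          have "\<theta>' i (f p i) = \<theta>' i (f q i)"
          proof (rule poly_mapping_eqI)
            fix u
            show "Poly_Mapping.lookup (\<theta>' i (f p i)) u = Poly_Mapping.lookup (\<theta>' i (f q i)) u"
            proof (cases "u \<in> ?Ci i")
              case True
              then have "(i, u) \<in> ?C" using i by simp
              then show ?thesis using lF[of p "(i, u)"] lF[of q "(i, u)"] pq(3) by simp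
            next
              case False
              then show ?thesis using h unfolding supported_on_iff by simp
            qed
          qed
          then have "\<theta> i (\<theta>' i (f p i)) = \<theta> i (\<theta>' i (f q i))" by (rule arg_cong)
          moreover have inv: "\<theta> i (\<theta>' i x) = x" if "x \<in> carrier (?S i)" for x
            using \<theta>'[OF i] that by blast
          ultimately show ?thesis
            by (simp only: inv[OF fi(2)[OF pq(1) i]] inv[OF fi(2)[OF pq(2) i]])
        qed
        moreover have "f p \<in> (\<Pi>\<^sub>E i\<in>{..<?l}. carrier (?S i))" "f q \<in> (\<Pi>\<^sub>E i\<in>{..<?l}. carrier (?S i))"
          using f(1) WU pq(1,2) by (auto simp: bij_betw_def)
        ultimately have "f p = f q" by (intro PiE_ext[of "f p" "{..<?l}" "\<lambda>i. carrier (?S i)" "f q"]) auto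
        then show "p = q" using f(1) WU pq(1,2) by (auto simp: bij_betw_def inj_on_def)
      qed
      show "F ` supported_on ?W \<subseteq> supported_on ?C"
        using lF by (fastforce simp: supported_on_iff)
    qed
    define part where "part q i = (\<Sum>u\<in>?Ci i. Poly_Mapping.single u (Poly_Mapping.lookup q (i, u)))" for q :: "nat \<times> (nat \<Rightarrow>\<^sub>0 nat) \<Rightarrow>\<^sub>0 'k" and i
    have lpart: "Poly_Mapping.lookup (part q i) u = (if u \<in> ?Ci i then Poly_Mapping.lookup q (i, u) else 0)" for q i u
      unfolding part_def by (rule lookup_sum_singles[OF finite_monomials_degree])
    have part_in: "part q i \<in> homogeneous (r i) (t - ?s i)" for q i
      unfolding supported_on_iff lpart by simp
    have part_P: "part q i \<in> ?P i" for q i using part_in homogeneous_subset by blast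
    define g where "g q = (\<lambda>i\<in>{..<?l}. \<theta> i (part q i))" for q
    have hom: "\<theta> i \<in> graded_algebra_hom ?K (polynomial_ring (r i)) (?S i)" and inj\<theta>: "inj_on (\<theta> i) (?P i)" if "i < ?l" for i
      using iso[OF that] by (auto simp: graded_algebra_iso_def bij_betw_def polynomial_ring_simps)
    note \<theta> = graded_algebra_homD[OF hom, unfolded polynomial_ring_simps ring_of_type_algebra_simps const_mult_eq_scale]
    have g_in: "g q \<in> f ` supported_on ?W" for q
      unfolding f(4) g_def using \<theta>(6) part_in by auto
    define G where "G q = inv_into (supported_on ?W) f (g q)" for q
    have fG: "f (G q) = g q" and GW: "G q \<in> supported_on ?W" for q
      unfolding G_def using g_in by (auto intro: f_inv_into_f inv_into_into)
    have injW: "p = q" if "p \<in> supported_on ?W" "q \<in> supported_on ?W" "f p = f q" for p q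
      using f(1) WU that by (auto simp: bij_betw_def inj_on_def)
    have le2: "card ?C \<le> card ?W"
    proof (rule card_le_of_injective_linear[where F = G, OF finC finW])
      fix p q :: "nat \<times> (nat \<Rightarrow>\<^sub>0 nat) \<Rightarrow>\<^sub>0 'k"
      have part_add: "part (p + q) i = part p i + part q i" for i
        by (rule poly_mapping_eqI) (simp add: lpart lookup_add)
      show "G (p + q) = G p + G q"
      proof (rule injW)
        show "f (G (p + q)) = f (G p + G q)"
          unfolding f(2)[OF WU WU, OF GW GW] fG
          by (auto simp: g_def fun_eq_iff part_add \<theta>(3) part_P)
      qed (auto intro: GW add_supported_on)
    next
      fix c and p :: "nat \<times> (nat \<Rightarrow>\<^sub>0 nat) \<Rightarrow>\<^sub>0 'k"
      have part_scale: "part (scale c p) i = scale c (part p i)" for i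
        by (rule poly_mapping_eqI) (simp add: lpart)
      show "G (scale c p) = scale c (G p)"
      proof (rule injW)
        show "f (G (scale c p)) = f (scale c (G p))"
          unfolding f(3)[OF WU, OF GW] fG
          by (auto simp: g_def fun_eq_iff part_scale \<theta>(5) part_P)
      qed (auto intro: GW scale_in_supported_on)
    next
      show "inj_on G (supported_on ?C)"
      proof (rule inj_onI)
        fix p q assume pq: "p \<in> supported_on ?C" "q \<in> supported_on ?C" "G p = G q"
        then have "g p = g q" using fG by metis
        then have "\<theta> i (part p i) = \<theta> i (part q i)" if "i < ?l" for i
          using that by (auto simp: g_def dest: fun_cong[of _ _ i])
        then have part: "part p i = part q i" if "i < ?l" for i
          using that inj\<theta>[OF that] part_P by (auto dest: inj_onD)
        show "p = q"
        proof (rule poly_mapping_eqI)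
          fix c show "Poly_Mapping.lookup p c = Poly_Mapping.lookup q c"
          proof (cases "c \<in> ?C")
            case True
            then show ?thesis
              using lpart[of p "fst c" "snd c"] lpart[of q "fst c" "snd c"] part[of "fst c"] by auto
          next
            case False
            then show ?thesis
              using pq(1)[unfolded supported_on_iff, rule_format, of c]
                pq(2)[unfolded supported_on_iff, rule_format, of c] by (simp only: not_False_eq_True)
          qed
        qed
      qed
    qed (use GW in auto)
    from le1 le2 have "card ?W = card ?C" by simp
    also have "\<dots> = (\<Sum>i<?l. card (?Ci i))" by (simp add: card_SigmaI finite_monomials_degree)
    finally show ?thesis by (simp add: polynomial_ring_hilbert_def)
  qed
  define rs where "rs = map (\<lambda>i. (r i, ?s i)) [0..<?l]"
  have "hilbert_pairs n (\<lambda>t. card {m \<in> U. int (monomial_degree m) = t}) rs"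
    unfolding hilbert_pairs_def dim sum_list_pairs_nth
    by (auto simp: rs_def rn)
  moreover have "hdepth_decomposition H = (INF (r, s)\<in>set rs. enat r)"
  proof -
    have "hdepth_decomposition H = (INF i\<in>{..<?l}. depth (?S i) (shift (ideal_module (?S i) (carrier (?S i))) (- ?s i)))"
      unfolding hdepth_decomposition_def set_conv_nth by (rule arg_cong[of _ _ Inf]) (auto simp: case_prod_beta image_iff)
    also have "\<dots> = (INF i\<in>{..<?l}. enat (r i))"
      by (rule INF_cong[OF refl]) (use depth_of_polynomial_algebra[OF cr iso] in auto)
    also have "\<dots> = (INF (r, s)\<in>set rs. enat r)"
      by (rule arg_cong[of _ _ Inf]) (simp add: rs_def image_image lessThan_atLeast0)
    finally show ?thesis .
  qed
  ultimately show ?thesis by blast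
qed

section \<open>From Hilbert functions to Hilbert decompositions\<close>

text \<open>The retraction sets the additional variables to \<open>0\<close>.\<close>

lemma graded_retract_fewer_variables:
  assumes "r \<le> n"
  shows "graded_retract (ring_of_type_algebra :: 'k::field ring) (polynomial_ring n) (polynomial_ring r)"
proof -
  let ?K = "ring_of_type_algebra :: 'k ring"
  let ?g = "\<lambda>j. if j \<in> {1..r} then Var j else (0 :: 'k mpoly)"
  have sub: "monomials r \<subseteq> monomials n" using assms by (auto simp: monomials_def)
  have "id \<in> graded_algebra_hom ?K (polynomial_ring r) (polynomial_ring n)"
    using supported_on_mono[OF sub, where 'b = 'k] 
    by (auto simp: graded_algebra_hom_def ring_hom_def polynomial_ring_simps)
       (use sub in \<open>auto simp: supported_on_def\<close>)
  moreover have g: "?g i \<in> homogeneous r 1" for i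
  proof (cases "i \<in> {1..r}")
    case True
    then have "Var i \<in> pm.span (Var ` {1..r} :: 'k mpoly set)" by (intro pm.span_base) simp
    then show ?thesis using True unfolding span_Vars by simp
  qed auto
  have "substitute ?g p \<in> homogeneous r t" if "p \<in> homogeneous n t" for p t
    using that by (rule substitute_homogeneous) (rule g)
  moreover have "substitute ?g p \<in> supported_on (monomials r)" if "p \<in> supported_on (monomials n)" for p
    using that by (rule substitute_in_polys) (rule subsetD[OF homogeneous_subset g])
  ultimately have "substitute ?g \<in> graded_algebra_hom ?K (polynomial_ring n) (polynomial_ring r)"
    by (auto simp: graded_algebra_hom_def ring_hom_def polynomial_ring_simps const_mult_eq_scale
        substitute_add substitute_mult substitute_scale)
  moreover have "substitute ?g p = p" if "p \<in> supported_on (monomials r)" for p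
    using that
  proof (induction rule: polynomial_induct)
    case (const c)
    show ?case by (simp add: single_zero_eq_scale substitute_scale)
  qed (simp_all add: substitute_add substitute_mult)
  ultimately show ?thesis
    using \<open>id \<in> _\<close> unfolding graded_retract_def
    by (intro conjI graded_algebra_polynomial_ring bexI[of _ id] bexI[of _ "substitute ?g"])
       (simp_all add: polynomial_ring_simps)
qed

lemma bij_betw_graded:
  assumes finA: "\<And>t. finite {a \<in> A. f a = (t::int)}" and finB: "\<And>t. finite {b \<in> B. g b = t}"
    and card: "\<And>t. card {a \<in> A. f a = t} = card {b \<in> B. g b = t}"
  obtains \<beta> where "bij_betw \<beta> A B" "\<And>a. a \<in> A \<Longrightarrow> g (\<beta> a) = f a"
proof -
  have "\<forall>t. \<exists>\<beta>. bij_betw \<beta> {a \<in> A. f a = t} {b \<in> B. g b = t}"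
    using finite_same_card_bij[OF finA finB card] by blast
  from choice[OF this] obtain \<beta> where \<beta>: "\<And>t. bij_betw (\<beta> t) {a \<in> A. f a = t} {b \<in> B. g b = t}" by blast
  let ?b = "\<lambda>a. \<beta> (f a) a"
  have in_B: "?b a \<in> B \<and> g (?b a) = f a" if "a \<in> A" for a
    using bij_betwE[OF \<beta>[of "f a"]] that by auto
  have "bij_betw ?b A B"
  proof (rule bij_betw_imageI)
    show "inj_on ?b A"
    proof (rule inj_onI)
      fix x y assume xy: "x \<in> A" "y \<in> A" "?b x = ?b y"
      then have "f x = f y" using in_B by metis
      then show "x = y" using xy bij_betw_imp_inj_on[OF \<beta>[of "f x"]] by (auto simp: inj_on_def)
    qed
    show "?b ` A = B"
    proof (intro equalityI subsetI)
      fix b assume "b \<in> B"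
      then have "b \<in> \<beta> (g b) ` {a \<in> A. f a = g b}" using bij_betw_imp_surj_on[OF \<beta>[of "g b"]] by simp
      then obtain x where "b = \<beta> (g b) x" "x \<in> A" "f x = g b" by auto
      then show "b \<in> ?b ` A" by (intro image_eqI[of _ _ x]) simp_all
    qed (use in_B in auto)
  qed
  then show thesis using that in_B by blast
qed

text \<open>Equal Hilbert functions provide a bijection \<open>\<beta>\<close>, compatible with degrees, from the monomials of the ideal onto the
  disjoint union of the monomials of the summands. Its linear extension is the required isomorphism.\<close>

lemma decomposition_of_hilbert_pairs:
  fixes U rs n
  defines "H \<equiv> map (\<lambda>(r, s). (polynomial_ring r :: ('k::field, 'k mpoly) graded, s)) rs"
  assumes U: "U \<subseteq> monomials n"
    and rs: "hilbert_pairs n (\<lambda>t. card {m \<in> U. int (monomial_degree m) = t}) rs"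
  shows "hilbert_decomposition (ring_of_type_algebra :: 'k ring) (polynomial_ring n)
        (ideal_module (polynomial_ring n) (supported_on U)) H"
    and "hdepth_decomposition H = (INF (r, s)\<in>set rs. enat r)"
proof -
  let ?K = "ring_of_type_algebra :: 'k ring"
  have rn: "r \<le> n" if "(r, s) \<in> set rs" for r s
    using rs that by (auto simp: hilbert_pairs_def)
  have id: "graded_algebra_iso ?K (polynomial_ring r) (polynomial_ring r) id" for r
    by (auto simp: graded_algebra_iso_def graded_algebra_hom_def)
  show "hdepth_decomposition H = (INF (r, s)\<in>set rs. enat r)"
    unfolding hdepth_decomposition_def H_def
    by (simp add: image_image case_prod_beta depth_of_polynomial_algebra[OF cring_polynomial_ring id])
  let ?l = "length rs"
  let ?r = "\<lambda>i. fst (rs ! i)" and ?s = "\<lambda>i. snd (rs ! i)"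
  let ?V = "restrict_scalars (polynomial_ring n) (ideal_module (polynomial_ring n) (supported_on U))
     :: ('k, 'k mpoly) graded"
  let ?D = "direct_sum (map (\<lambda>(S, s). shift S (- s)) H)"
  have lH: "length H = ?l" by (simp add: H_def)
  have Hi: "fst (H ! i) = polynomial_ring (?r i)" "snd (H ! i) = ?s i" if "i < ?l" for i
    using that by (simp_all add: H_def case_prod_beta)
  let ?P = "\<lambda>i. supported_on (monomials (?r i)) :: 'k mpoly set"
  have D: "carrier ?D = (\<Pi>\<^sub>E i\<in>{..<?l}. ?P i)"
    "add ?D = (\<lambda>f g. \<lambda>i\<in>{..<?l}. f i + g i)"
    "module.smult ?D = (\<lambda>k f. \<lambda>i\<in>{..<?l}. scale k (f i))"
    "hcomp ?D t = (\<Pi>\<^sub>E i\<in>{..<?l}. homogeneous (?r i) (t - ?s i))" for t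
    unfolding direct_sum_simps lH
    by (auto simp: Hi polynomial_ring_simps fun_eq_iff restrict_def const_mult_eq_scale intro!: PiE_cong)
  let ?C = "Sigma {..<?l} (\<lambda>i. monomials (?r i))"
  let ?deg = "\<lambda>(i, u). int (monomial_degree u) + ?s i"
  have C: "{c \<in> ?C. ?deg c = t} = Sigma {..<?l} (\<lambda>i. {u \<in> monomials (?r i). int (monomial_degree u) = t - ?s i})" for t
    by auto
  obtain \<beta> where \<beta>: "bij_betw \<beta> U ?C" "\<And>m. m \<in> U \<Longrightarrow> ?deg (\<beta> m) = int (monomial_degree m)"
  proof (rule bij_betw_graded[of U "\<lambda>m. int (monomial_degree m)" ?C ?deg])
    fix t
    show "finite {m \<in> U. int (monomial_degree m) = t}"
      by (rule finite_subset[OF _ finite_monomials_degree[of n t]]) (use U in auto)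
    show "finite {c \<in> ?C. ?deg c = t}"
      unfolding C by (intro finite_SigmaI finite_monomials_degree) simp
    show "card {m \<in> U. int (monomial_degree m) = t} = card {c \<in> ?C. ?deg c = t}"
      using rs unfolding C
      by (simp add: hilbert_pairs_def sum_list_pairs_nth polynomial_ring_hilbert_def card_SigmaI finite_monomials_degree)
  next
    fix \<beta> assume "bij_betw \<beta> U ?C" "\<And>m. m \<in> U \<Longrightarrow> ?deg (\<beta> m) = int (monomial_degree m)"
    then show thesis by (rule that)
  qed
  define \<gamma> where "\<gamma> = inv_into U \<beta>"
  have \<gamma>: "\<gamma> c \<in> U" "\<beta> (\<gamma> c) = c" if "c \<in> ?C" for c
    using that \<beta>(1) by (auto simp: \<gamma>_def bij_betw_def f_inv_into_f intro!: inv_into_into)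
  have \<gamma>\<beta>: "\<gamma> (\<beta> m) = m" if "m \<in> U" for m
    using that \<beta>(1) by (simp add: \<gamma>_def bij_betw_inv_into_left)
  have \<beta>C: "\<beta> m \<in> ?C" if "m \<in> U" for m using \<beta>(1) that by (rule bij_betwE[THEN bspec])
  define part where "part p i = (\<Sum>u\<in>(\<lambda>m. snd (\<beta> m)) ` Poly_Mapping.keys p.
      Poly_Mapping.single u (if (i, u) \<in> ?C then Poly_Mapping.lookup p (\<gamma> (i, u)) else 0))" for p :: "'k mpoly" and i
  have lpart: "Poly_Mapping.lookup (part p i) u = (if (i, u) \<in> ?C then Poly_Mapping.lookup p (\<gamma> (i, u)) else 0)" for p i u
  proof -
    have "u \<in> (\<lambda>m. snd (\<beta> m)) ` Poly_Mapping.keys p" if "(i, u) \<in> ?C" "Poly_Mapping.lookup p (\<gamma> (i, u)) \<noteq> 0"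
      using that \<gamma>(2)[OF that(1)] by (intro image_eqI[of _ _ "\<gamma> (i, u)"]) (simp_all add: in_keys_iff)
    then show ?thesis unfolding part_def by (subst lookup_sum_singles) auto
  qed
  define f where "f p = (\<lambda>i\<in>{..<?l}. part p i)" for p
  \<comment> \<open>The inverse of \<open>f\<close>, collecting the coefficients of all summands.\<close>
  define g where "g h = (\<Sum>i<?l. \<Sum>u\<in>Poly_Mapping.keys (h i). Poly_Mapping.single (\<gamma> (i, u)) (Poly_Mapping.lookup (h i) u))" for h :: "nat \<Rightarrow> 'k mpoly"
  have lg: "Poly_Mapping.lookup (g h) m = (if m \<in> U then Poly_Mapping.lookup (h (fst (\<beta> m))) (snd (\<beta> m)) else 0)"
    if h: "h \<in> (\<Pi>\<^sub>E i\<in>{..<?l}. ?P i)" for h m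
  proof -
    have hC: "(i, u) \<in> ?C" if "i < ?l" "u \<in> Poly_Mapping.keys (h i)" for i u
      using PiE_mem[OF h, of i] that by (auto simp: supported_on_def)
    have eq: "Poly_Mapping.lookup (g h) m = (\<Sum>i<?l. \<Sum>u\<in>Poly_Mapping.keys (h i). if (i, u) = \<beta> m \<and> m \<in> U then Poly_Mapping.lookup (h i) u else 0)"
      unfolding g_def lookup_sum lookup_single when_def
    proof (intro sum.cong refl)
      fix i u assume iu: "i \<in> {..<?l}" "u \<in> Poly_Mapping.keys (h i)"
      then have c: "(i, u) \<in> ?C" using hC by simp
      have "\<gamma> (i, u) = m \<longleftrightarrow> (i, u) = \<beta> m \<and> m \<in> U"
        using \<gamma>[OF c] \<gamma>\<beta> by metis
      then show "(if \<gamma> (i, u) = m then Poly_Mapping.lookup (h i) u else 0) =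
        (if (i, u) = \<beta> m \<and> m \<in> U then Poly_Mapping.lookup (h i) u else 0)" by simp
    qed
    show ?thesis
    proof (cases "m \<in> U")
      case True
      obtain j v where jv: "\<beta> m = (j, v)" by (cases "\<beta> m")
      have j: "j < ?l" using \<beta>C[OF True] jv by simp
      have "Poly_Mapping.lookup (g h) m = (\<Sum>i<?l. if i = j then Poly_Mapping.lookup (h j) v else 0)"
        unfolding eq jv
      proof (intro sum.cong refl)
        fix i assume "i \<in> {..<?l}"
        show "(\<Sum>u\<in>Poly_Mapping.keys (h i). if (i, u) = (j, v) \<and> m \<in> U then Poly_Mapping.lookup (h i) u else 0) =
           (if i = j then Poly_Mapping.lookup (h j) v else 0)"
          using True by (simp add: sum.delta in_keys_iff)
      qed
      then show ?thesis using True jv j by (simp add: sum.delta)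
    qed (simp add: eq)
  qed
  have f_in: "f p \<in> (\<Pi>\<^sub>E i\<in>{..<?l}. ?P i)" for p
    by (auto simp: f_def supported_on_iff lpart)
  have gf: "g (f p) = p" if "p \<in> supported_on U" for p
  proof (rule poly_mapping_eqI)
    fix m show "Poly_Mapping.lookup (g (f p)) m = Poly_Mapping.lookup p m"
    proof (cases "m \<in> U")
      case True
      obtain i u where iu: "\<beta> m = (i, u)" by (cases "\<beta> m")
      have c: "(i, u) \<in> ?C" using \<beta>C[OF True] iu by simp
      have "f p i = part p i" using c by (simp add: f_def)
      then have "Poly_Mapping.lookup (g (f p)) m = Poly_Mapping.lookup (part p i) u"
        using True by (simp add: lg[OF f_in] iu)
      also have "\<dots> = Poly_Mapping.lookup p (\<gamma> (i, u))" unfolding lpart using c by (rule if_P)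
      also have "\<gamma> (i, u) = m" using \<gamma>\<beta>[OF True] iu by simp
      finally show ?thesis .
    next
      case False
      then show ?thesis using that by (simp add: lg[OF f_in] supported_on_iff)
    qed
  qed
  have g_in: "g h \<in> supported_on U" if "h \<in> (\<Pi>\<^sub>E i\<in>{..<?l}. ?P i)" for h
    using lg[OF that] by (simp add: supported_on_iff)
  have fg: "f (g h) = h" if h: "h \<in> (\<Pi>\<^sub>E i\<in>{..<?l}. ?P i)" for h
  proof (rule PiE_ext[OF f_in h])
    fix i assume i: "i \<in> {..<?l}"
    show "f (g h) i = h i"
    proof (rule poly_mapping_eqI)
      fix u show "Poly_Mapping.lookup (f (g h) i) u = Poly_Mapping.lookup (h i) u"
      proof (cases "(i, u) \<in> ?C")
        case True
        then show ?thesis using i \<gamma>[OF True] by (simp add: f_def lpart lg[OF h])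
      next
        case False
        then have "Poly_Mapping.lookup (h i) u = 0"
          using PiE_mem[OF h i] i by (auto simp: supported_on_iff)
        then show ?thesis using False i by (simp only: f_def lpart restrict_apply' if_False)
      qed
    qed
  qed
  have bij: "bij_betw f (supported_on U) (\<Pi>\<^sub>E i\<in>{..<?l}. ?P i)"
    by (rule bij_betw_byWitness[of _ g]) (use gf fg f_in g_in in auto)
  have homog: "f p \<in> (\<Pi>\<^sub>E i\<in>{..<?l}. homogeneous (?r i) (t - ?s i)) \<longleftrightarrow>
      p \<in> supported_on {m \<in> U. int (monomial_degree m) = t}" if p: "p \<in> supported_on U" for p t
  proof
    assume L: "f p \<in> (\<Pi>\<^sub>E i\<in>{..<?l}. homogeneous (?r i) (t - ?s i))"
    have "int (monomial_degree m) = t" if m: "m \<in> Poly_Mapping.keys p" for m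
    proof -
      have mU: "m \<in> U" using p m by (auto simp: supported_on_def)
      obtain i u where iu: "\<beta> m = (i, u)" by (cases "\<beta> m")
      then have c: "(i, u) \<in> ?C" using \<beta>C[OF mU] by simp
      then have i: "i < ?l" by simp
      have "Poly_Mapping.lookup (f p i) u = Poly_Mapping.lookup p m"
        using c i \<gamma>\<beta>[OF mU] iu by (simp add: f_def lpart)
      then have "u \<in> Poly_Mapping.keys (f p i)" using m by (simp add: in_keys_iff)
      moreover have "f p i \<in> homogeneous (?r i) (t - ?s i)" using PiE_mem[OF L, of i] i by simp
      ultimately have "int (monomial_degree u) = t - ?s i" by (auto simp: supported_on_def)
      then show ?thesis using \<beta>(2)[OF mU] iu by simp
    qed
    then show "p \<in> supported_on {m \<in> U. int (monomial_degree m) = t}"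
      using p by (auto simp: supported_on_def)
  next
    assume R: "p \<in> supported_on {m \<in> U. int (monomial_degree m) = t}"
    have "f p i \<in> homogeneous (?r i) (t - ?s i)" if i: "i < ?l" for i
      unfolding supported_on_def
    proof (intro CollectI subsetI)
      fix u assume "u \<in> Poly_Mapping.keys (f p i)"
      then have ne: "(if (i, u) \<in> ?C then Poly_Mapping.lookup p (\<gamma> (i, u)) else 0) \<noteq> 0"
        using i by (simp only: in_keys_iff f_def restrict_apply' lessThan_iff lpart not_False_eq_True)
      then have c: "(i, u) \<in> ?C" by presburger
      then have "\<gamma> (i, u) \<in> Poly_Mapping.keys p" using ne by (simp add: in_keys_iff)
      then have "int (monomial_degree (\<gamma> (i, u))) = t" using R by (auto simp: supported_on_def)
      then show "u \<in> monomials (?r i) \<and> int (monomial_degree u) = t - ?s i"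
        using \<beta>(2)[OF \<gamma>(1)[OF c]] \<gamma>(2)[OF c] c by simp
    qed
    then show "f p \<in> (\<Pi>\<^sub>E i\<in>{..<?l}. homogeneous (?r i) (t - ?s i))"
      by (auto simp: f_def)
  qed
  have hc: "f ` supported_on {m \<in> U. int (monomial_degree m) = t} = (\<Pi>\<^sub>E i\<in>{..<?l}. homogeneous (?r i) (t - ?s i))" for t
  proof (intro equalityI subsetI)
    fix h assume "h \<in> f ` supported_on {m \<in> U. int (monomial_degree m) = t}"
    then obtain p where p: "h = f p" "p \<in> supported_on {m \<in> U. int (monomial_degree m) = t}" by (rule imageE)
    then have "p \<in> supported_on U" by (auto simp: supported_on_def)
    then show "h \<in> (\<Pi>\<^sub>E i\<in>{..<?l}. homogeneous (?r i) (t - ?s i))" using homog p by simp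
  next
    fix h :: "nat \<Rightarrow> 'k mpoly" assume h: "h \<in> (\<Pi>\<^sub>E i\<in>{..<?l}. homogeneous (?r i) (t - ?s i))"
    then have h': "h \<in> (\<Pi>\<^sub>E i\<in>{..<?l}. ?P i)"
      using homogeneous_subset by (rule subsetD[OF PiE_mono, rotated])
    have "g h \<in> supported_on {m \<in> U. int (monomial_degree m) = t}"
      using homog[OF g_in[OF h'], of t] h by (simp add: fg[OF h'])
    then show "h \<in> f ` supported_on {m \<in> U. int (monomial_degree m) = t}"
      using fg[OF h'] by (intro image_eqI[of _ _ "g h"]) simp_all
  qed
  have "graded_vs_iso ?K ?V ?D"
    unfolding graded_vs_iso_def
  proof (intro exI[of _ f] conjI ballI allI)
    show "bij_betw f (carrier ?V) (carrier ?D)"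
      unfolding ideal_module_simps[OF U] D by (rule bij)
    fix x y :: "'k mpoly" assume "x \<in> carrier ?V" "y \<in> carrier ?V"
    show "f (x \<oplus>\<^bsub>?V\<^esub> y) = f x \<oplus>\<^bsub>?D\<^esub> f y"
      unfolding ideal_module_simps[OF U] D f_def
      by (auto simp: fun_eq_iff restrict_def lpart lookup_add intro!: poly_mapping_eqI)
  next
    fix k x assume "x \<in> carrier ?V"
    show "f (k \<odot>\<^bsub>?V\<^esub> x) = k \<odot>\<^bsub>?D\<^esub> f x"
      unfolding ideal_module_simps[OF U] D f_def
      by (auto simp: fun_eq_iff restrict_def lpart intro!: poly_mapping_eqI)
  next
    fix t show "f ` hcomp ?V t = hcomp ?D t"
      unfolding ideal_module_simps[OF U] D by (rule hc)
  qed
  then show "hilbert_decomposition ?K (polynomial_ring n)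
        (ideal_module (polynomial_ring n) (supported_on U)) H"
    unfolding hilbert_decomposition_def
    using graded_retract_fewer_variables[OF rn] by (auto simp: H_def)
qed

lemma Hdepth_supported_on:
  assumes U: "U \<subseteq> monomials n"
  shows "Hdepth (ring_of_type_algebra :: 'k::field ring) (polynomial_ring n)
        (ideal_module (polynomial_ring n) (supported_on U)) =
     Max {INF (r, s)\<in>set rs. enat r | rs. hilbert_pairs n (\<lambda>t. card {m \<in> U. int (monomial_degree m) = t}) rs}"
proof -
  let ?K = "ring_of_type_algebra :: 'k ring"
  have "{hdepth_decomposition H | H. hilbert_decomposition ?K (polynomial_ring n)
        (ideal_module (polynomial_ring n) (supported_on U)) H} =
    {INF (r, s)\<in>set rs. enat r | rs. hilbert_pairs n (\<lambda>t. card {m \<in> U. int (monomial_degree m) = t}) rs}"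
  proof (intro equalityI subsetI)
    fix x assume "x \<in> {hdepth_decomposition H | H. hilbert_decomposition ?K (polynomial_ring n)
        (ideal_module (polynomial_ring n) (supported_on U)) H}"
    then obtain H where "x = hdepth_decomposition H" "hilbert_decomposition ?K (polynomial_ring n)
        (ideal_module (polynomial_ring n) (supported_on U)) H" by auto
    then show "x \<in> {INF (r, s)\<in>set rs. enat r | rs. hilbert_pairs n (\<lambda>t. card {m \<in> U. int (monomial_degree m) = t}) rs}"
      using hilbert_pairs_of_decomposition[OF U, of H] by auto
  next
    fix x assume "x \<in> {INF (r, s)\<in>set rs. enat r | rs. hilbert_pairs n (\<lambda>t. card {m \<in> U. int (monomial_degree m) = t}) rs}"
    then obtain rs where x: "x = (INF (r, s)\<in>set rs. enat r)" 
      and rs: "hilbert_pairs n (\<lambda>t. card {m \<in> U. int (monomial_degree m) = t}) rs" by auto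
    show "x \<in> {hdepth_decomposition H | H. hilbert_decomposition ?K (polynomial_ring n)
        (ideal_module (polynomial_ring n) (supported_on U)) H}"
      unfolding x using decomposition_of_hilbert_pairs[OF U rs, where 'k = 'k] by (metis (mono_tags, lifting) mem_Collect_eq)
  qed
  then show ?thesis by (simp add: Hdepth_def)
qed

section \<open>Recurrences for Hilbert functions\<close>

text \<open>The Hilbert function of the \<open>d\<close>-th power of the maximal ideal in \<open>m\<close> variables; see
  \<open>maximal_ideal_power_eq\<close>.\<close>

definition power_hilbert :: "nat \<Rightarrow> nat \<Rightarrow> int \<Rightarrow> nat" where
  "power_hilbert m d t = card {u \<in> {u \<in> monomials m. d \<le> monomial_degree u}. int (monomial_degree u) = t}"

text \<open>The Hilbert function of the squarefree Veronese ideal: a monomial lies in the ideal when at least \<open>d\<close>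
  variables divide it; see \<open>squarefree_veronese_eq\<close>.\<close>

definition veronese_hilbert :: "nat \<Rightarrow> nat \<Rightarrow> int \<Rightarrow> nat" where
  "veronese_hilbert n d t = card {u \<in> {u \<in> monomials n. d \<le> card (Poly_Mapping.keys u)}. int (monomial_degree u) = t}"

lemma finite_subset_degree: "finite {u \<in> {u \<in> monomials m. Q u}. int (monomial_degree u) = t}"
  by (rule finite_subset[OF _ finite_monomials_degree[of m t]]) auto

text \<open>The monomials divisible by \<open>x\<^sub>i\<close> are counted by their quotients by \<open>x\<^sub>i\<close>.\<close>

lemma card_split_by_variable:
  assumes "finite A"
  shows "card A = card {u \<in> A. Poly_Mapping.lookup u i = (0::nat)} + card {v. Poly_Mapping.single i 1 + v \<in> A}"
proof -
  let ?e = "\<lambda>v. Poly_Mapping.single i (1::nat) + v"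
  have "A = {u \<in> A. Poly_Mapping.lookup u i = 0} \<union> ?e ` {v. ?e v \<in> A}"
  proof (intro equalityI subsetI)
    fix u assume "u \<in> A"
    show "u \<in> {u \<in> A. Poly_Mapping.lookup u i = 0} \<union> ?e ` {v. ?e v \<in> A}"
    proof (cases "Poly_Mapping.lookup u i = 0")
      case False
      then obtain v where "u = ?e v" using variable_divides_iff[of u i] by blast
      then show ?thesis using \<open>u \<in> A\<close> by blast
    qed (use \<open>u \<in> A\<close> in simp)
  qed auto
  moreover have "{u \<in> A. Poly_Mapping.lookup u i = 0} \<inter> ?e ` {v. ?e v \<in> A} = {}"
    by (auto simp: lookup_add)
  moreover have "finite (?e ` {v. ?e v \<in> A})" by (rule finite_subset[OF _ assms]) auto
  ultimately have "card A = card {u \<in> A. Poly_Mapping.lookup u i = 0} + card (?e ` {v. ?e v \<in> A})"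
    using card_Un_disjoint[of "{u \<in> A. Poly_Mapping.lookup u i = 0}" "?e ` {v. ?e v \<in> A}"] assms by auto
  then show ?thesis by (simp add: card_image inj_on_def)
qed

lemma monomials_Suc_iff: "u \<in> monomials (Suc m) \<and> Poly_Mapping.lookup u (Suc m) = 0 \<longleftrightarrow> u \<in> monomials m"
proof -
  have "{1..Suc m} = insert (Suc m) {1..m}" by auto
  then show ?thesis unfolding monomials_def by (auto simp: in_keys_iff)
qed

lemma single_add_in_monomials_iff:
  "Poly_Mapping.single (Suc m) 1 + v \<in> monomials (Suc m) \<longleftrightarrow> v \<in> monomials (Suc m)"
  using add_in_monomialsD[of "Poly_Mapping.single (Suc m) 1" v "Suc m"]
  by (auto simp: single_in_monomials_iff intro: add_in_monomials)

lemma power_hilbert_Suc: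
  "power_hilbert (Suc m) (Suc d) t = power_hilbert m (Suc d) t + power_hilbert (Suc m) d (t - 1)"
proof -
  have "{u \<in> {u \<in> {u \<in> monomials (Suc m). Suc d \<le> monomial_degree u}. int (monomial_degree u) = t}. Poly_Mapping.lookup u (Suc m) = 0}
    = {u \<in> {u \<in> monomials m. Suc d \<le> monomial_degree u}. int (monomial_degree u) = t}"
    using monomials_Suc_iff by blast
  moreover have "{v. Poly_Mapping.single (Suc m) 1 + v \<in> {u \<in> {u \<in> monomials (Suc m). Suc d \<le> monomial_degree u}. int (monomial_degree u) = t}}
    = {u \<in> {u \<in> monomials (Suc m). d \<le> monomial_degree u}. int (monomial_degree u) = t - 1}"
    unfolding mem_Collect_eq single_add_in_monomials_iff monomial_degree_add monomial_degree_single by auto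
  ultimately show ?thesis
    unfolding power_hilbert_def by (subst card_split_by_variable[OF finite_subset_degree, where i = "Suc m"]) simp
qed

lemma polynomial_ring_hilbert_Suc:
  "polynomial_ring_hilbert (Suc r) t = polynomial_ring_hilbert r t + polynomial_ring_hilbert (Suc r) (t - 1)"
proof -
  have "{u \<in> {u \<in> monomials (Suc r). int (monomial_degree u) = t}. Poly_Mapping.lookup u (Suc r) = 0}
    = {u \<in> monomials r. int (monomial_degree u) = t}"
    using monomials_Suc_iff by blast
  moreover have "{v. Poly_Mapping.single (Suc r) 1 + v \<in> {u \<in> monomials (Suc r). int (monomial_degree u) = t}}
    = {u \<in> monomials (Suc r). int (monomial_degree u) = t - 1}"
    unfolding mem_Collect_eq single_add_in_monomials_iff monomial_degree_add monomial_degree_single by auto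
  ultimately show ?thesis
    unfolding polynomial_ring_hilbert_def by (subst card_split_by_variable[OF finite_monomials_degree, where i = "Suc r"]) simp
qed

text \<open>Multiplication of the generating series by \<open>1 - T\<close>. Since the argument is an integer, values below the
  support need no special treatment.\<close>

definition backward_diff :: "(int \<Rightarrow> int) \<Rightarrow> int \<Rightarrow> int" where
  "backward_diff F t = F t - F (t - 1)"

text \<open>Let \<open>N(t)\<close> count the monomials of degree \<open>t\<close> in the ideal that are divisible by the last variable. Dividing by it leaves either a
  monomial that is still divisible by it, counted by \<open>N(t - 1)\<close>, or one in the other variables, of which at
  least \<open>d\<close> must occur. So the difference of \<open>N\<close> is, up to a shift, a Hilbert function in one variable less.\<close>

lemma veronese_hilbert_Suc:
  "backward_diff (\<lambda>t. int (veronese_hilbert (Suc n) (Suc d) t)) t =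
     backward_diff (\<lambda>t. int (veronese_hilbert n (Suc d) t)) t + int (veronese_hilbert n d (t - 1))"
proof -
  let ?e = "Poly_Mapping.single (Suc n) (1::nat)"
  let ?A = "\<lambda>t. {u \<in> {u \<in> monomials (Suc n). Suc d \<le> card (Poly_Mapping.keys u)}. int (monomial_degree u) = t}"
  define N where "N t = card {v. ?e + v \<in> ?A t}" for t
  have fin: "finite {v. ?e + v \<in> ?A t}" for t
    using finite_vimageI[OF finite_subset_degree[of "Suc n" "\<lambda>u. Suc d \<le> card (Poly_Mapping.keys u)" t], of "\<lambda>v. ?e + v"]
    by (simp add: vimage_def inj_def)
  have "{u \<in> ?A t. Poly_Mapping.lookup u (Suc n) = 0}
    = {u \<in> {u \<in> monomials n. Suc d \<le> card (Poly_Mapping.keys u)}. int (monomial_degree u) = t}" for t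
    using monomials_Suc_iff by blast
  then have 1: "veronese_hilbert (Suc n) (Suc d) t = veronese_hilbert n (Suc d) t + N t" for t
    unfolding veronese_hilbert_def N_def
    by (subst card_split_by_variable[OF finite_subset_degree, where i = "Suc n"]) simp
  have e_mem: "?e + v \<in> ?A t \<longleftrightarrow> v \<in> monomials (Suc n) \<and> d \<le> card (Poly_Mapping.keys v - {Suc n}) \<and> int (monomial_degree v) = t - 1" for v t
  proof -
    have "Poly_Mapping.keys (?e + v) = insert (Suc n) (Poly_Mapping.keys v - {Suc n})"
      by (auto simp: keys_add_nat)
    then have "card (Poly_Mapping.keys (?e + v)) = Suc (card (Poly_Mapping.keys v - {Suc n}))"
      using card_insert_disjoint[of "Poly_Mapping.keys v - {Suc n}" "Suc n"] by (simp only:) simp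
    then show ?thesis
      unfolding mem_Collect_eq single_add_in_monomials_iff monomial_degree_add monomial_degree_single by auto
  qed
  have "{v \<in> {v. ?e + v \<in> ?A t}. Poly_Mapping.lookup v (Suc n) = 0}
     = {u \<in> {u \<in> monomials n. d \<le> card (Poly_Mapping.keys u)}. int (monomial_degree u) = t - 1}" for t
  proof -
    have "(v \<in> monomials (Suc n) \<and> d \<le> card (Poly_Mapping.keys v - {Suc n}) \<and> int (monomial_degree v) = t - 1)
        \<and> Poly_Mapping.lookup v (Suc n) = 0 \<longleftrightarrow>
      (v \<in> monomials n \<and> d \<le> card (Poly_Mapping.keys v)) \<and> int (monomial_degree v) = t - 1" for v
    proof (cases "Poly_Mapping.lookup v (Suc n) = 0")
      case True
      then have "Poly_Mapping.keys v - {Suc n} = Poly_Mapping.keys v"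
        by (simp add: in_keys_iff)
      then show ?thesis using True monomials_Suc_iff[of v n] by simp
    qed (use monomials_Suc_iff[of v n] in simp)
    then show ?thesis unfolding e_mem unfolding mem_Collect_eq by (rule Collect_cong)
  qed
  moreover have "{v. ?e + v \<in> {v. ?e + v \<in> ?A t}} = {v. ?e + v \<in> ?A (t - 1)}" for t
  proof -
    have "Poly_Mapping.keys (?e + v) - {Suc n} = Poly_Mapping.keys v - {Suc n}" for v :: "nat \<Rightarrow>\<^sub>0 nat"
      by (auto simp: keys_add_nat)
    then have "?e + (?e + v) \<in> ?A t \<longleftrightarrow> ?e + v \<in> ?A (t - 1)" for v
      unfolding e_mem single_add_in_monomials_iff monomial_degree_add monomial_degree_single by auto
    then show ?thesis unfolding mem_Collect_eq[of _ "\<lambda>v. ?e + v \<in> ?A t"] by (rule Collect_cong)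
  qed
  ultimately have 2: "N t = veronese_hilbert n d (t - 1) + N (t - 1)" for t
    unfolding N_def veronese_hilbert_def
    by (subst card_split_by_variable[OF fin, where i = "Suc n"]) simp
  show ?thesis unfolding backward_diff_def 1 by (simp add: 2[of t])
qed

lemma backward_diff_add: "backward_diff (\<lambda>t. F t + G t) = (\<lambda>t. backward_diff F t + backward_diff G t)"
  by (simp add: backward_diff_def fun_eq_iff)

lemma backward_diff_shift: "backward_diff (\<lambda>t. F (t - s)) = (\<lambda>t. backward_diff F (t - s))"
  by (simp add: backward_diff_def fun_eq_iff algebra_simps)

lemma funpow_backward_diff_add: "(backward_diff ^^ k) (\<lambda>t. F t + G t) = (\<lambda>t. (backward_diff ^^ k) F t + (backward_diff ^^ k) G t)"
  by (induction k) (simp_all add: backward_diff_add)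

lemma funpow_backward_diff_shift: "(backward_diff ^^ k) (\<lambda>t. F (t - s)) = (\<lambda>t. (backward_diff ^^ k) F (t - s))"
  by (induction k) (simp_all add: backward_diff_shift)

lemma funpow_backward_diff_zero: "(backward_diff ^^ k) (\<lambda>t. 0) = (\<lambda>t. 0)"
  by (induction k) (simp_all add: backward_diff_def fun_eq_iff)

lemma monomial_degree_eq_0_iff: "monomial_degree m = 0 \<longleftrightarrow> m = 0"
proof
  assume m: "monomial_degree m = 0"
  show "m = 0"
  proof (rule poly_mapping_eqI)
    fix i show "Poly_Mapping.lookup m i = Poly_Mapping.lookup 0 i"
      using lookup_le_monomial_degree[of m i] m by simp
  qed
qed simp

section \<open>The Hilbert functions of the two ideals\<close>

text \<open>The identity \<open>(1 - T)^d V(n, d + 1) = P(n - d, d + 1)\<close> of Hilbert series. The recurrence for \<open>V\<close> multiplied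
  by \<open>(1 - T)^d\<close> becomes the recurrence for \<open>P\<close>; the inner induction on \<open>n\<close> starts at \<open>n = d\<close>, where both sides vanish:
  fewer than \<open>d + 1\<close> variables can divide a monomial, and without variables there is no monomial of positive degree.\<close>

lemma funpow_backward_diff_veronese_hilbert:
  assumes "d \<le> n"
  shows "(backward_diff ^^ d) (\<lambda>t. int (veronese_hilbert n (Suc d) t)) = (\<lambda>t. int (power_hilbert (n - d) (Suc d) t))"
  using assms
proof (induction d arbitrary: n)
  case 0
  have "1 \<le> card (Poly_Mapping.keys u) \<longleftrightarrow> 1 \<le> monomial_degree u" for u :: "nat \<Rightarrow>\<^sub>0 nat"
  proof -
    have "card (Poly_Mapping.keys u) = 0 \<longleftrightarrow> monomial_degree u = 0"
      by (simp add: monomial_degree_eq_0_iff)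
    then show ?thesis by linarith
  qed
  then show ?case by (simp add: veronese_hilbert_def power_hilbert_def)
next
  case (Suc d)
  from \<open>Suc d \<le> n\<close> show ?case
  proof (induction n rule: dec_induct)
    case base
    have "\<not> Suc (Suc d) \<le> card (Poly_Mapping.keys u)" if "u \<in> monomials (Suc d)" for u
      using card_mono[of "{1..Suc d}" "Poly_Mapping.keys u"] that by (simp add: monomials_def)
    then have none: "{u \<in> monomials (Suc d). Suc (Suc d) \<le> card (Poly_Mapping.keys u)} = {}" by blast
    have "veronese_hilbert (Suc d) (Suc (Suc d)) t = 0" for t
      unfolding veronese_hilbert_def none by simp
    moreover have "power_hilbert 0 (Suc (Suc d)) t = 0" for t
      by (auto simp: power_hilbert_def monomials_def)
    ultimately show ?case by (simp add: funpow_backward_diff_zero del: funpow.simps)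
  next
    case (step n)
    have n: "Suc n - Suc d = Suc (n - Suc d)" "n - d = Suc (n - Suc d)" using step(1) by simp_all
    have "(backward_diff ^^ Suc d) (\<lambda>t. int (veronese_hilbert (Suc n) (Suc (Suc d)) t)) =
       (backward_diff ^^ d) (\<lambda>t. backward_diff (\<lambda>t. int (veronese_hilbert n (Suc (Suc d)) t)) t + int (veronese_hilbert n (Suc d) (t - 1)))"
      unfolding funpow_Suc_right comp_def by (rule arg_cong[of _ _ "backward_diff ^^ d"]) (simp add: veronese_hilbert_Suc fun_eq_iff)
    also have "\<dots> = (\<lambda>t. (backward_diff ^^ Suc d) (\<lambda>t. int (veronese_hilbert n (Suc (Suc d)) t)) t +
        (backward_diff ^^ d) (\<lambda>t. int (veronese_hilbert n (Suc d) t)) (t - 1))"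
      by (simp add: funpow_backward_diff_add funpow_backward_diff_shift[of d "\<lambda>t. int (veronese_hilbert n (Suc d) t)" 1] funpow_Suc_right del: funpow.simps)
    also have "\<dots> = (\<lambda>t. int (power_hilbert (n - Suc d) (Suc (Suc d)) t) + int (power_hilbert (n - d) (Suc d) (t - 1)))"
      using step Suc.IH[of n] by simp
    also have "\<dots> = (\<lambda>t. int (power_hilbert (Suc n - Suc d) (Suc (Suc d)) t))"
      unfolding n by (simp add: power_hilbert_Suc fun_eq_iff)
    finally show ?case .
  qed
qed

section \<open>Shifting the dimensions in a list of pairs\<close>

definition pairs_hilbert :: "(nat \<times> int) list \<Rightarrow> int \<Rightarrow> int" where
  "pairs_hilbert rs t = (\<Sum>(r, s)\<leftarrow>rs. int (polynomial_ring_hilbert r (t - s)))"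

lemma hilbert_pairs_iff:
  "hilbert_pairs n F rs \<longleftrightarrow> (\<forall>(r, s)\<in>set rs. r \<le> n) \<and> (\<lambda>t. int (F t)) = pairs_hilbert rs"
proof -
  have "pairs_hilbert rs t = int (\<Sum>(r, s)\<leftarrow>rs. polynomial_ring_hilbert r (t - s))" for t
    by (induction rs) (auto simp: pairs_hilbert_def)
  then show ?thesis by (auto simp: hilbert_pairs_def fun_eq_iff)
qed

lemma backward_diff_pairs_hilbert:
  "backward_diff (pairs_hilbert (map (\<lambda>(r, s). (Suc r, s)) rs)) = pairs_hilbert rs"
proof (induction rs)
  case Nil
  show ?case by (simp add: pairs_hilbert_def backward_diff_def fun_eq_iff)
next
  case (Cons p rs)
  obtain r s where p: "p = (r, s)" by (cases p)
  have split: "pairs_hilbert ((r, s) # rs) = (\<lambda>t. int (polynomial_ring_hilbert r (t - s)) + pairs_hilbert rs t)" for r s rs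
    by (simp add: pairs_hilbert_def fun_eq_iff)
  have "backward_diff (\<lambda>t. int (polynomial_ring_hilbert (Suc r) (t - s))) = (\<lambda>t. int (polynomial_ring_hilbert r (t - s)))"
  proof
    fix t
    show "backward_diff (\<lambda>t. int (polynomial_ring_hilbert (Suc r) (t - s))) t = int (polynomial_ring_hilbert r (t - s))"
      using polynomial_ring_hilbert_Suc[of r "t - s"] by (simp add: backward_diff_def algebra_simps)
  qed
  then show ?case using Cons by (simp add: p split backward_diff_add)
qed

lemma funpow_backward_diff_pairs_hilbert:
  "(backward_diff ^^ k) (pairs_hilbert (map (\<lambda>(r, s). (r + k, s)) rs)) = pairs_hilbert rs"
proof (induction k)
  case (Suc k)
  have "map (\<lambda>(r, s). (r + Suc k, s)) rs = map (\<lambda>(r, s). (Suc r, s)) (map (\<lambda>(r, s). (r + k, s)) rs)"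
    by auto
  then show ?case using Suc by (simp only: funpow_Suc_right comp_def backward_diff_pairs_hilbert)
qed simp

lemma polynomial_ring_hilbert_neg: "t < 0 \<Longrightarrow> polynomial_ring_hilbert r t = 0"
  unfolding polynomial_ring_hilbert_def by auto

lemma pairs_hilbert_vanishes: "\<exists>T. \<forall>t<T. pairs_hilbert rs t = 0"
proof (induction rs)
  case Nil
  show ?case by (simp add: pairs_hilbert_def)
next
  case (Cons p rs)
  then obtain T where T: "\<forall>t<T. pairs_hilbert rs t = 0" by blast
  obtain r s where p: "p = (r, s)" by (cases p)
  have "\<forall>t<min T s. pairs_hilbert (p # rs) t = 0"
    using T by (auto simp: pairs_hilbert_def p polynomial_ring_hilbert_neg)
  then show ?case by blast
qed

text \<open>The difference of \<open>F\<close> and \<open>G\<close> is constant, hence zero. The vanishing for small arguments excludes a nonzero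
  constant.\<close>

lemma backward_diff_injective:
  assumes "backward_diff F = backward_diff G" "\<forall>t<T. F t = 0" "\<forall>t<T. G t = 0"
  shows "F = G"
proof
  fix t
  have eq: "F t - F (t - 1) = G t - G (t - 1)" for t
    using fun_cong[OF assms(1), of t] by (simp add: backward_diff_def)
  show "F t = G t"
  proof (cases "t < T")
    case False
    then have "T - 1 \<le> t" by simp
    then show ?thesis
    proof (induction t rule: int_ge_induct)
      case (step i)
      then show ?case using eq[of "i + 1"] by simp
    qed (use assms in simp)
  qed (use assms in simp)
qed

lemma funpow_backward_diff_injective:
  assumes "(backward_diff ^^ k) F = (backward_diff ^^ k) G" "\<exists>T. \<forall>t<T. F t = 0" "\<exists>T. \<forall>t<T. G t = 0"
  shows "F = G"
  using assms
proof (induction k arbitrary: F G)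
  case (Suc k)
  obtain T where T: "\<forall>t<T. F t = 0" using Suc.prems(2) by blast
  obtain T' where T': "\<forall>t<T'. G t = 0" using Suc.prems(3) by blast
  have "backward_diff F = backward_diff G"
  proof (rule Suc.IH)
    show "(backward_diff ^^ k) (backward_diff F) = (backward_diff ^^ k) (backward_diff G)"
      using Suc.prems(1) by (simp only: funpow_Suc_right comp_def)
    show "\<exists>T. \<forall>t<T. backward_diff F t = 0" using T by (intro exI[of _ T]) (simp add: backward_diff_def)
    show "\<exists>T. \<forall>t<T. backward_diff G t = 0" using T' by (intro exI[of _ T']) (simp add: backward_diff_def)
  qed
  then show ?case by (rule backward_diff_injective[of _ _ "min T T'"]) (use T T' in auto)
qed simp

lemma hilbert_pairs_veronese_of_power:
  assumes "d \<le> n" and rs: "hilbert_pairs (n - d) (power_hilbert (n - d) (Suc d)) rs"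
  shows "hilbert_pairs n (veronese_hilbert n (Suc d)) (map (\<lambda>(r, s). (r + d, s)) rs)"
proof -
  have "(\<lambda>t. int (veronese_hilbert n (Suc d) t)) = pairs_hilbert (map (\<lambda>(r, s). (r + d, s)) rs)"
  proof (rule funpow_backward_diff_injective[where k = d])
    show "(backward_diff ^^ d) (\<lambda>t. int (veronese_hilbert n (Suc d) t)) =
       (backward_diff ^^ d) (pairs_hilbert (map (\<lambda>(r, s). (r + d, s)) rs))"
      using rs by (simp add: funpow_backward_diff_pairs_hilbert funpow_backward_diff_veronese_hilbert[OF \<open>d \<le> n\<close>] hilbert_pairs_iff)
    have "veronese_hilbert n (Suc d) t = 0" if "t < 0" for t
      using that by (auto simp: veronese_hilbert_def)
    then show "\<exists>T. \<forall>t<T. int (veronese_hilbert n (Suc d) t) = 0" by (intro exI[of _ 0]) simp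
  qed (rule pairs_hilbert_vanishes)
  then show ?thesis using rs \<open>d \<le> n\<close> by (fastforce simp: hilbert_pairs_iff)
qed

lemma hilbert_pairs_power_of_veronese:
  assumes "d \<le> n" and rs: "hilbert_pairs n (veronese_hilbert n (Suc d)) rs" and d: "\<forall>(r, s)\<in>set rs. d \<le> r"
  shows "hilbert_pairs (n - d) (power_hilbert (n - d) (Suc d)) (map (\<lambda>(r, s). (r - d, s)) rs)"
proof -
  have eq: "map (\<lambda>(r, s). (r + d, s)) (map (\<lambda>(r, s). (r - d, s)) rs) = rs"
    using d by (simp add: map_idI case_prod_beta)
  have "(\<lambda>t. int (power_hilbert (n - d) (Suc d) t)) = (backward_diff ^^ d) (pairs_hilbert rs)"
    using rs by (simp add: funpow_backward_diff_veronese_hilbert[OF \<open>d \<le> n\<close>, symmetric] hilbert_pairs_iff)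
  also have "\<dots> = pairs_hilbert (map (\<lambda>(r, s). (r - d, s)) rs)"
    using funpow_backward_diff_pairs_hilbert[of d "map (\<lambda>(r, s). (r - d, s)) rs"] unfolding eq .
  finally show ?thesis using rs by (fastforce simp: hilbert_pairs_iff)
qed

text \<open>The recurrence \<open>P(m + 1, d + 1) = P(m, d + 1) + T P(m + 1, d)\<close> assembles a list from two smaller ones. Without any
  decomposition the maximum in the definition of the Hilbert depth would be taken over the empty set.\<close>

lemma ex_hilbert_pairs_power: "\<exists>rs. hilbert_pairs m (power_hilbert m d) rs"
proof (induction d arbitrary: m)
  case 0
  have "hilbert_pairs m (power_hilbert m 0) [(m, 0)]"
    by (simp add: hilbert_pairs_def power_hilbert_def polynomial_ring_hilbert_def)
  then show ?case by blast
next
  case (Suc d)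
  show ?case
  proof (induction m)
    case 0
    have "power_hilbert 0 (Suc d) t = 0" for t
      by (auto simp: power_hilbert_def monomials_def)
    then have "hilbert_pairs 0 (power_hilbert 0 (Suc d)) []"
      by (simp add: hilbert_pairs_def)
    then show ?case by blast
  next
    case (Suc m)
    then obtain rs where rs: "hilbert_pairs m (power_hilbert m (Suc d)) rs" by blast
    obtain rs' where rs': "hilbert_pairs (Suc m) (power_hilbert (Suc m) d) rs'"
      using \<open>\<And>m. \<exists>rs. hilbert_pairs m (power_hilbert m d) rs\<close> by blast
    have shift: "(\<Sum>(r, s)\<leftarrow>map (\<lambda>(r, s). (r, s + 1)) rs'. polynomial_ring_hilbert r (t - s)) =
        (\<Sum>(r, s)\<leftarrow>rs'. polynomial_ring_hilbert r (t - 1 - s))" for t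
      by (induction rs') (auto simp: algebra_simps)
    have "hilbert_pairs (Suc m) (power_hilbert (Suc m) (Suc d)) (rs @ map (\<lambda>(r, s). (r, s + 1)) rs')"
      unfolding hilbert_pairs_def
    proof (intro conjI allI)
      fix t
      have "power_hilbert m (Suc d) t = (\<Sum>(r, s)\<leftarrow>rs. polynomial_ring_hilbert r (t - s))"
        "power_hilbert (Suc m) d (t - 1) = (\<Sum>(r, s)\<leftarrow>rs'. polynomial_ring_hilbert r (t - 1 - s))"
        using rs rs' unfolding hilbert_pairs_def by blast+
      then show "power_hilbert (Suc m) (Suc d) t =
          (\<Sum>(r, s)\<leftarrow>rs @ map (\<lambda>(r, s). (r, s + 1)) rs'. polynomial_ring_hilbert r (t - s))"
        unfolding power_hilbert_Suc map_append[of "\<lambda>(r, s). polynomial_ring_hilbert r (t - s)"] sum_list_append shift by simp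
    qed (use rs rs' in \<open>fastforce simp: hilbert_pairs_def\<close>)
    then show ?case by blast
  qed
qed

lemma hilbert_pairs_nonempty: "hilbert_pairs n F rs \<Longrightarrow> F t \<noteq> 0 \<Longrightarrow> rs \<noteq> []"
  by (auto simp: hilbert_pairs_def)

lemma INF_pairs_eqI:
  assumes "(r, s) \<in> set rs" "\<forall>(r', s')\<in>set rs. r \<le> r'"
  shows "(INF (r, s)\<in>set rs. enat r) = enat r"
proof (rule antisym)
  show "(INF (r, s)\<in>set rs. enat r) \<le> enat r" using assms by (intro INF_lower2[of "(r, s)"]) auto
  show "enat r \<le> (INF (r, s)\<in>set rs. enat r)" using assms by (intro INF_greatest) auto
qed

lemma INF_pairs:
  assumes "rs \<noteq> []"
  obtains r s where "(r, s) \<in> set rs" "(INF (r, s)\<in>set rs. enat r) = enat r" "\<forall>(r', s')\<in>set rs. r \<le> r'"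
proof -
  have "Min (fst ` set rs) \<in> fst ` set rs" using assms by (intro Min_in) auto
  then obtain r s where rs: "(r, s) \<in> set rs" "r = Min (fst ` set rs)" by auto
  have le: "\<forall>(r', s')\<in>set rs. r \<le> r'" unfolding rs(2) by (force intro!: Min_le)
  show thesis by (rule that[OF rs(1) INF_pairs_eqI[OF rs(1) le] le])
qed

section \<open>Comparing the maxima\<close>

text \<open>A nonzero \<open>F\<close> forces the lists to be nonempty, so their values are dimensions bounded by \<open>n\<close> rather than \<open>\<infinity>\<close>,
  and the maximum is attained.\<close>

lemma Max_pairs:
  assumes "hilbert_pairs n F rs0" "F t \<noteq> 0"
  defines "A \<equiv> {INF (r, s)\<in>set rs. enat r | rs. hilbert_pairs n F rs}"
  obtains r s rs where "hilbert_pairs n F rs" "(r, s) \<in> set rs" "\<forall>(r', s')\<in>set rs. r \<le> r'" "Max A = enat r"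
    "\<And>r s rs. hilbert_pairs n F rs \<Longrightarrow> (r, s) \<in> set rs \<Longrightarrow> \<forall>(r', s')\<in>set rs. r \<le> r' \<Longrightarrow> enat r \<le> Max A"
proof -
  have elem: "\<exists>r s. (r, s) \<in> set rs \<and> (INF (r, s)\<in>set rs. enat r) = enat r \<and> (\<forall>(r', s')\<in>set rs. r \<le> r') \<and> r \<le> n"
    if p: "hilbert_pairs n F rs" for rs
  proof -
    obtain r s where "(r, s) \<in> set rs" "(INF (r, s)\<in>set rs. enat r) = enat r" "\<forall>(r', s')\<in>set rs. r \<le> r'"
      using INF_pairs[OF hilbert_pairs_nonempty[OF p assms(2)]] by blast
    moreover have "r \<le> n" using p calculation(1) by (auto simp: hilbert_pairs_def)
    ultimately show ?thesis by blast
  qed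
  have "A \<subseteq> enat ` {..n}"
  proof
    fix x assume "x \<in> A"
    then obtain rs where "hilbert_pairs n F rs" "x = (INF (r, s)\<in>set rs. enat r)" unfolding A_def by auto
    then show "x \<in> enat ` {..n}" using elem[of rs] by auto
  qed
  then have fin: "finite A" by (rule finite_subset) simp
  have "A \<noteq> {}" using assms(1) unfolding A_def by auto
  with fin have "Max A \<in> A" by (rule Max_in)
  then obtain rs where rs: "hilbert_pairs n F rs" "Max A = (INF (r, s)\<in>set rs. enat r)" unfolding A_def by auto
  obtain r s where "(r, s) \<in> set rs" "(INF (r, s)\<in>set rs. enat r) = enat r" "\<forall>(r', s')\<in>set rs. r \<le> r'"
    using elem[OF rs(1)] by blast
  moreover have "enat r \<le> Max A" if "hilbert_pairs n F rs" "(r, s) \<in> set rs" "\<forall>(r', s')\<in>set rs. r \<le> r'" for r s rs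
  proof (rule Max_ge[OF fin])
    show "enat r \<in> A" unfolding A_def using that(1) INF_pairs_eqI[OF that(2,3)] by force
  qed
  ultimately show thesis using that rs by force
qed

lemma Max_pairs_veronese:
  assumes "d < n"
  shows "Max {INF (r, s)\<in>set rs. enat r | rs. hilbert_pairs (n - d) (power_hilbert (n - d) (Suc d)) rs} + enat d
    = Max {INF (r, s)\<in>set rs. enat r | rs. hilbert_pairs n (veronese_hilbert n (Suc d)) rs}"
    (is "Max ?A + _ = Max ?B")
proof -
  have dn: "d \<le> n" using assms by simp
  obtain rs1 where rs1: "hilbert_pairs (n - d) (power_hilbert (n - d) (Suc d)) rs1"
    using ex_hilbert_pairs_power by blast
  \<comment> \<open>The power of the first variable shows that the ideal is nonzero.\<close>
  have "Poly_Mapping.single 1 (Suc d) \<in> {u \<in> {u \<in> monomials (n - d). Suc d \<le> monomial_degree u}. int (monomial_degree u) = int (Suc d)}"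
    using assms by (simp add: monomials_def)
  then have ne: "power_hilbert (n - d) (Suc d) (int (Suc d)) \<noteq> 0"
    using finite_subset_degree[of "n - d" "\<lambda>u. Suc d \<le> monomial_degree u" "int (Suc d)"]
    unfolding power_hilbert_def by (metis (no_types, lifting) card_0_eq empty_iff)
  let ?rs2 = "map (\<lambda>(r, s). (r + d, s)) rs1"
  have rs2: "hilbert_pairs n (veronese_hilbert n (Suc d)) ?rs2"
    by (rule hilbert_pairs_veronese_of_power[OF dn rs1])
  have "?rs2 \<noteq> []" using hilbert_pairs_nonempty[OF rs1 ne] by simp
  have "\<exists>t. veronese_hilbert n (Suc d) t \<noteq> 0"
  proof (rule ccontr)
    assume "\<not> ?thesis"
    then have "(\<lambda>t. int (power_hilbert (n - d) (Suc d) t)) = (\<lambda>t. 0)"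
      by (simp add: funpow_backward_diff_veronese_hilbert[OF dn, symmetric] funpow_backward_diff_zero)
    then show False using ne by (metis of_nat_eq_0_iff)
  qed
  then obtain t where ne': "veronese_hilbert n (Suc d) t \<noteq> 0" by blast
  \<comment> \<open>An optimal list for each side; shifting it gives a competitor on the other side.\<close>
  obtain r s rs where A: "hilbert_pairs (n - d) (power_hilbert (n - d) (Suc d)) rs" "(r, s) \<in> set rs"
      "\<forall>(r', s')\<in>set rs. r \<le> r'" "Max ?A = enat r"
    and Amax: "\<And>r s rs. hilbert_pairs (n - d) (power_hilbert (n - d) (Suc d)) rs \<Longrightarrow> (r, s) \<in> set rs \<Longrightarrow> \<forall>(r', s')\<in>set rs. r \<le> r' \<Longrightarrow> enat r \<le> Max ?A"
    by (rule Max_pairs[OF rs1 ne]) blast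
  obtain r2 s2 rs' where B: "hilbert_pairs n (veronese_hilbert n (Suc d)) rs'" "(r2, s2) \<in> set rs'"
      "\<forall>(r', s')\<in>set rs'. r2 \<le> r'" "Max ?B = enat r2"
    and Bmax: "\<And>r s rs. hilbert_pairs n (veronese_hilbert n (Suc d)) rs \<Longrightarrow> (r, s) \<in> set rs \<Longrightarrow> \<forall>(r', s')\<in>set rs. r \<le> r' \<Longrightarrow> enat r \<le> Max ?B"
    by (rule Max_pairs[OF rs2 ne']) blast
  have "enat (r + d) \<le> Max ?B"
  proof (rule Bmax)
    show "hilbert_pairs n (veronese_hilbert n (Suc d)) (map (\<lambda>(r, s). (r + d, s)) rs)"
      by (rule hilbert_pairs_veronese_of_power[OF dn A(1)])
    show "(r + d, s) \<in> set (map (\<lambda>(r, s). (r + d, s)) rs)" using A(2) by force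
    show "\<forall>(r', s')\<in>set (map (\<lambda>(r, s). (r + d, s)) rs). r + d \<le> r'" using A(3) by auto
  qed
  then have le: "r + d \<le> r2" using B(4) by simp
  have "enat (r2 - d) \<le> Max ?A"
  proof (rule Amax)
    show "hilbert_pairs (n - d) (power_hilbert (n - d) (Suc d)) (map (\<lambda>(r, s). (r - d, s)) rs')"
      using B(3) le by (intro hilbert_pairs_power_of_veronese[OF dn B(1)]) fastforce
    show "(r2 - d, s2) \<in> set (map (\<lambda>(r, s). (r - d, s)) rs')" using B(2) by force
    show "\<forall>(r', s')\<in>set (map (\<lambda>(r, s). (r - d, s)) rs'). r2 - d \<le> r'" using B(3) by (auto intro!: diff_le_mono)
  qed
  then have "r2 - d \<le> r" using A(4) by simp
  then show ?thesis using le A(4) B(4) by simp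
qed

section \<open>Monomial ideals\<close>

lemma genideal_monomials:
  assumes G: "G \<subseteq> monomials n"
  shows "genideal (polynomial_ring n) {Poly_Mapping.single m (1::'k::field) | m. m \<in> G} =
    supported_on {g + v | g v. g \<in> G \<and> v \<in> monomials n}" (is "_ = supported_on ?U")
proof -
  interpret P: cring "polynomial_ring n :: ('k, 'k mpoly) graded" by (rule cring_polynomial_ring)
  have U: "?U \<subseteq> monomials n" using G by (auto intro: add_in_monomials)
  have GP: "{Poly_Mapping.single m (1::'k) | m. m \<in> G} \<subseteq> carrier (polynomial_ring n)"
    using G by (auto simp: polynomial_ring_simps intro: single_supported_on)
  show ?thesis
  proof
    show "genideal (polynomial_ring n) {Poly_Mapping.single m (1::'k) | m. m \<in> G} \<subseteq> supported_on ?U"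
    proof (rule P.genideal_minimal)
      have abs: "p * q \<in> supported_on ?U" if "p \<in> supported_on ?U" "q \<in> supported_on (monomials n)" for p q :: "'k mpoly"
        using that
      proof (rule mult_supported_on)
        fix u v assume "u \<in> ?U" "v \<in> monomials n"
        then obtain g w where "u = g + w" "g \<in> G" "w \<in> monomials n" by blast
        then have "u + v = g + (w + v)" "g \<in> G" "w + v \<in> monomials n"
          using \<open>v \<in> monomials n\<close> by (simp_all add: add.assoc add_in_monomials)
        then show "u + v \<in> ?U" by blast
      qed
      show "ideal (supported_on ?U) (polynomial_ring n :: ('k, 'k mpoly) graded)"
      proof (rule idealI)
        show "subgroup (supported_on ?U) (add_monoid (polynomial_ring n :: ('k, 'k mpoly) graded))"
        proof (rule P.add.subgroupI)
          show "supported_on ?U \<subseteq> carrier (polynomial_ring n :: ('k, 'k mpoly) graded)"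
            unfolding polynomial_ring_simps by (rule supported_on_mono[OF U])
          show "supported_on ?U \<noteq> ({} :: 'k mpoly set)" using zero_supported_on by blast
          fix a :: "'k mpoly" assume a: "a \<in> supported_on ?U"
          then have "a \<in> supported_on (monomials n)" using supported_on_mono[OF U] by blast
          then have "\<ominus>\<^bsub>polynomial_ring n\<^esub> a = - a"
            by (intro P.minus_equality) (simp_all add: polynomial_ring_simps uminus_supported_on)
          then show "\<ominus>\<^bsub>polynomial_ring n\<^esub> a \<in> supported_on ?U" using a by (simp add: uminus_supported_on)
          fix b :: "'k mpoly" assume "b \<in> supported_on ?U"
          then show "a \<oplus>\<^bsub>polynomial_ring n\<^esub> b \<in> supported_on ?U"
            using a by (simp add: polynomial_ring_simps add_supported_on)
        qed
      next
        fix a x :: "'k mpoly" assume "a \<in> supported_on ?U" "x \<in> carrier (polynomial_ring n)"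
        then show "x \<otimes>\<^bsub>polynomial_ring n\<^esub> a \<in> supported_on ?U" "a \<otimes>\<^bsub>polynomial_ring n\<^esub> x \<in> supported_on ?U"
          using abs[of a x] by (simp_all add: polynomial_ring_simps mult.commute)
      qed (rule P.ring_axioms)
      show "{Poly_Mapping.single m (1::'k) | m. m \<in> G} \<subseteq> supported_on ?U"
      proof
        fix p assume "p \<in> {Poly_Mapping.single m (1::'k) | m. m \<in> G}"
        then obtain m where "p = Poly_Mapping.single m 1" "m \<in> G" by blast
        moreover have "m \<in> ?U" using \<open>m \<in> G\<close> by (metis (mono_tags, lifting) add.right_neutral mem_Collect_eq zero_in_monomials)
        ultimately show "p \<in> supported_on ?U" by (simp add: single_supported_on)
      qed
    qed
    show "supported_on ?U \<subseteq> genideal (polynomial_ring n) {Poly_Mapping.single m (1::'k) | m. m \<in> G}" (is "_ \<subseteq> ?I")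
    proof
      interpret I: ideal ?I "polynomial_ring n :: ('k, 'k mpoly) graded"
        by (rule P.genideal_ideal[OF GP])
      fix p :: "'k mpoly" assume p: "p \<in> supported_on ?U"
      have single: "Poly_Mapping.single u c \<in> ?I" if "u \<in> ?U" for u c
      proof -
        obtain g v where gv: "u = g + v" "g \<in> G" "v \<in> monomials n" using \<open>u \<in> ?U\<close> by blast
        have "Poly_Mapping.single g 1 \<in> ?I" using P.genideal_self[OF GP] gv(2) by blast
        then have "Poly_Mapping.single v c \<otimes>\<^bsub>polynomial_ring n\<^esub> Poly_Mapping.single g 1 \<in> ?I"
          using gv(3) by (intro I.I_l_closed) (simp_all add: polynomial_ring_simps single_supported_on)
        then show ?thesis by (simp add: polynomial_ring_simps mult_single gv(1) add.commute)
      qed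
      have "finite A \<Longrightarrow> A \<subseteq> ?U \<Longrightarrow> (\<Sum>u\<in>A. Poly_Mapping.single u (Poly_Mapping.lookup p u)) \<in> ?I" for A
      proof (induction A rule: finite_induct)
        case empty
        show ?case using I.zero_closed by (simp add: polynomial_ring_simps)
      next
        case (insert u A)
        then show ?case using I.a_closed[OF single[of u "Poly_Mapping.lookup p u"]] by (simp add: polynomial_ring_simps)
      qed
      from this[of "Poly_Mapping.keys p"] show "p \<in> ?I" using p by (simp add: sum_singles supported_on_def)
    qed
  qed
qed

text \<open>A factor of degree \<open>d\<close> is built up one variable at a time.\<close>

lemma monomial_factor_of_degree:
  "d \<le> monomial_degree m \<Longrightarrow> \<exists>g v. m = g + v \<and> monomial_degree g = d"
proof (induction d)
  case 0
  show ?case by (rule exI[of _ 0]) simp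
next
  case (Suc d)
  then obtain g v where gv: "m = g + v" "monomial_degree g = d" by auto
  then have "v \<noteq> 0" using Suc.prems by auto
  then obtain i where "Poly_Mapping.lookup v i \<noteq> 0" by (metis lookup_zero poly_mapping_eqI)
  then obtain w where "v = Poly_Mapping.single i 1 + w" using variable_divides_iff[of v i] by blast
  then have "m = (g + Poly_Mapping.single i 1) + w" "monomial_degree (g + Poly_Mapping.single i 1) = Suc d"
    using gv by (simp_all add: add.assoc monomial_degree_add)
  then show ?case by blast
qed

lemma maximal_ideal_power_eq:
  "maximal_ideal_power n d = (supported_on {u \<in> monomials n. d \<le> monomial_degree u} :: 'k::field mpoly set)"
proof -
  let ?G = "{m \<in> monomials n. monomial_degree m = d}"
  have "{g + v | g v. g \<in> ?G \<and> v \<in> monomials n} = {u \<in> monomials n. d \<le> monomial_degree u}"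
  proof (intro equalityI subsetI)
    fix u assume "u \<in> {u \<in> monomials n. d \<le> monomial_degree u}"
    then obtain g v where gv: "u = g + v" "monomial_degree g = d" "u \<in> monomials n"
      using monomial_factor_of_degree[of d u] by blast
    then have "g \<in> ?G" "v \<in> monomials n" using add_in_monomialsD[of g v n] by auto
    then show "u \<in> {g + v | g v. g \<in> ?G \<and> v \<in> monomials n}" using gv(1) by blast
  qed (auto simp: monomial_degree_add add_in_monomials)
  moreover have "{Poly_Mapping.single m (1::'k) | m. Poly_Mapping.keys m \<subseteq> {1..n} \<and> monomial_degree m = d}
     = {Poly_Mapping.single m 1 | m. m \<in> ?G}"
    by (simp add: monomials_def)
  ultimately show ?thesis
    unfolding maximal_ideal_power_def
    using genideal_monomials[of ?G n, where 'k = 'k] by auto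
qed

text \<open>The product of any \<open>d\<close> of the variables that divide the monomial.\<close>

lemma squarefree_factor:
  assumes "d \<le> card (Poly_Mapping.keys m)"
  shows "\<exists>g v. m = g + v \<and> monomial_degree g = d \<and> (\<forall>i. Poly_Mapping.lookup g i \<le> (1::nat))"
proof -
  obtain A where A: "A \<subseteq> Poly_Mapping.keys m" "card A = d" "finite A"
    using obtain_subset_with_card_n[OF assms] by blast
  let ?g = "\<Sum>i\<in>A. Poly_Mapping.single i (1::nat)"
  have lg: "Poly_Mapping.lookup ?g i = (if i \<in> A then 1 else 0)" for i
    by (rule lookup_sum_singles[OF A(3)])
  have "m = ?g + (m - ?g)"
  proof (rule poly_mapping_eqI)
    fix i
    have "1 \<le> Poly_Mapping.lookup m i" if "i \<in> A"
      using A(1) that by (auto simp: in_keys_iff Suc_le_eq)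
    then show "Poly_Mapping.lookup m i = Poly_Mapping.lookup (?g + (m - ?g)) i"
      by (simp only: lookup_add lookup_minus lg) auto
  qed
  moreover have "monomial_degree ?g = card A"
    using A(3) by (induction A rule: finite_induct) (simp_all add: monomial_degree_add)
  ultimately show ?thesis using A(2) lg by (intro exI[of _ ?g] exI[of _ "m - ?g"]) simp
qed

lemma card_keys_squarefree:
  assumes "\<forall>i. Poly_Mapping.lookup g i \<le> (1::nat)"
  shows "card (Poly_Mapping.keys g) = monomial_degree g"
proof -
  have "Poly_Mapping.lookup g i = 1" if "i \<in> Poly_Mapping.keys g" for i
    using assms[rule_format, of i] that by (simp add: in_keys_iff)
  then show ?thesis by (simp add: monomial_degree_def)
qed

lemma squarefree_veronese_eq:
  "squarefree_veronese n d = (supported_on {u \<in> monomials n. d \<le> card (Poly_Mapping.keys u)} :: 'k::field mpoly set)"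
proof -
  let ?G = "{m \<in> monomials n. monomial_degree m = d \<and> (\<forall>i. Poly_Mapping.lookup m i \<le> 1)}"
  have "{g + v | g v. g \<in> ?G \<and> v \<in> monomials n} = {u \<in> monomials n. d \<le> card (Poly_Mapping.keys u)}"
  proof (intro equalityI subsetI)
    fix u assume "u \<in> {u \<in> monomials n. d \<le> card (Poly_Mapping.keys u)}"
    then obtain g v where gv: "u = g + v" "monomial_degree g = d" "\<forall>i. Poly_Mapping.lookup g i \<le> 1" "u \<in> monomials n"
      using squarefree_factor[of d u] by blast
    then have "g \<in> ?G" "v \<in> monomials n" using add_in_monomialsD[of g v n] by auto
    then show "u \<in> {g + v | g v. g \<in> ?G \<and> v \<in> monomials n}" using gv(1) by blast
  next
    fix u assume "u \<in> {g + v | g v. g \<in> ?G \<and> v \<in> monomials n}"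
    then obtain g v where gv: "u = g + v" "g \<in> ?G" "v \<in> monomials n" by blast
    have "d = card (Poly_Mapping.keys g)" using gv(2) card_keys_squarefree[of g] by simp
    also have "\<dots> \<le> card (Poly_Mapping.keys u)" by (rule card_mono) (auto simp: gv(1) keys_add_nat)
    finally show "u \<in> {u \<in> monomials n. d \<le> card (Poly_Mapping.keys u)}"
      using gv by (simp add: add_in_monomials)
  qed
  moreover have "{Poly_Mapping.single m (1::'k) | m.
          Poly_Mapping.keys m \<subseteq> {1..n} \<and> monomial_degree m = d \<and> (\<forall>i. Poly_Mapping.lookup m i \<le> 1)}
     = {Poly_Mapping.single m 1 | m. m \<in> ?G}"
    by (simp add: monomials_def)
  ultimately show ?thesis
    unfolding squarefree_veronese_def
    using genideal_monomials[of ?G n, where 'k = 'k] by auto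
qed

section \<open>The Hilbert depths of the two ideals\<close>

theorem theorem1p4:
  fixes n d :: nat
  assumes "1 \<le> d" and "d \<le> n"
  shows "Hdepth (ring_of_type_algebra :: 'k::field ring) (polynomial_ring (n - d + 1))
             (ideal_module (polynomial_ring (n - d + 1)) (maximal_ideal_power (n - d + 1) d))
           + enat (d - 1)
         = Hdepth (ring_of_type_algebra :: 'k ring) (polynomial_ring n)
             (ideal_module (polynomial_ring n) (squarefree_veronese n d))"
proof -
  obtain e where d: "d = Suc e" using assms(1) by (cases d) auto
  \<comment> \<open>The Hilbert function lemmas use \<open>d = e + 1\<close>, which avoids truncated subtraction.\<close>
  have e: "e < n" "n - d + 1 = n - e" "d - 1 = e" using assms d by auto
  have "(\<lambda>t. card {m \<in> {u \<in> monomials (n - e). d \<le> monomial_degree u}. int (monomial_degree m) = t}) =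
      power_hilbert (n - e) (Suc e)"
    unfolding d by (rule ext) (rule power_hilbert_def[symmetric])
  moreover have "(\<lambda>t. card {m \<in> {u \<in> monomials n. d \<le> card (Poly_Mapping.keys u)}. int (monomial_degree m) = t}) =
      veronese_hilbert n (Suc e)"
    unfolding d by (rule ext) (rule veronese_hilbert_def[symmetric])
  ultimately show ?thesis
    unfolding maximal_ideal_power_eq squarefree_veronese_eq e(2,3)
    using Max_pairs_veronese[OF e(1)]
    by (simp only: Hdepth_supported_on[OF Collect_restrict])
qed

end
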